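(* For every $n\ge0$ the complex $\mathcal{M}_n$ is obtained by pasting two copies $\mathcal{T}_n$ and $\mathcal{T}_n\cdot a$ of $\mathcal{T}_n$ along the sets $K_{a,n}$, $K_{b,n}$, $K_{c,n}$, $K_{a\alpha,n}$, $K_{b\beta,n}$, $K_{c\gamma,n}$, $K_{a\alpha\gamma,n}$, $K_{\alpha c,n}$ by the action of the respective maps $\kappa_{g,n}$ (i.e., identifying a point $\xi\in K_{g,n}$ of one copy with the point $\kappa_{g,n}(\xi)\cdot a$ in the other copy), and pasting the sets $K_{\alpha,n}$, $K_{\beta,n}$, $K_{\gamma,n}$ to themselves (inside each of the two copies) by the respective maps $\kappa_{g,n}$ (i.e., identifying $\xi$ with $\kappa_{g,n}(\xi)$ in $\mathcal T_n$ and $\xi\cdot a$ with $\kappa_{g,n}(\xi)\cdot a$ in $\mathcal T_n\cdot a$).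
   Context: Let $\mathsf{X}=\{1,2,3,4\}$ and $\mathsf{X}^*$ the rooted tree of finite words. For a permutation $\tau$ of $\mathsf{X}$ and automorphisms $g_i$ of $\mathsf{X}^*$, $\tau(g_1,g_2,g_3,g_4)$ denotes $xv\mapsto\tau(x)g_x(v)$ (trivial entries omitted). Left actions; $\varepsilon$ is the identity. Sections: $g(xv)=g(x)\,g|_x(v)$, $g|_{xv}=g|_x|_v$. Let $\sigma=(1\,2)(3\,4)$, $\pi=(1\,3)(2\,4)$. $\Gamma$ is generated by $\alpha=\sigma$, $a=\pi$, $\beta=(\alpha,\gamma,\alpha,\gamma)$, $b=(a\alpha,a\alpha,c,c)$, $\gamma=(\beta,\varepsilon,\varepsilon,\beta)$, $c=(b\beta,b\beta,b,b)$. The elements $\alpha,\beta,\gamma,a,b,c,a\alpha,b\beta,c\gamma,a\alpha\gamma,\alpha c$ are involutions. $\Gamma_A=\langle\beta,\gamma,b,c\rangle$, $\Gamma_B=\langle\alpha,\gamma,a,c\rangle$, $\Gamma_C=\langle\alpha,\beta,a,b\rangle$, $\Gamma_{A_1}=\langle\alpha,b,c\rangle$, $\Gamma_{B_1}=\langle\beta,a,c\gamma\rangle$, $\Gamma_{C_1}=\langle\gamma,a\alpha,b\beta\rangle$. $\mathcal{G}$ is the set of these six finite groups and all their pairwise and triple intersections. $\Xi$ is the simplicial complex of chains of the poset of subsets $G\cdot g\subset\Gamma$ ($G\in\mathcal{G}$, $g\in\Gamma$), with $\Gamma$ acting by right translations; $\mathcal{T}_0\subset\Xi$ is the subcomplex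 of chains in $\mathcal{G}$. Bimodule: $\mathfrak{M}^{\otimes n}=\mathsf{X}^n\times\Gamma$, elements $v\cdot h$, with $(v\cdot h)\cdot g=v\cdot hg$, $g\cdot(v\cdot h)=g(v)\cdot g|_vh$. $\Xi_n=\Xi\otimes\mathfrak{M}^{\otimes n}$ is the quotient of $\Xi\times\mathfrak{M}^{\otimes n}$ by $\xi\cdot g\otimes m=\xi\otimes g\cdot m$, with the right action $(\xi\otimes m)\cdot g=\xi\otimes m\cdot g$. $\mathcal{T}_n=\{\xi\otimes v:\xi\in\mathcal{T}_0,v\in\mathsf{X}^n\}\subset\Xi_n$. $K_{g,n}=\mathcal{T}_n\cap\mathcal{T}_n\cdot g$ and $\kappa_{g,n}:K_{g,n}\to K_{g^{-1},n}$ is $\xi\mapsto\xi\cdot g^{-1}$. $\mathrm{IMG}(f)$ denotes the index two subgroup $\langle\alpha,\beta,\gamma,ab,bc\rangle$ of $\Gamma$ (isomorphic to the iterated monodromy group of $f(z,w)=((1-2z/w)^2,(1-2/w)^2)$), and $\mathcal{M}_n=\Xi_n/\mathrm{IMG}(f)$; the copies $\mathcal{T}_n$ and $\mathcal{T}_n\cdot a$ are mapped to $\mathcal{M}_n$ by the quotient map. *)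

theory Defs
  imports "HOL-Analysis.Analysis" "HOL-Algebra.Coset" "HOL-Algebra.Generated_Groups"
begin

section \<open>Quotients of topological spaces\<close>

definition generated_equiv :: "'a set \<Rightarrow> ('a \<times> 'a) set \<Rightarrow> ('a \<times> 'a) set" where
  "generated_equiv A R = (R \<union> R\<inverse>)\<^sup>* \<inter> A \<times> A"

lemma equiv_generated_equiv: "equiv A (generated_equiv A R)"
proof (rule equivI)
  have "sym (R \<union> R\<inverse>)"
    by (rule sym_Un_converse)
  then show "sym (generated_equiv A R)"
    unfolding generated_equiv_def by (intro sym_Int sym_rtrancl) (auto intro: symI)
  show "trans (generated_equiv A R)"
    unfolding generated_equiv_def
    by (intro trans_Int trans_rtrancl) (auto intro: transI)
qed (auto simp: generated_equiv_def refl_on_def)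

lemma generated_equiv_least:
  assumes "R \<subseteq> A \<times> A" "equiv A E" "R \<subseteq> E"
  shows "R \<subseteq> generated_equiv A R" "generated_equiv A R \<subseteq> E"
proof -
  show "R \<subseteq> generated_equiv A R"
    using assms(1) unfolding generated_equiv_def by auto
  have E: "sym E" "trans E" "refl_on A E"
    using assms(2) unfolding equiv_def by auto
  have "(x, y) \<in> E" if "(x, y) \<in> (R \<union> R\<inverse>)\<^sup>*" "x \<in> A" for x y
    using that
  proof (induction rule: rtrancl_induct)
    case base
    then show ?case using E(3) unfolding refl_on_def by blast
  next
    case (step y z)
    then have "(y, z) \<in> E" using assms(3) E(1) unfolding sym_def by blast
    then show ?case using step E(2) unfolding trans_def by blast
  qed
  then show "generated_equiv A R \<subseteq> E"
    unfolding generated_equiv_def by auto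
qed

definition quotient_class :: "'a topology \<Rightarrow> ('a \<times> 'a) set \<Rightarrow> 'a \<Rightarrow> 'a set" where
  "quotient_class X R x = generated_equiv (topspace X) R `` {x}"

definition quotient_space :: "'a topology \<Rightarrow> ('a \<times> 'a) set \<Rightarrow> 'a set topology" where
  "quotient_space X R = topology (\<lambda>U. U \<subseteq> quotient_class X R ` topspace X \<and>
     openin X {x \<in> topspace X. quotient_class X R x \<in> U})"

lemma openin_quotient_space:
  "openin (quotient_space X R) U \<longleftrightarrow> U \<subseteq> quotient_class X R ` topspace X \<and>
     openin X {x \<in> topspace X. quotient_class X R x \<in> U}"
proof -
  let ?q = "quotient_class X R"
  let ?P = "\<lambda>U. U \<subseteq> ?q ` topspace X \<and> openin X {x \<in> topspace X. ?q x \<in> U}"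
  have "istopology ?P"
    unfolding istopology_def
  proof (intro conjI allI impI)
    fix S T assume S: "?P S" and T: "?P T"
    have "{x \<in> topspace X. ?q x \<in> S \<inter> T} =
          {x \<in> topspace X. ?q x \<in> S} \<inter> {x \<in> topspace X. ?q x \<in> T}"
      by auto
    then show "openin X {x \<in> topspace X. ?q x \<in> S \<inter> T}"
      using openin_Int[OF conjunct2[OF S] conjunct2[OF T]] by simp
    show "S \<inter> T \<subseteq> ?q ` topspace X" using S by blast
  next
    fix K assume K: "\<forall>S\<in>K. ?P S"
    have "{x \<in> topspace X. ?q x \<in> \<Union>K} = (\<Union>S\<in>K. {x \<in> topspace X. ?q x \<in> S})"
      by auto
    then show "openin X {x \<in> topspace X. ?q x \<in> \<Union>K}"
      using openin_Union[of "(\<lambda>S. {x \<in> topspace X. ?q x \<in> S}) ` K" X] K by auto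
    show "\<Union>K \<subseteq> ?q ` topspace X" using K by blast
  qed
  then show ?thesis
    unfolding quotient_space_def by (simp add: topology_inverse')
qed


section \<open>Geometric realization of simplicial complexes\<close>

text \<open>A simplicial complex is a set of finite nonempty sets of vertices, and a point of its
  realization is given by its barycentric coordinates. The realization carries the weak topology;
  every closed simplex has the Euclidean topology, which is induced by the product topology on
  functions.\<close>

definition closed_simplex :: "'v set \<Rightarrow> ('v \<Rightarrow> real) set" where
  "closed_simplex s = {\<xi>. (\<forall>v. 0 \<le> \<xi> v) \<and> (\<forall>v. v \<notin> s \<longrightarrow> \<xi> v = 0) \<and> (\<Sum>v\<in>s. \<xi> v) = 1}"

definition realization :: "'v set set \<Rightarrow> ('v \<Rightarrow> real) set" where
  "realization K = (\<Union>s\<in>K. closed_simplex s)"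

definition realization_topology :: "'v set set \<Rightarrow> ('v \<Rightarrow> real) topology" where
  "realization_topology K = topology (\<lambda>U. U \<subseteq> realization K \<and>
     (\<forall>s\<in>K. openin (top_of_set (closed_simplex s)) (U \<inter> closed_simplex s)))"

lemma openin_realization_topology:
  "openin (realization_topology K) U \<longleftrightarrow> U \<subseteq> realization K \<and>
     (\<forall>s\<in>K. openin (top_of_set (closed_simplex s)) (U \<inter> closed_simplex s))"
proof -
  let ?P = "\<lambda>U. U \<subseteq> realization K \<and>
     (\<forall>s\<in>K. openin (top_of_set (closed_simplex s)) (U \<inter> closed_simplex s))"
  have "istopology ?P"
    unfolding istopology_def
  proof (intro conjI allI impI ballI)
    fix S T s assume "?P S" "?P T" "s \<in> K"
    then have "openin (top_of_set (closed_simplex s))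
        ((S \<inter> closed_simplex s) \<inter> (T \<inter> closed_simplex s))"
      by (blast intro: openin_Int)
    moreover have "(S \<inter> closed_simplex s) \<inter> (T \<inter> closed_simplex s) = S \<inter> T \<inter> closed_simplex s"
      by blast
    ultimately show "openin (top_of_set (closed_simplex s)) (S \<inter> T \<inter> closed_simplex s)"
      by (simp only:)
  next
    fix S T assume "?P S"
    then show "S \<inter> T \<subseteq> realization K" by blast
  next
    fix \<U> s assume \<U>: "\<forall>S\<in>\<U>. ?P S" and s: "s \<in> K"
    have "openin (top_of_set (closed_simplex s)) (\<Union>((\<lambda>S. S \<inter> closed_simplex s) ` \<U>))"
      by (rule openin_Union) (use \<U> s in blast)
    then show "openin (top_of_set (closed_simplex s)) (\<Union>\<U> \<inter> closed_simplex s)"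
      by (simp only: Int_Union2)
  next
    fix \<U> assume "\<forall>S\<in>\<U>. ?P S"
    then show "\<Union>\<U> \<subseteq> realization K" by blast
  qed
  then show ?thesis
    unfolding realization_topology_def by (simp add: topology_inverse')
qed

lemma topspace_realization_topology: "topspace (realization_topology K) = realization K"
proof -
  have "openin (realization_topology K) (realization K)"
    unfolding openin_realization_topology
  proof (intro conjI ballI)
    fix s assume "s \<in> K"
    then have "realization K \<inter> closed_simplex s = closed_simplex s"
      unfolding realization_def by blast
    then show "openin (top_of_set (closed_simplex s)) (realization K \<inter> closed_simplex s)"
      by simp
  qed simp
  then have "realization K \<subseteq> topspace (realization_topology K)"
    by (rule openin_subset)
  moreover have "topspace (realization_topology K) \<subseteq> realization K"
    using openin_topspace[of "realization_topology K"]
    unfolding openin_realization_topology by blast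
  ultimately show ?thesis by blast
qed

definition finite_chains :: "'a set set \<Rightarrow> 'a set set set" where
  "finite_chains P = {s. s \<noteq> {} \<and> finite s \<and> s \<subseteq> P \<and> chain\<^sub>\<subseteq> s}"


section \<open>The tree and its automorphisms\<close>

datatype letter = X1 | X2 | X3 | X4

type_synonym word = "letter list"

text \<open>The vertex \<open>v\<close> is adjacent to the vertices \<open>v @ [x]\<close>.\<close>

definition tree_automorphisms :: "(word \<Rightarrow> word) set" where
  "tree_automorphisms = {g. bij g \<and> g [] = [] \<and> (\<forall>v x. \<exists>y. g (v @ [x]) = g v @ [y])}"

definition Aut_tree :: "(word \<Rightarrow> word) monoid" where
  "Aut_tree = \<lparr>carrier = tree_automorphisms, mult = (\<circ>), one = id\<rparr>"

lemma length_tree_automorphism: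
  assumes "g \<in> tree_automorphisms" shows "length (g v) = length v"
proof (induction v rule: rev_induct)
  case Nil
  then show ?case using assms by (simp add: tree_automorphisms_def)
next
  case (snoc x v)
  obtain y where "g (v @ [x]) = g v @ [y]"
    using assms by (auto simp: tree_automorphisms_def)
  then show ?case using snoc by simp
qed

lemma group_Aut_tree: "group Aut_tree"
proof (rule groupI)
  fix g h assume g: "g \<in> carrier Aut_tree" and h: "h \<in> carrier Aut_tree"
  have "\<exists>y. g (h (v @ [x])) = g (h v) @ [y]" for v x
  proof -
    obtain z where "h (v @ [x]) = h v @ [z]"
      using h by (auto simp: Aut_tree_def tree_automorphisms_def)
    then show ?thesis
      using g by (simp add: Aut_tree_def tree_automorphisms_def)
  qed
  then show "g \<otimes>\<^bsub>Aut_tree\<^esub> h \<in> carrier Aut_tree"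
    using g h by (auto simp: Aut_tree_def tree_automorphisms_def bij_comp)
next
  fix g assume "g \<in> carrier Aut_tree"
  then have g: "g \<in> tree_automorphisms" by (simp add: Aut_tree_def)
  then have b: "bij g" and e: "g [] = []" by (auto simp: tree_automorphisms_def)
  have "\<exists>y. inv_into UNIV g (v @ [x]) = inv_into UNIV g v @ [y]" for v x
  proof -
    have surj: "g (inv_into UNIV g u) = u" for u
      using b by (simp add: bij_is_surj surj_f_inv_f)
    have inj: "inv_into UNIV g (g u) = u" for u
      using b by (simp add: bij_is_inj)
    define w where "w = inv_into UNIV g (v @ [x])"
    have w: "g w = v @ [x]" using surj by (simp add: w_def)
    have "length w = Suc (length v)"
      using length_tree_automorphism[OF g, of w] w by simp
    then obtain u y where u: "w = u @ [y]" by (metis length_Suc_conv_rev)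
    then obtain z where "g w = g u @ [z]" using g by (auto simp: tree_automorphisms_def)
    then have "g u = v" using w by simp
    then have "inv_into UNIV g v = u" using inj by blast
    then show ?thesis using u unfolding w_def by blast
  qed
  moreover have "bij (inv_into UNIV g)"
    using b by (rule bij_imp_bij_inv)
  moreover have "inv_into UNIV g [] = []"
    using inv_into_f_f[OF bij_is_inj[OF b], of "[]"] e by simp
  ultimately have "inv_into UNIV g \<in> carrier Aut_tree"
    by (simp add: Aut_tree_def tree_automorphisms_def)
  moreover have "inv_into UNIV g \<otimes>\<^bsub>Aut_tree\<^esub> g = \<one>\<^bsub>Aut_tree\<^esub>"
    using b by (simp add: Aut_tree_def bij_is_inj)
  ultimately show "\<exists>h\<in>carrier Aut_tree. h \<otimes>\<^bsub>Aut_tree\<^esub> g = \<one>\<^bsub>Aut_tree\<^esub>" by blast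
qed (auto simp: Aut_tree_def tree_automorphisms_def comp_assoc)

text \<open>The section \<open>g|\<^sub>u\<close>, determined by \<open>g (u @ v) = g u @ section_at g u v\<close>.\<close>

primrec section_at :: "(word \<Rightarrow> word) \<Rightarrow> word \<Rightarrow> word \<Rightarrow> word" where
  "section_at g [] = g"
| "section_at g (x # u) = section_at (\<lambda>v. tl (g (x # v))) u"

text \<open>\<open>wreath \<tau> g1 g2 g3 g4\<close> is the automorphism \<open>\<tau>(g1, g2, g3, g4)\<close>.\<close>

fun wreath :: "(letter \<Rightarrow> letter) \<Rightarrow> (word \<Rightarrow> word) \<Rightarrow> (word \<Rightarrow> word) \<Rightarrow> (word \<Rightarrow> word) \<Rightarrow>
    (word \<Rightarrow> word) \<Rightarrow> word \<Rightarrow> word" where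
  "wreath \<tau> g1 g2 g3 g4 [] = []"
| "wreath \<tau> g1 g2 g3 g4 (X1 # v) = \<tau> X1 # g1 v"
| "wreath \<tau> g1 g2 g3 g4 (X2 # v) = \<tau> X2 # g2 v"
| "wreath \<tau> g1 g2 g3 g4 (X3 # v) = \<tau> X3 # g3 v"
| "wreath \<tau> g1 g2 g3 g4 (X4 # v) = \<tau> X4 # g4 v"

fun perm_sigma :: "letter \<Rightarrow> letter" where
  "perm_sigma X1 = X2" | "perm_sigma X2 = X1" | "perm_sigma X3 = X4" | "perm_sigma X4 = X3"

fun perm_pi :: "letter \<Rightarrow> letter" where
  "perm_pi X1 = X3" | "perm_pi X3 = X1" | "perm_pi X2 = X4" | "perm_pi X4 = X2"


section \<open>The group\<close>

definition gen_alpha :: "word \<Rightarrow> word" where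
  "gen_alpha = wreath perm_sigma id id id id"

definition gen_a :: "word \<Rightarrow> word" where
  "gen_a = wreath perm_pi id id id id"

text \<open>The generators \<open>\<beta>\<close>, \<open>\<gamma>\<close>, \<open>b\<close>, \<open>c\<close> are defined by recursion on words; their defining
  wreath recursions are the lemmas below.\<close>

fun gen_beta :: "word \<Rightarrow> word" and gen_gamma :: "word \<Rightarrow> word" where
  "gen_beta [] = []"
| "gen_beta (X1 # v) = X1 # gen_alpha v"
| "gen_beta (X2 # v) = X2 # gen_gamma v"
| "gen_beta (X3 # v) = X3 # gen_alpha v"
| "gen_beta (X4 # v) = X4 # gen_gamma v"
| "gen_gamma [] = []"
| "gen_gamma (X1 # v) = X1 # gen_beta v"
| "gen_gamma (X2 # v) = X2 # v"
| "gen_gamma (X3 # v) = X3 # v"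
| "gen_gamma (X4 # v) = X4 # gen_beta v"

lemma length_gen_alpha [simp]: "length (gen_alpha v) = length v"
proof (cases v)
  case (Cons x u)
  then show ?thesis by (cases x) (auto simp: gen_alpha_def)
qed (simp add: gen_alpha_def)

lemma length_gen_beta_gamma [simp]:
  "length (gen_beta v) = length v" "length (gen_gamma v) = length v"
  by (induction v and v rule: gen_beta_gen_gamma.induct) auto

function gen_b :: "word \<Rightarrow> word" and gen_c :: "word \<Rightarrow> word" where
  "gen_b [] = []"
| "gen_b (X1 # v) = X1 # gen_a (gen_alpha v)"
| "gen_b (X2 # v) = X2 # gen_a (gen_alpha v)"
| "gen_b (X3 # v) = X3 # gen_c v"
| "gen_b (X4 # v) = X4 # gen_c v"
| "gen_c [] = []"
| "gen_c (X1 # v) = X1 # gen_b (gen_beta v)"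
| "gen_c (X2 # v) = X2 # gen_b (gen_beta v)"
| "gen_c (X3 # v) = X3 # gen_b v"
| "gen_c (X4 # v) = X4 # gen_b v"
  by pat_completeness auto
termination
  by (relation "Wellfounded.measure (\<lambda>p. case p of Inl v \<Rightarrow> length v | Inr v \<Rightarrow> length v)") auto

lemma gen_beta_wreath: "gen_beta = wreath id gen_alpha gen_gamma gen_alpha gen_gamma"
proof
  fix v show "gen_beta v = wreath id gen_alpha gen_gamma gen_alpha gen_gamma v"
    by (cases "(id :: letter \<Rightarrow> letter, gen_alpha, gen_gamma, gen_alpha, gen_gamma, v)"
        rule: wreath.cases) auto
qed

lemma gen_gamma_wreath: "gen_gamma = wreath id gen_beta id id gen_beta"
proof
  fix v show "gen_gamma v = wreath id gen_beta id id gen_beta v"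
    by (cases "(id :: letter \<Rightarrow> letter, gen_alpha, gen_gamma, gen_alpha, gen_gamma, v)"
        rule: wreath.cases) auto
qed

lemma gen_b_wreath: "gen_b = wreath id (gen_a \<circ> gen_alpha) (gen_a \<circ> gen_alpha) gen_c gen_c"
proof
  fix v show "gen_b v = wreath id (gen_a \<circ> gen_alpha) (gen_a \<circ> gen_alpha) gen_c gen_c v"
    by (cases "(id :: letter \<Rightarrow> letter, gen_alpha, gen_gamma, gen_alpha, gen_gamma, v)"
        rule: wreath.cases) auto
qed

lemma gen_c_wreath: "gen_c = wreath id (gen_b \<circ> gen_beta) (gen_b \<circ> gen_beta) gen_b gen_b"
proof
  fix v show "gen_c v = wreath id (gen_b \<circ> gen_beta) (gen_b \<circ> gen_beta) gen_b gen_b v"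
    by (cases "(id :: letter \<Rightarrow> letter, gen_alpha, gen_gamma, gen_alpha, gen_gamma, v)"
        rule: wreath.cases) auto
qed

definition Gamma_group :: "(word \<Rightarrow> word) set" where
  "Gamma_group = generate Aut_tree {gen_alpha, gen_beta, gen_gamma, gen_a, gen_b, gen_c}"

definition IMG_group :: "(word \<Rightarrow> word) set" where
  "IMG_group = generate Aut_tree
     {gen_alpha, gen_beta, gen_gamma, gen_a \<circ> gen_b, gen_b \<circ> gen_c}"

definition six_groups :: "(word \<Rightarrow> word) set set" where
  "six_groups =
    {generate Aut_tree {gen_beta, gen_gamma, gen_b, gen_c},
     generate Aut_tree {gen_alpha, gen_gamma, gen_a, gen_c},
     generate Aut_tree {gen_alpha, gen_beta, gen_a, gen_b},
     generate Aut_tree {gen_alpha, gen_b, gen_c},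
     generate Aut_tree {gen_beta, gen_a, gen_c \<circ> gen_gamma},
     generate Aut_tree {gen_gamma, gen_a \<circ> gen_alpha, gen_b \<circ> gen_beta}}"

text \<open>The groups \<open>G\<close>, \<open>H\<close>, \<open>K\<close> need not be distinct, so this contains the six groups
  themselves and their pairwise intersections.\<close>

definition vertex_groups :: "(word \<Rightarrow> word) set set" where
  "vertex_groups = {G \<inter> H \<inter> K | G H K. G \<in> six_groups \<and> H \<in> six_groups \<and> K \<in> six_groups}"


section \<open>The complex \<open>\<Xi>\<close>\<close>

type_synonym xi_point = "(word \<Rightarrow> word) set \<Rightarrow> real"

definition Xi_vertices :: "(word \<Rightarrow> word) set set" where
  "Xi_vertices = {G #>\<^bsub>Aut_tree\<^esub> g | G g. G \<in> vertex_groups \<and> g \<in> Gamma_group}"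

definition Xi :: "xi_point topology" where
  "Xi = realization_topology (finite_chains Xi_vertices)"

text \<open>The affine extension of the action on vertices: the coordinate of \<open>\<xi> \<cdot> g\<close> at the
  vertex \<open>C \<cdot> g\<close> is the coordinate of \<open>\<xi>\<close> at \<open>C\<close>.\<close>

definition Xi_act :: "xi_point \<Rightarrow> (word \<Rightarrow> word) \<Rightarrow> xi_point" where
  "Xi_act \<xi> g = (\<lambda>C. \<xi> (C #>\<^bsub>Aut_tree\<^esub> inv\<^bsub>Aut_tree\<^esub> g))"

definition T0 :: "xi_point set" where
  "T0 = realization (finite_chains vertex_groups)"


section \<open>The complexes \<open>\<Xi>\<^sub>n\<close> and \<open>\<M>\<^sub>n\<close>\<close>

type_synonym bimodule_element = "word \<times> (word \<Rightarrow> word)"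

definition bimodule :: "nat \<Rightarrow> bimodule_element set" where
  "bimodule n = {v. length v = n} \<times> Gamma_group"

definition bimodule_right :: "bimodule_element \<Rightarrow> (word \<Rightarrow> word) \<Rightarrow> bimodule_element" where
  "bimodule_right m g = (fst m, snd m \<circ> g)"

definition bimodule_left :: "(word \<Rightarrow> word) \<Rightarrow> bimodule_element \<Rightarrow> bimodule_element" where
  "bimodule_left g m = (g (fst m), section_at g (fst m) \<circ> snd m)"

definition Xi_times_bimodule :: "nat \<Rightarrow> (xi_point \<times> bimodule_element) topology" where
  "Xi_times_bimodule n = prod_topology Xi (discrete_topology (bimodule n))"

definition tensor_rel ::
  "nat \<Rightarrow> ((xi_point \<times> bimodule_element) \<times> (xi_point \<times> bimodule_element)) set" where
  "tensor_rel n = {((Xi_act \<xi> g, m), (\<xi>, bimodule_left g m)) | \<xi> g m.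
     \<xi> \<in> topspace Xi \<and> g \<in> Gamma_group \<and> m \<in> bimodule n}"

type_synonym xin_point = "(xi_point \<times> bimodule_element) set"

definition Xi_n :: "nat \<Rightarrow> xin_point topology" where
  "Xi_n n = quotient_space (Xi_times_bimodule n) (tensor_rel n)"

definition tensor :: "nat \<Rightarrow> xi_point \<Rightarrow> bimodule_element \<Rightarrow> xin_point" where
  "tensor n \<xi> m = quotient_class (Xi_times_bimodule n) (tensor_rel n) (\<xi>, m)"

text \<open>A point of \<open>\<Xi>\<^sub>n\<close> is an equivalence class; \<open>(\<xi> \<otimes> m) \<cdot> g = \<xi> \<otimes> m \<cdot> g\<close> is applied to all its
  representatives.\<close>

definition Xi_n_act :: "xin_point \<Rightarrow> (word \<Rightarrow> word) \<Rightarrow> xin_point" where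
  "Xi_n_act p g = (\<lambda>(\<xi>, m). (\<xi>, bimodule_right m g)) ` p"

definition Xi_n_cells :: "nat \<Rightarrow> xin_point set set" where
  "Xi_n_cells n = {(\<lambda>\<xi>. tensor n \<xi> m) ` closed_simplex s | s m.
     s \<in> finite_chains Xi_vertices \<and> m \<in> bimodule n}"

definition T_n :: "nat \<Rightarrow> xin_point set" where
  "T_n n = {tensor n \<xi> (v, id) | \<xi> v. \<xi> \<in> T0 \<and> length v = n}"

definition T_n_cells :: "nat \<Rightarrow> xin_point set set" where
  "T_n_cells n = {(\<lambda>\<xi>. tensor n \<xi> (v, id)) ` closed_simplex s | s v.
     s \<in> finite_chains vertex_groups \<and> length v = n}"

definition IMG_orbit_rel :: "nat \<Rightarrow> (xin_point \<times> xin_point) set" where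
  "IMG_orbit_rel n = {(p, Xi_n_act p g) | p g. p \<in> topspace (Xi_n n) \<and> g \<in> IMG_group}"

definition M_n :: "nat \<Rightarrow> xin_point set topology" where
  "M_n n = quotient_space (Xi_n n) (IMG_orbit_rel n)"

definition M_n_proj :: "nat \<Rightarrow> xin_point \<Rightarrow> xin_point set" where
  "M_n_proj n = quotient_class (Xi_n n) (IMG_orbit_rel n)"

definition M_n_cells :: "nat \<Rightarrow> xin_point set set set" where
  "M_n_cells n = (\<lambda>c. M_n_proj n ` c) ` Xi_n_cells n"


section \<open>Pasting two copies of \<open>\<T>\<^sub>n\<close>\<close>

definition K_set :: "(word \<Rightarrow> word) \<Rightarrow> nat \<Rightarrow> xin_point set" where
  "K_set g n = T_n n \<inter> (\<lambda>p. Xi_n_act p g) ` T_n n"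

definition kappa :: "(word \<Rightarrow> word) \<Rightarrow> xin_point \<Rightarrow> xin_point" where
  "kappa g p = Xi_n_act p (inv\<^bsub>Aut_tree\<^esub> g)"

text \<open>The disjoint union of the two copies: points \<open>(False, p)\<close> with \<open>p\<close> in \<open>\<T>\<^sub>n\<close> and points
  \<open>(True, q)\<close> with \<open>q\<close> in \<open>\<T>\<^sub>n \<cdot> a\<close>. (As subsets of \<open>\<Xi>\<^sub>n\<close> the two copies intersect.)\<close>

definition two_copies :: "nat \<Rightarrow> (bool \<times> xin_point) topology" where
  "two_copies n = sum_topology
     (\<lambda>i. subtopology (Xi_n n) (if i then (\<lambda>p. Xi_n_act p gen_a) ` T_n n else T_n n)) UNIV"

definition crossing_elements :: "(word \<Rightarrow> word) set" where
  "crossing_elements =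
    {gen_a, gen_b, gen_c, gen_a \<circ> gen_alpha, gen_b \<circ> gen_beta, gen_c \<circ> gen_gamma,
     gen_a \<circ> gen_alpha \<circ> gen_gamma, gen_alpha \<circ> gen_c}"

definition pasting_rel :: "nat \<Rightarrow> ((bool \<times> xin_point) \<times> (bool \<times> xin_point)) set" where
  "pasting_rel n =
     {((False, p), (True, Xi_n_act (kappa g p) gen_a)) | g p.
        g \<in> crossing_elements \<and> p \<in> K_set g n}
   \<union> {((False, p), (False, kappa g p)) | g p.
        g \<in> {gen_alpha, gen_beta, gen_gamma} \<and> p \<in> K_set g n}
   \<union> {((True, Xi_n_act p gen_a), (True, Xi_n_act (kappa g p) gen_a)) | g p.
        g \<in> {gen_alpha, gen_beta, gen_gamma} \<and> p \<in> K_set g n}"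

definition pasted :: "nat \<Rightarrow> (bool \<times> xin_point) set topology" where
  "pasted n = quotient_space (two_copies n) (pasting_rel n)"

definition pasted_proj :: "nat \<Rightarrow> bool \<times> xin_point \<Rightarrow> (bool \<times> xin_point) set" where
  "pasted_proj n = quotient_class (two_copies n) (pasting_rel n)"

definition pasted_cells :: "nat \<Rightarrow> (bool \<times> xin_point) set set set" where
  "pasted_cells n =
     {(\<lambda>p. pasted_proj n (False, p)) ` c | c. c \<in> T_n_cells n}
   \<union> {(\<lambda>p. pasted_proj n (True, Xi_n_act p gen_a)) ` c | c. c \<in> T_n_cells n}"

end

theory Submission
  imports Defs
begin

text \<open>
  Every point of \<open>\<Xi>\<^sub>n\<close> is of the form \<open>(\<xi> \<otimes> v) \<cdot> h\<close> with \<open>\<xi>\<close> in \<open>T0\<close>, and \<open>\<xi> \<otimes> v = (\<xi> \<otimes> g(v)) \<cdot> g|\<^sub>v\<close> for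
  \<open>g\<close> in the least group \<open>G\<close> supporting \<open>\<xi>\<close>; there are no other coincidences. Modulo the even subgroup
  only the parity of the number of letters \<open>a\<close>, \<open>b\<close>, \<open>c\<close> in \<open>h\<close> matters, so \<open>\<M>\<^sub>n\<close> is covered by the two
  copies, and its identifications are indexed by the elements \<open>g\<close> of the groups \<open>G\<close>. It remains to
  reduce them to the listed ones.

  The eleven listed elements together with the identity form a set \<open>N\<close> of involutions that is closed
  under sections. So it suffices that each \<open>G\<close> is generated by \<open>G \<inter> N\<close>. Each of the six groups is a
  product of a subgroup of \<open>\<langle>\<alpha>, \<beta>, \<gamma>\<rangle>\<close> and a set of representatives of a dihedral quotient that acts on
  the binary tree of blocks \<open>{1, 2}\<close>, \<open>{3, 4}\<close>. Comparing these factorizations, two different groups among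
  \<open>\<Gamma>\<^sub>A\<close>, \<open>\<Gamma>\<^sub>B\<close>, \<open>\<Gamma>\<^sub>C\<close>, or among \<open>\<Gamma>\<^bsub>A1\<^esub>\<close>, \<open>\<Gamma>\<^bsub>B1\<^esub>\<close>, \<open>\<Gamma>\<^bsub>C1\<^esub>\<close>, meet inside \<open>N\<close>; this settles all triple
  intersections, and only the nine mixed pairs need an extra argument.

  The parity is well defined because a trivial word with an odd number of letters \<open>a\<close>, \<open>b\<close>, \<open>c\<close> would
  have ever shorter trivial sections of the same kind. Finally, every simplex of \<open>\<Xi>\<^sub>n\<close> is carried by the even
  subgroup affinely onto a simplex of one of the copies, so that \<open>\<M>\<^sub>n\<close> is a topological quotient of their
  disjoint union.
\<close>

section \<open>Words in the generators\<close>

text \<open>Words are kept apart from the automorphisms they denote: letters can be counted only in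
  a word, and the evaluation of \<open>act\<close> on test words needs executable data.\<close>

datatype generator = G\<alpha> | G\<beta> | G\<gamma> | Ga | Gb | Gc

primrec gen_act :: "generator \<Rightarrow> word \<Rightarrow> word" where
  "gen_act G\<alpha> = gen_alpha"
| "gen_act G\<beta> = gen_beta"
| "gen_act G\<gamma> = gen_gamma"
| "gen_act Ga = gen_a"
| "gen_act Gb = gen_b"
| "gen_act Gc = gen_c"

primrec act :: "generator list \<Rightarrow> word \<Rightarrow> word" where
  "act [] v = v"
| "act (s # w) v = gen_act s (act w v)"

lemma act_append: "act (u @ w) = act u \<circ> act w"
  by (induction u) auto

lemma gen_alpha_simps [simp]:
  "gen_alpha [] = []" "gen_alpha (x # v) = perm_sigma x # v"
  by (simp_all add: gen_alpha_def) (cases x; simp)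

lemma gen_a_simps [simp]:
  "gen_a [] = []" "gen_a (x # v) = perm_pi x # v"
  by (simp_all add: gen_a_def) (cases x; simp)

fun gen_top :: "generator \<Rightarrow> letter \<Rightarrow> letter" where
  "gen_top G\<alpha> x = perm_sigma x"
| "gen_top Ga x = perm_pi x"
| "gen_top _ x = x"

fun gen_section :: "generator \<Rightarrow> letter \<Rightarrow> generator list" where
  "gen_section G\<alpha> x = []"
| "gen_section Ga x = []"
| "gen_section G\<beta> x = (if x \<in> {X1, X3} then [G\<alpha>] else [G\<gamma>])"
| "gen_section G\<gamma> x = (if x \<in> {X1, X4} then [G\<beta>] else [])"
| "gen_section Gb x = (if x \<in> {X1, X2} then [Ga, G\<alpha>] else [Gc])"
| "gen_section Gc x = (if x \<in> {X1, X2} then [Gb, G\<beta>] else [Gb])"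

lemma gen_act_Nil [simp]: "gen_act s [] = []"
  by (cases s) auto

lemma gen_act_Cons: "gen_act s (x # v) = gen_top s x # act (gen_section s x) v"
  by (cases s; cases x) auto

primrec act_top :: "generator list \<Rightarrow> letter \<Rightarrow> letter" where
  "act_top [] x = x"
| "act_top (s # w) x = gen_top s (act_top w x)"

text \<open>The chain rule (fg)|x = f|g(x) g|x for words: the section of the outermost letter is
  taken at the image of \<open>x\<close> under the rest.\<close>

primrec act_section :: "generator list \<Rightarrow> letter \<Rightarrow> generator list" where
  "act_section [] x = []"
| "act_section (s # w) x = gen_section s (act_top w x) @ act_section w x"

lemma act_Nil [simp]: "act w [] = []"
  by (induction w) auto

lemma act_Cons: "act w (x # v) = act_top w x # act (act_section w x) v"
  by (induction w) (auto simp: gen_act_Cons act_append)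

section \<open>Relations between the generators\<close>

lemma perm_involution [simp]: "perm_sigma (perm_sigma x) = x" "perm_pi (perm_pi x) = x"
  "perm_sigma (perm_pi x) = perm_pi (perm_sigma x)"
  by (cases x; simp)+

lemma a_involution [simp]: "gen_a (gen_a v) = v"
  by (cases v) auto

lemma alpha_involution [simp]: "gen_alpha (gen_alpha v) = v"
  by (cases v) auto

lemma alpha_a_commute: "gen_alpha (gen_a v) = gen_a (gen_alpha v)"
  by (cases v) auto

text \<open>On each first letter, a relation unfolds into relations between the sections, so that all
  relations with mutually recursive unfoldings are proved at once, by induction on the length.\<close>

lemma beta_gamma_involution: "gen_beta (gen_beta v) = v \<and> gen_gamma (gen_gamma v) = v"
proof (induction v)
  case (Cons x v)
  then show ?case by (cases x) auto
qed auto

lemma beta_involution [simp]: "gen_beta (gen_beta v) = v"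
  and gamma_involution [simp]: "gen_gamma (gen_gamma v) = v"
  using beta_gamma_involution by auto

lemma beta_a_commute: "gen_beta (gen_a v) = gen_a (gen_beta v)"
proof (cases v)
  case (Cons x u)
  then show ?thesis by (cases x) auto
qed auto

lemma alpha_b_commute: "gen_alpha (gen_b v) = gen_b (gen_alpha v)"
proof (cases v)
  case (Cons x u)
  then show ?thesis by (cases x) auto
qed auto

lemma alpha_c_commute: "gen_alpha (gen_c v) = gen_c (gen_alpha v)"
proof (cases v)
  case (Cons x u)
  then show ?thesis by (cases x) auto
qed auto

lemma gamma_a_alpha_commute: "gen_gamma (gen_a (gen_alpha v)) = gen_a (gen_alpha (gen_gamma v))"
proof (cases v)
  case (Cons x u)
  then show ?thesis by (cases x) auto
qed auto

lemma b_c_relations: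
  "gen_b (gen_b v) = v \<and> gen_c (gen_c v) = v \<and>
   gen_beta (gen_b v) = gen_b (gen_beta v) \<and> gen_gamma (gen_c v) = gen_c (gen_gamma v)"
proof (induction "length v" arbitrary: v rule: less_induct)
  case less
  show ?case
  proof (cases v)
    case (Cons x u)
    \<comment> \<open>The section of c at 1 and 2 is b\<beta>, so instances at
      \<open>gen_beta u\<close> are needed besides those at \<open>u\<close>. This is why the
      induction is on the length, which \<beta> preserves.\<close>
    with less have "gen_b (gen_b u) = u" "gen_c (gen_c u) = u"
      "gen_beta (gen_b u) = gen_b (gen_beta u)" "gen_gamma (gen_c u) = gen_c (gen_gamma u)"
      "gen_b (gen_b (gen_beta u)) = gen_beta u"
      "gen_beta (gen_b (gen_beta u)) = gen_b (gen_beta (gen_beta u))"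
      by auto
    then show ?thesis using Cons
      by (cases x) (auto simp: alpha_a_commute alpha_c_commute gamma_a_alpha_commute)
  qed auto
qed

lemma b_involution [simp]: "gen_b (gen_b v) = v"
  and c_involution [simp]: "gen_c (gen_c v) = v"
  and beta_b_commute: "gen_beta (gen_b v) = gen_b (gen_beta v)"
  and gamma_c_commute: "gen_gamma (gen_c v) = gen_c (gen_gamma v)"
  using b_c_relations by auto

text \<open>b\<beta> = (a, a\<alpha>\<gamma>, \<alpha>c, c\<gamma>) and c\<gamma> = (b, b\<beta>, b,
  b\<beta>), so each of the two relations has the other among its sections.\<close>

lemma gamma_beta_twisted_commute:
  "gen_gamma (gen_b (gen_beta v)) = gen_b (gen_beta (gen_gamma v)) \<and>
   gen_beta (gen_c (gen_gamma v)) = gen_c (gen_gamma (gen_beta v))"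
proof (induction v)
  case (Cons x u)
  then show ?case
    by (cases x) (auto simp: beta_a_commute alpha_b_commute beta_b_commute gamma_c_commute
      alpha_a_commute)
qed auto

lemma gamma_b_beta_commute: "gen_gamma (gen_b (gen_beta v)) = gen_b (gen_beta (gen_gamma v))"
  and beta_c_gamma_commute: "gen_beta (gen_c (gen_gamma v)) = gen_c (gen_gamma (gen_beta v))"
  using gamma_beta_twisted_commute by auto

text \<open>Since \<alpha>\<gamma>\<alpha> = (id, \<beta>, \<beta>, id), multiplying by \<gamma> =
  (\<beta>, id, id, \<beta>) leaves \<beta> at every letter. Likewise aca = (b, b, b\<beta>,
  b\<beta>), so that the squares of \<alpha>\<gamma> and of ac are the same element.\<close>

lemma alpha_gamma_square:
  "gen_alpha (gen_gamma (gen_alpha (gen_gamma (x # v)))) = x # gen_beta v"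
  by (cases x) auto

lemma a_c_square: "gen_a (gen_c (gen_a (gen_c (x # v)))) = x # gen_beta v"
  by (cases x) (auto simp: beta_b_commute)

lemma a_c_eq_alpha_gamma:
  "gen_a (gen_c (gen_a (gen_c v))) = gen_alpha (gen_gamma (gen_alpha (gen_gamma v)))"
proof (cases v)
  case (Cons x u)
  then show ?thesis by (simp only: alpha_gamma_square a_c_square)
qed auto

lemma alpha_gamma_fourth:
  "gen_alpha (gen_gamma (gen_alpha (gen_gamma
     (gen_alpha (gen_gamma (gen_alpha (gen_gamma v))))))) = v"
proof (cases v)
  case (Cons x u)
  then show ?thesis by (simp only: alpha_gamma_square beta_involution)
qed auto

lemma gamma_alpha_square:
  "gen_gamma (gen_alpha (gen_gamma (gen_alpha v))) = gen_alpha (gen_gamma (gen_alpha (gen_gamma v)))"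
  using alpha_gamma_fourth[of "gen_gamma (gen_alpha (gen_gamma (gen_alpha v)))"] by simp

lemma c_a_square:
  "gen_c (gen_a (gen_c (gen_a v))) = gen_alpha (gen_gamma (gen_alpha (gen_gamma v)))"
  using a_c_eq_alpha_gamma[of "gen_c (gen_a (gen_c (gen_a v)))"]
    alpha_gamma_fourth[of "gen_c (gen_a (gen_c (gen_a v)))"]
  by simp

section \<open>Powers of products of two generators\<close>

lemma gamma_alpha_power: "(gen_gamma \<circ> gen_alpha) ^^ 4 = id"
  by (rule ext) (simp add: eval_nat_numeral gamma_alpha_square alpha_gamma_fourth)

text \<open>Here (\<beta>\<alpha>)^2 = (\<alpha>\<gamma>, \<gamma>\<alpha>, \<alpha>\<gamma>,
  \<gamma>\<alpha>), and the squares of \<alpha>\<gamma> and \<gamma>\<alpha> agree.\<close>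

lemma beta_alpha_power4_Cons:
  "((gen_beta \<circ> gen_alpha) ^^ 4) (x # v) = x # gen_alpha (gen_gamma (gen_alpha (gen_gamma v)))"
  by (cases x) (simp_all add: eval_nat_numeral gamma_alpha_square)

lemma beta_alpha_power: "(gen_beta \<circ> gen_alpha) ^^ 8 = id"
proof
  fix v
  have "((gen_beta \<circ> gen_alpha) ^^ (4 + 4)) v = v"
    unfolding funpow_add
    by (cases v) (simp_all add: beta_alpha_power4_Cons alpha_gamma_fourth,
        simp add: eval_nat_numeral)
  then show "((gen_beta \<circ> gen_alpha) ^^ 8) v = id v" by simp
qed

text \<open>The sections of \<gamma>\<beta> are \<beta>\<alpha>, \<gamma>, \<alpha>,
  \<beta>\<gamma>. Only the last calls for induction, and it is conjugate to \<gamma>\<beta> by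
  \<gamma>: this is why the hypothesis is taken at \<open>gen_gamma u\<close>.\<close>

lemma gamma_beta_power: "(gen_gamma \<circ> gen_beta) ^^ 8 = id"
proof
  fix v
  have "((gen_gamma \<circ> gen_beta) ^^ 8) v = v"
  proof (induction "length v" arbitrary: v rule: less_induct)
    case less
    show ?case
    proof (cases v)
      case (Cons x u)
      have "((gen_gamma \<circ> gen_beta) ^^ 8) (gen_gamma u) = gen_gamma u"
        using Cons by (intro less) simp
      then have "gen_gamma (((gen_gamma \<circ> gen_beta) ^^ 8) (gen_gamma u)) = u"
        by simp
      then have "((gen_beta \<circ> gen_gamma) ^^ 8) u = u"
        by (simp add: eval_nat_numeral)
      then show ?thesis
        using Cons fun_cong[OF beta_alpha_power, of u]
        by (cases x) (simp_all add: eval_nat_numeral)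
    qed (simp add: eval_nat_numeral)
  qed
  then show "((gen_gamma \<circ> gen_beta) ^^ 8) v = id v" by simp
qed

lemma c_a_power: "(gen_c \<circ> gen_a) ^^ 2 = (gen_gamma \<circ> gen_alpha) ^^ 2"
  by (rule ext) (simp add: eval_nat_numeral gamma_alpha_square c_a_square)

text \<open>The sections of (ba)^2 are a\<alpha>c at 1, 2 and ca\<alpha> at 3, 4. As \<alpha>
  commutes with a and c, their squares are (ac)^2 and (ca)^2, both equal to
  (\<alpha>\<gamma>)^2.\<close>

lemma b_a_power: "(gen_b \<circ> gen_a) ^^ 4 = (gen_beta \<circ> gen_alpha) ^^ 4"
proof
  fix v show "((gen_b \<circ> gen_a) ^^ 4) v = ((gen_beta \<circ> gen_alpha) ^^ 4) v"
  proof (cases v)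
    case (Cons x u)
    have "((gen_b \<circ> gen_a) ^^ 4) (x # u) = x # gen_alpha (gen_gamma (gen_alpha (gen_gamma u)))"
      by (cases x) (simp_all add: eval_nat_numeral alpha_c_commute alpha_a_commute
          c_a_square a_c_eq_alpha_gamma)
    then show ?thesis using Cons by (simp add: beta_alpha_power4_Cons)
  qed (simp add: eval_nat_numeral)
qed

text \<open>Both a and b commute with \<alpha> and \<beta>, so the power equals (ba)^4
  (\<beta>\<alpha>)^4 = (\<beta>\<alpha>)^8.\<close>

lemma b_a_twisted_power_apply:
  "((gen_b \<circ> gen_beta \<circ> (gen_a \<circ> gen_alpha)) ^^ 4) v = v"
proof -
  have "gen_b (gen_a (gen_b (gen_a (gen_b (gen_a (gen_b (gen_a u))))))) =
    gen_beta (gen_alpha (gen_beta (gen_alpha (gen_beta (gen_alpha (gen_beta (gen_alpha u)))))))" for u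
    using fun_cong[OF b_a_power, of u] by (simp add: eval_nat_numeral)
  moreover have "gen_beta (gen_alpha (gen_beta (gen_alpha (gen_beta (gen_alpha (gen_beta (gen_alpha
    (gen_beta (gen_alpha (gen_beta (gen_alpha (gen_beta (gen_alpha (gen_beta (gen_alpha u))))))))))))))) = u" for u
    using fun_cong[OF beta_alpha_power, of u] by (simp add: eval_nat_numeral)
  ultimately show ?thesis
    by (simp add: eval_nat_numeral alpha_a_commute beta_a_commute alpha_b_commute beta_b_commute)
qed

lemma b_a_twisted_power: "(gen_b \<circ> gen_beta \<circ> (gen_a \<circ> gen_alpha)) ^^ 4 = id"
  using b_a_twisted_power_apply by auto

text \<open>c\<gamma> = (b, b\<beta>, b, b\<beta>) is invariant under the letter exchange of a, so
  the two involutions commute.\<close>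

lemma c_gamma_a_power: "(gen_c \<circ> gen_gamma \<circ> gen_a) ^^ 2 = id"
proof
  fix v show "((gen_c \<circ> gen_gamma \<circ> gen_a) ^^ 2) v = id v"
  proof (cases v)
    case (Cons x u)
    then show ?thesis by (cases x) (simp_all add: eval_nat_numeral beta_b_commute)
  qed (simp add: eval_nat_numeral)
qed

lemma length_gen_a [simp]: "length (gen_a v) = length v"
  by (cases v) auto

lemma length_gen_b_c [simp]: "length (gen_b v) = length v" "length (gen_c v) = length v"
  by (induction v and v rule: gen_b_gen_c.induct) auto

text \<open>The section of cb is b\<beta>a\<alpha> at 1, 2, with trivial fourth power, and bc at 3,
  4, which is conjugate to cb by b.\<close>

lemma c_b_power: "(gen_c \<circ> gen_b) ^^ 4 = id"
proof
  fix v
  have "((gen_c \<circ> gen_b) ^^ 4) v = v"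
  proof (induction "length v" arbitrary: v rule: less_induct)
    case less
    show ?case
    proof (cases v)
      case (Cons x u)
      have "((gen_c \<circ> gen_b) ^^ 4) (gen_b u) = gen_b u"
        using Cons by (intro less) simp
      then have "gen_b (((gen_c \<circ> gen_b) ^^ 4) (gen_b u)) = u"
        by simp
      then have "((gen_b \<circ> gen_c) ^^ 4) u = u"
        by (simp add: eval_nat_numeral)
      then show ?thesis
        using Cons b_a_twisted_power_apply[of u]
        by (cases x) (simp_all add: eval_nat_numeral)
    qed (simp add: eval_nat_numeral)
  qed
  then show "((gen_c \<circ> gen_b) ^^ 4) v = id v" by simp
qed

section \<open>Groups of tree automorphisms generated by involutions\<close>

lemma act_empty [simp]: "act [] = id"
  by (rule ext) simp

lemma act_rev [simp]: "act (rev w) (act w v) = v" "act w (act (rev w) v) = v"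
proof -
  have involution: "gen_act s (gen_act s v) = v" for s v
    by (cases s) auto
  have *: "act (rev w) (act w v) = v" for w v
    by (induction w arbitrary: v) (auto simp: act_append involution)
  show "act (rev w) (act w v) = v" by (rule *)
  show "act w (act (rev w) v) = v" using *[of "rev w" v] by simp
qed

lemma act_rev_comp: "act (rev w) \<circ> act w = id" "act w \<circ> act (rev w) = id"
  by auto

lemma bij_act: "bij (act w)"
  by (rule o_bij[OF act_rev_comp])

lemma act_snoc: "\<exists>y. act w (v @ [x]) = act w v @ [y]"
  by (induction v arbitrary: w) (auto simp: act_Cons)

lemma act_in_tree_automorphisms [simp]: "act w \<in> tree_automorphisms"
  by (simp add: tree_automorphisms_def bij_act act_snoc)

lemma Aut_tree_simps [simp]:
  "carrier Aut_tree = tree_automorphisms" "f \<otimes>\<^bsub>Aut_tree\<^esub> g = f \<circ> g" "\<one>\<^bsub>Aut_tree\<^esub> = id"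
  by (simp_all add: Aut_tree_def)

lemma inv_Aut_tree:
  assumes "g \<circ> f = id" "f \<in> tree_automorphisms" "g \<in> tree_automorphisms"
  shows "inv\<^bsub>Aut_tree\<^esub> f = g"
  using group.inv_equality[OF group_Aut_tree, of g f] assms by simp

lemma inv_act: "inv\<^bsub>Aut_tree\<^esub> (act w) = act (rev w)"
  by (rule inv_Aut_tree) (auto simp: act_rev_comp)

lemma gen_eq_act:
  "gen_alpha = act [G\<alpha>]" "gen_beta = act [G\<beta>]" "gen_gamma = act [G\<gamma>]"
  "gen_a = act [Ga]" "gen_b = act [Gb]" "gen_c = act [Gc]"
  by auto

lemma gen_in_tree_automorphisms [simp]:
  "gen_alpha \<in> tree_automorphisms" "gen_beta \<in> tree_automorphisms"
  "gen_gamma \<in> tree_automorphisms" "gen_a \<in> tree_automorphisms"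
  "gen_b \<in> tree_automorphisms" "gen_c \<in> tree_automorphisms"
  unfolding gen_eq_act by (rule act_in_tree_automorphisms)+

lemma comp_in_tree_automorphisms [simp]:
  "f \<in> tree_automorphisms \<Longrightarrow> g \<in> tree_automorphisms \<Longrightarrow> f \<circ> g \<in> tree_automorphisms"
  using monoid.m_closed[OF group.is_monoid[OF group_Aut_tree], of f g] by simp

lemma id_in_tree_automorphisms [simp]: "id \<in> tree_automorphisms"
  using monoid.one_closed[OF group.is_monoid[OF group_Aut_tree]] by simp

definition involutions :: "(word \<Rightarrow> word) set" where
  "involutions = {g \<in> tree_automorphisms. g \<circ> g = id}"

lemma gen_involutions [simp]:
  "gen_alpha \<in> involutions" "gen_beta \<in> involutions" "gen_gamma \<in> involutions"
  "gen_a \<in> involutions" "gen_b \<in> involutions" "gen_c \<in> involutions"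
  by (auto simp: involutions_def)

lemma twisted_involutions [simp]:
  "gen_a \<circ> gen_alpha \<in> involutions" "gen_b \<circ> gen_beta \<in> involutions"
  "gen_c \<circ> gen_gamma \<in> involutions" "gen_a \<circ> gen_alpha \<circ> gen_gamma \<in> involutions"
  "gen_alpha \<circ> gen_c \<in> involutions"
  by (auto simp: involutions_def alpha_a_commute beta_b_commute gamma_c_commute
      gamma_a_alpha_commute alpha_c_commute)

lemma inv_involution: "g \<in> involutions \<Longrightarrow> inv\<^bsub>Aut_tree\<^esub> g = g"
  by (rule inv_Aut_tree) (auto simp: involutions_def)

lemma generate_involutions_induct:
  assumes "h \<in> generate Aut_tree S" "S \<subseteq> involutions" "id \<in> P"
    and step: "\<And>s p. s \<in> S \<Longrightarrow> p \<in> P \<Longrightarrow> s \<circ> p \<in> P"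
  shows "h \<in> P"
proof -
  \<comment> \<open>The claim is strengthened to invariance of \<open>P\<close> under left
    multiplication by \<open>h\<close>, which passes to products. Inverses of generators are
    generators again.\<close>
  have "\<forall>p\<in>P. h \<circ> p \<in> P"
    using assms(1)
  proof (induction rule: generate.induct)
    case (incl s)
    then show ?case using step by blast
  next
    case (inv s)
    then have "inv\<^bsub>Aut_tree\<^esub> s = s" using inv_involution assms(2) by blast
    then show ?case using step inv by (simp only:) blast
  next
    case (eng h1 h2)
    then show ?case by (simp add: comp_assoc)
  qed simp
  from bspec[OF this assms(3)] show ?thesis by simp
qed

lemma subgroup_generate:
  assumes "S \<subseteq> involutions" shows "subgroup (generate Aut_tree S) Aut_tree"
  using assms by (intro group.generate_is_subgroup[OF group_Aut_tree]) (auto simp: involutions_def)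

lemma generate_comp:
  "f \<in> generate Aut_tree S \<Longrightarrow> g \<in> generate Aut_tree S \<Longrightarrow> f \<circ> g \<in> generate Aut_tree S"
  using generate.eng[of f Aut_tree S g] by simp

lemma id_in_generate [simp]: "id \<in> generate Aut_tree S"
  using generate.one[of Aut_tree S] by simp

lemma generate_empty: "generate Aut_tree {} = {id}"
  using group.generate_empty[OF group_Aut_tree] by simp

lemma generate_singleton:
  assumes "x \<in> involutions" shows "generate Aut_tree {x} = {id, x}"
proof
  have "x \<circ> p \<in> {id, x}" if "p \<in> {id, x}" for p
    using that assms by (auto simp: involutions_def)
  then show "generate Aut_tree {x} \<subseteq> {id, x}"
    using generate_involutions_induct[of _ "{x}" "{id, x}"] assms by blast
qed (auto intro: generate.incl)

lemma generate_conjugate: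
  assumes "k \<in> generate Aut_tree T" "T \<subseteq> involutions" "s \<circ> s = id"
    and "\<And>x. x \<in> T \<Longrightarrow> s \<circ> x \<circ> s \<in> generate Aut_tree T"
  shows "s \<circ> k \<circ> s \<in> generate Aut_tree T"
proof -
  have "k \<in> {k. s \<circ> k \<circ> s \<in> generate Aut_tree T}"
  proof (rule generate_involutions_induct[OF assms(1,2)])
    fix x p assume "x \<in> T" "p \<in> {k. s \<circ> k \<circ> s \<in> generate Aut_tree T}"
    then have "(s \<circ> x \<circ> s) \<circ> (s \<circ> p \<circ> s) \<in> generate Aut_tree T"
      using assms(4) generate_comp by auto
    also have "(s \<circ> x \<circ> s) \<circ> (s \<circ> p \<circ> s) = s \<circ> (x \<circ> p) \<circ> s"
      using fun_cong[OF assms(3)] by (simp add: fun_eq_iff)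
    finally show "x \<circ> p \<in> {k. s \<circ> k \<circ> s \<in> generate Aut_tree T}"
      by blast
  qed (use assms(3) in simp)
  then show ?thesis by simp
qed

section \<open>Extensions with a dihedral quotient\<close>

primrec rotation_word :: "generator list \<Rightarrow> generator list \<Rightarrow> nat \<Rightarrow> generator list" where
  "rotation_word s t 0 = []"
| "rotation_word s t (Suc i) = t @ s @ rotation_word s t i"

text \<open>The words (ts)^i and s(ts)^i with i < m. They represent, possibly with repetitions, the
  cosets of a normal subgroup whose quotient is generated by the images of the two involutions s and
  t.\<close>

definition dihedral_words :: "generator list \<Rightarrow> generator list \<Rightarrow> nat \<Rightarrow> generator list list" where
  "dihedral_words s t m =
     map (rotation_word s t) [0..<m] @ map (\<lambda>i. s @ rotation_word s t i) [0..<m]"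

lemma set_dihedral_words:
  "set (dihedral_words s t m) =
     rotation_word s t ` {..<m} \<union> (\<lambda>i. s @ rotation_word s t i) ` {..<m}"
  unfolding dihedral_words_def by (simp add: atLeast0LessThan)

lemma act_rotation_word: "act (rotation_word s t i) = (act t \<circ> act s) ^^ i"
  by (induction i) (auto simp: act_append)

text \<open>The products of \<langle>T\<rangle> with the listed words are closed under left
  multiplication by every generator: s and t normalize \<langle>T\<rangle>, so they can be moved
  past the factor in \<langle>T\<rangle>, and (ts)^m is absorbed by it.\<close>

lemma dihedral_extension:
  assumes T: "T \<subseteq> involutions" and st: "act s \<in> involutions" "act t \<in> involutions"
    and norm: "\<And>x. x \<in> T \<Longrightarrow> act s \<circ> x \<circ> act s \<in> generate Aut_tree T"
      "\<And>x. x \<in> T \<Longrightarrow> act t \<circ> x \<circ> act t \<in> generate Aut_tree T"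
    and m: "(act t \<circ> act s) ^^ m \<in> generate Aut_tree T" "m > 0"
    and h: "h \<in> generate Aut_tree (T \<union> {act s, act t})"
  shows "\<exists>k\<in>generate Aut_tree T. \<exists>d\<in>set (dihedral_words s t m). h = k \<circ> act d"
proof -
  define H where "H = generate Aut_tree T"
  define D where "D = set (dihedral_words s t m)"
  define P where "P = {k \<circ> act d | k d. k \<in> H \<and> d \<in> D}"
  have H: "subgroup H Aut_tree"
    unfolding H_def by (rule subgroup_generate[OF T])
  have ss: "act s \<circ> act s = id" and tt: "act t \<circ> act t = id"
    using st by (auto simp: involutions_def)
  have cs: "act s \<circ> k \<circ> act s \<in> H" and ct: "act t \<circ> k \<circ> act t \<in> H" if "k \<in> H" for k
    using that norm T ss tt unfolding H_def by (auto intro: generate_conjugate)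
  have Hc: "k \<circ> l \<in> H" if "k \<in> H" "l \<in> H" for k l
    using that unfolding H_def by (rule generate_comp)
  have D_rot: "rotation_word s t i \<in> D" and D_refl: "s @ rotation_word s t i \<in> D" if "i < m" for i
    using that by (auto simp: D_def set_dihedral_words)
  have D0: "[] \<in> D" using D_rot[OF m(2)] by simp
  have PI: "k \<circ> act d \<in> P" if "k \<in> H" "d \<in> D" for k d
    using that by (auto simp: P_def)
  have s_step: "act s \<circ> act d \<in> P" if "d \<in> D" for d
  proof -
    consider i where "i < m" "d = rotation_word s t i" | i where "i < m" "d = s @ rotation_word s t i"
      using \<open>d \<in> D\<close> unfolding D_def set_dihedral_words by blast
    then show ?thesis
    proof cases
      case 1
      then show ?thesis using PI[of id, OF _ D_refl] by (simp add: H_def act_append)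
    next
      case 2
      then have "act s \<circ> act d = id \<circ> act (rotation_word s t i)"
        using ss by (simp add: act_append comp_assoc[symmetric])
      then show ?thesis using PI[of id, OF _ D_rot] 2 by (simp add: H_def)
    qed
  qed
  \<comment> \<open>The word \<open>t\<close> need not be on the list. From z = (ts)^m = t
    s(ts)^(m-1) it follows that t = (tzt)^-1 s(ts)^(m-1), where tzt is in
    \<langle>T\<rangle>.\<close>
  have t_P: "act t \<in> P"
  proof -
    obtain j where j: "m = Suc j" using m(2) by (cases m) auto
    define z where "z = act t \<circ> (act s \<circ> act (rotation_word s t j))"
    have "z = (act t \<circ> act s) ^^ m"
      unfolding z_def j by (simp add: act_rotation_word comp_assoc)
    then have "act t \<circ> z \<circ> act t \<in> H" using m(1) ct by (simp add: H_def)
    then have z': "inv\<^bsub>Aut_tree\<^esub> (act t \<circ> z \<circ> act t) \<in> H"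
      by (rule subgroup.m_inv_closed[OF H])
    have "act t \<circ> z \<circ> act t \<in> tree_automorphisms"
      using \<open>act t \<circ> z \<circ> act t \<in> H\<close> subgroup.subset[OF H] by auto
    then have l_inv: "inv\<^bsub>Aut_tree\<^esub> (act t \<circ> z \<circ> act t) \<circ> (act t \<circ> z \<circ> act t) = id"
      using group.l_inv[OF group_Aut_tree] by auto
    have "act s \<circ> act (rotation_word s t j) = (act t \<circ> z \<circ> act t) \<circ> act t"
      unfolding z_def using fun_cong[OF tt] by (simp add: fun_eq_iff)
    then have "inv\<^bsub>Aut_tree\<^esub> (act t \<circ> z \<circ> act t) \<circ> act (s @ rotation_word s t j) =
        (inv\<^bsub>Aut_tree\<^esub> (act t \<circ> z \<circ> act t) \<circ> (act t \<circ> z \<circ> act t)) \<circ> act t"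
      by (simp only: act_append comp_assoc)
    also have "\<dots> = act t"
      unfolding l_inv by simp
    finally have "inv\<^bsub>Aut_tree\<^esub> (act t \<circ> z \<circ> act t) \<circ> act (s @ rotation_word s t j) = act t" .
    then show ?thesis using PI[OF z' D_refl[of j]] j by simp
  qed
  have t_step: "act t \<circ> act d \<in> P" if "d \<in> D" for d
  proof -
    consider "d = []" | i where "Suc i < m" "d = rotation_word s t (Suc i)"
      | i where "i < m" "d = s @ rotation_word s t i"
    proof -
      consider i where "i < m" "d = rotation_word s t i" | i where "i < m" "d = s @ rotation_word s t i"
        using \<open>d \<in> D\<close> unfolding D_def set_dihedral_words by blast
      then show thesis
      proof cases
        case (1 i)
        then show thesis using that(1,2) by (cases i) auto
      qed (use that(3) in blast)
    qed
    then show ?thesis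
    proof cases
      case 1
      then show ?thesis using t_P by simp
    next
      case 2
      then have "act t \<circ> act d = id \<circ> act (s @ rotation_word s t i)"
        using tt by (simp add: act_append comp_assoc[symmetric])
      then show ?thesis using PI[of id, OF _ D_refl[of i]] 2 by (simp add: H_def)
    next
      case 3
      have e: "act t \<circ> act d = act (rotation_word s t (Suc i))"
        using 3 by (simp add: act_append)
      show ?thesis
      proof (cases "Suc i < m")
        case True
        then show ?thesis using e PI[of id, OF _ D_rot[of "Suc i"]] by (simp add: H_def)
      next
        \<comment> \<open>The rotation has come full circle: (ts)^m lies in \<langle>T\<rangle> and
          is paired with the empty word.\<close>
        case False
        then have "Suc i = m" using 3 by simp
        then have "act t \<circ> act d \<in> H" using e m(1) by (simp only: act_rotation_word H_def)
        from PI[OF this D0] show ?thesis by simp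
      qed
    qed
  qed
  have conj_step: "act u \<circ> (k \<circ> act d) \<in> P"
    if uu: "act u \<circ> act u = id" "act u \<circ> k \<circ> act u \<in> H" and ud: "act u \<circ> act d \<in> P" for u k d
  proof -
    obtain l e where le: "l \<in> H" "e \<in> D" "act u \<circ> act d = l \<circ> act e"
      using ud by (auto simp: P_def)
    have "act u \<circ> (k \<circ> act d) = (act u \<circ> k \<circ> act u) \<circ> (act u \<circ> act d)"
      using fun_cong[OF uu(1)] by (simp add: fun_eq_iff)
    also have "\<dots> = ((act u \<circ> k \<circ> act u) \<circ> l) \<circ> act e"
      using le(3) by (simp add: comp_assoc)
    finally show ?thesis using PI[OF Hc[OF uu(2) le(1)] le(2)] by simp
  qed
  have "h \<in> P"
  proof (rule generate_involutions_induct[OF h])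
    show "T \<union> {act s, act t} \<subseteq> involutions" using T st by auto
    show "id \<in> P" using PI[OF _ D0, of id] by (simp add: H_def)
    fix x p assume x: "x \<in> T \<union> {act s, act t}" and "p \<in> P"
    then obtain k d where kd: "k \<in> H" "d \<in> D" "p = k \<circ> act d" by (auto simp: P_def)
    consider "x \<in> T" | "x = act s" | "x = act t" using x by auto
    then show "x \<circ> p \<in> P"
    proof cases
      case 1
      then have "x \<circ> k \<in> H" using Hc kd(1) by (auto simp: H_def intro: generate.incl)
      from PI[OF this kd(2)] show ?thesis using kd(3) by (simp add: comp_assoc)
    next
      case 2
      then show ?thesis using conj_step[OF ss cs s_step] kd by simp
    next
      case 3
      then show ?thesis using conj_step[OF tt ct t_step] kd by simp
    qed
  qed
  then show ?thesis by (auto simp: P_def H_def D_def)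
qed

lemma rotation_reverse:
  assumes "f \<circ> f = id"
  shows "(f \<circ> g) ^^ m = f \<circ> (g \<circ> f) ^^ m \<circ> f"
proof
  fix v
  have "f (f u) = u" for u using fun_cong[OF assms, of u] by simp
  then show "((f \<circ> g) ^^ m) v = (f \<circ> (g \<circ> f) ^^ m \<circ> f) v"
    by (induction m) simp_all
qed

text \<open>Interchanging s and t gives another list for the same group. When two groups are
  compared later, the order is chosen such that the generator they share, or its counterpart, is
  itself a listed word.\<close>

lemma dihedral_extension_swapped:
  assumes "T \<subseteq> involutions" "act s \<in> involutions" "act t \<in> involutions"
    and "\<And>x. x \<in> T \<Longrightarrow> act s \<circ> x \<circ> act s \<in> generate Aut_tree T"
      "\<And>x. x \<in> T \<Longrightarrow> act t \<circ> x \<circ> act t \<in> generate Aut_tree T"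
    and "(act t \<circ> act s) ^^ m \<in> generate Aut_tree T" "m > 0"
    and "h \<in> generate Aut_tree (T \<union> {act s, act t})"
  shows "\<exists>k\<in>generate Aut_tree T. \<exists>d\<in>set (dihedral_words t s m). h = k \<circ> act d"
proof (rule dihedral_extension)
  have ss: "act s \<circ> act s = id"
    using assms(2) by (auto simp: involutions_def)
  show "(act s \<circ> act t) ^^ m \<in> generate Aut_tree T"
    unfolding rotation_reverse[OF ss, of m "act t"]
    by (rule generate_conjugate) (use assms in \<open>auto simp: involutions_def\<close>)
  show "h \<in> generate Aut_tree (T \<union> {act t, act s})"
    using assms(8) by (simp add: insert_commute)
qed (use assms in auto)

section \<open>The finite subgroups\<close>

abbreviation "\<Gamma>A \<equiv> generate Aut_tree {gen_beta, gen_gamma, gen_b, gen_c}"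
abbreviation "\<Gamma>B \<equiv> generate Aut_tree {gen_alpha, gen_gamma, gen_a, gen_c}"
abbreviation "\<Gamma>C \<equiv> generate Aut_tree {gen_alpha, gen_beta, gen_a, gen_b}"
abbreviation "\<Gamma>A1 \<equiv> generate Aut_tree {gen_alpha, gen_b, gen_c}"
abbreviation "\<Gamma>B1 \<equiv> generate Aut_tree {gen_beta, gen_a, gen_c \<circ> gen_gamma}"
abbreviation "\<Gamma>C1 \<equiv> generate Aut_tree {gen_gamma, gen_a \<circ> gen_alpha, gen_b \<circ> gen_beta}"

text \<open>Not claimed to be the nucleus of the self-similar group: only closure under sections matters, and
  that every vertex group is generated by the members it contains.\<close>

definition nucleus :: "(word \<Rightarrow> word) set" where
  "nucleus = {id, gen_alpha, gen_beta, gen_gamma, gen_a, gen_b, gen_c,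
     gen_a \<circ> gen_alpha, gen_b \<circ> gen_beta, gen_c \<circ> gen_gamma,
     gen_a \<circ> gen_alpha \<circ> gen_gamma, gen_alpha \<circ> gen_c}"

definition factors_through ::
  "(word \<Rightarrow> word) set \<Rightarrow> generator list list \<Rightarrow> (word \<Rightarrow> word) set \<Rightarrow> bool" where
  "factors_through H D G \<longleftrightarrow> (\<forall>h\<in>G. \<exists>k\<in>H. \<exists>d\<in>set D. h = k \<circ> act d)"

lemma dihedral_factorization:
  assumes "T \<subseteq> involutions" "act s \<in> involutions" "act t \<in> involutions"
    and "\<And>x. x \<in> T \<Longrightarrow> act s \<circ> x \<circ> act s \<in> generate Aut_tree T"
      "\<And>x. x \<in> T \<Longrightarrow> act t \<circ> x \<circ> act t \<in> generate Aut_tree T"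
    and "(act t \<circ> act s) ^^ m \<in> generate Aut_tree T" "m > 0"
    and "S = T \<union> {act s, act t}"
  shows "factors_through (generate Aut_tree T) (dihedral_words s t m) (generate Aut_tree S)"
    "factors_through (generate Aut_tree T) (dihedral_words t s m) (generate Aut_tree S)"
  unfolding factors_through_def assms(8)
  using dihedral_extension[OF assms(1-7)] dihedral_extension_swapped[OF assms(1-7)] by auto

lemma act_singleton [simp]: "act [s] = gen_act s"
  by (rule ext) simp

lemma act_pair [simp]: "act [s, t] = gen_act s \<circ> gen_act t"
  by (rule ext) simp

section \<open>Factorizations of the finite groups\<close>

lemma dihedral_alpha_gamma:
  "factors_through {id} (dihedral_words [G\<alpha>] [G\<gamma>] 4) (generate Aut_tree {gen_alpha, gen_gamma})"
  "factors_through {id} (dihedral_words [G\<gamma>] [G\<alpha>] 4) (generate Aut_tree {gen_alpha, gen_gamma})"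
  using dihedral_factorization[of "{}" "[G\<alpha>]" "[G\<gamma>]" 4] gamma_alpha_power
  by (simp_all add: generate_empty)

lemma dihedral_alpha_beta:
  "factors_through {id} (dihedral_words [G\<alpha>] [G\<beta>] 8) (generate Aut_tree {gen_alpha, gen_beta})"
  "factors_through {id} (dihedral_words [G\<beta>] [G\<alpha>] 8) (generate Aut_tree {gen_alpha, gen_beta})"
  using dihedral_factorization[of "{}" "[G\<alpha>]" "[G\<beta>]" 8] beta_alpha_power
  by (simp_all add: generate_empty)

lemma dihedral_beta_gamma:
  "factors_through {id} (dihedral_words [G\<beta>] [G\<gamma>] 8) (generate Aut_tree {gen_beta, gen_gamma})"
  "factors_through {id} (dihedral_words [G\<gamma>] [G\<beta>] 8) (generate Aut_tree {gen_beta, gen_gamma})"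
  using dihedral_factorization[of "{}" "[G\<beta>]" "[G\<gamma>]" 8] gamma_beta_power
  by (simp_all add: generate_empty)

lemma generate_triple: "s \<in> S \<Longrightarrow> t \<in> S \<Longrightarrow> u \<in> S \<Longrightarrow> s \<circ> t \<circ> u \<in> generate Aut_tree S"
  by (intro generate_comp generate.incl)

lemma generate_power: "g \<in> generate Aut_tree S \<Longrightarrow> g ^^ m \<in> generate Aut_tree S"
  by (induction m) (auto intro: generate_comp)

text \<open>These show that b, c normalize \<langle>\<beta>, \<gamma>\<rangle>, that a, c normalize
  \<langle>\<alpha>, \<gamma>\<rangle>, and that a, b normalize \<langle>\<alpha>, \<beta>\<rangle>.
  The twisted ones restate that \<gamma> commutes with b\<beta> and a\<alpha>, and \<beta> with
  c\<gamma>.\<close>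

lemma conjugates:
  "gen_b \<circ> gen_beta \<circ> gen_b = gen_beta" "gen_b \<circ> gen_gamma \<circ> gen_b = gen_beta \<circ> gen_gamma \<circ> gen_beta"
  "gen_c \<circ> gen_beta \<circ> gen_c = gen_gamma \<circ> gen_beta \<circ> gen_gamma" "gen_c \<circ> gen_gamma \<circ> gen_c = gen_gamma"
  "gen_a \<circ> gen_alpha \<circ> gen_a = gen_alpha" "gen_a \<circ> gen_gamma \<circ> gen_a = gen_alpha \<circ> gen_gamma \<circ> gen_alpha"
  "gen_c \<circ> gen_alpha \<circ> gen_c = gen_alpha" "gen_a \<circ> gen_beta \<circ> gen_a = gen_beta"
  "gen_b \<circ> gen_alpha \<circ> gen_b = gen_alpha"
  "gen_c \<circ> gen_gamma \<circ> gen_beta \<circ> (gen_c \<circ> gen_gamma) = gen_beta"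
  "gen_a \<circ> gen_alpha \<circ> gen_gamma \<circ> (gen_a \<circ> gen_alpha) = gen_gamma"
  "gen_b \<circ> gen_beta \<circ> gen_gamma \<circ> (gen_b \<circ> gen_beta) = gen_gamma"
proof -
  have "gen_b (gen_gamma (gen_b v)) = gen_beta (gen_gamma (gen_beta v))" for v
    using gamma_b_beta_commute[of "gen_beta v"] by (simp add: beta_b_commute)
  then show "gen_b \<circ> gen_gamma \<circ> gen_b = gen_beta \<circ> gen_gamma \<circ> gen_beta" by auto
  have "gen_c (gen_beta (gen_c v)) = gen_gamma (gen_beta (gen_gamma v))" for v
    using beta_c_gamma_commute[of "gen_gamma v"] by (simp add: gamma_c_commute)
  then show "gen_c \<circ> gen_beta \<circ> gen_c = gen_gamma \<circ> gen_beta \<circ> gen_gamma" by auto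
  have "gen_a (gen_gamma (gen_a v)) = gen_alpha (gen_gamma (gen_alpha v))" for v
    using gamma_a_alpha_commute[of "gen_alpha v"] by (simp add: alpha_a_commute)
  then show "gen_a \<circ> gen_gamma \<circ> gen_a = gen_alpha \<circ> gen_gamma \<circ> gen_alpha" by auto
  show "gen_c \<circ> gen_gamma \<circ> gen_beta \<circ> (gen_c \<circ> gen_gamma) = gen_beta"
    by (rule ext) (simp add: beta_c_gamma_commute gamma_c_commute)
  show "gen_a \<circ> gen_alpha \<circ> gen_gamma \<circ> (gen_a \<circ> gen_alpha) = gen_gamma"
    by (rule ext) (simp add: gamma_a_alpha_commute alpha_a_commute)
  show "gen_b \<circ> gen_beta \<circ> gen_gamma \<circ> (gen_b \<circ> gen_beta) = gen_gamma"
    by (rule ext) (simp add: gamma_b_beta_commute beta_b_commute)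
qed (auto simp: beta_b_commute gamma_c_commute alpha_a_commute alpha_c_commute beta_a_commute
    alpha_b_commute)

lemma factor_A:
  "factors_through (generate Aut_tree {gen_beta, gen_gamma}) (dihedral_words [Gb] [Gc] 4) \<Gamma>A"
  "factors_through (generate Aut_tree {gen_beta, gen_gamma}) (dihedral_words [Gc] [Gb] 4) \<Gamma>A"
proof -
  note * = dihedral_factorization[of "{gen_beta, gen_gamma}" "[Gb]" "[Gc]" 4 "{gen_beta, gen_gamma, gen_b, gen_c}"]
  have "act [Gb] \<circ> x \<circ> act [Gb] \<in> generate Aut_tree {gen_beta, gen_gamma}"
    "act [Gc] \<circ> x \<circ> act [Gc] \<in> generate Aut_tree {gen_beta, gen_gamma}" if "x \<in> {gen_beta, gen_gamma}" for x
    using that by (elim insertE emptyE; simp add: conjugates generate_triple generate.incl)+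
  moreover have "(act [Gc] \<circ> act [Gb]) ^^ 4 \<in> generate Aut_tree {gen_beta, gen_gamma}"
    by (simp add: c_b_power)
  moreover have "{gen_beta, gen_gamma, gen_b, gen_c} = {gen_beta, gen_gamma} \<union> {act [Gb], act [Gc]}"
    by auto
  ultimately show "factors_through (generate Aut_tree {gen_beta, gen_gamma}) (dihedral_words [Gb] [Gc] 4) \<Gamma>A"
    "factors_through (generate Aut_tree {gen_beta, gen_gamma}) (dihedral_words [Gc] [Gb] 4) \<Gamma>A"
    using *
    by simp_all
qed

lemma factor_B:
  "factors_through (generate Aut_tree {gen_alpha, gen_gamma}) (dihedral_words [Ga] [Gc] 2) \<Gamma>B"
  "factors_through (generate Aut_tree {gen_alpha, gen_gamma}) (dihedral_words [Gc] [Ga] 2) \<Gamma>B"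
proof -
  note * = dihedral_factorization[of "{gen_alpha, gen_gamma}" "[Ga]" "[Gc]" 2 "{gen_alpha, gen_gamma, gen_a, gen_c}"]
  have "act [Ga] \<circ> x \<circ> act [Ga] \<in> generate Aut_tree {gen_alpha, gen_gamma}"
    "act [Gc] \<circ> x \<circ> act [Gc] \<in> generate Aut_tree {gen_alpha, gen_gamma}" if "x \<in> {gen_alpha, gen_gamma}" for x
    using that by (elim insertE emptyE; simp add: conjugates generate_triple generate.incl)+
  \<comment> \<open>Membership is enough here: (ca)^2 = (\<gamma>\<alpha>)^2 is a product of letters
    \<alpha> and \<gamma>. In \<open>factor_C\<close> the same role is played by (ba)^4 =
    (\<beta>\<alpha>)^4.\<close>
  moreover have "(act [Gc] \<circ> act [Ga]) ^^ 2 \<in> generate Aut_tree {gen_alpha, gen_gamma}"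
    using generate_power[OF generate_comp[of gen_gamma "{gen_alpha, gen_gamma}" gen_alpha], of 2]
    by (simp add: c_a_power generate.incl)
  moreover have "{gen_alpha, gen_gamma, gen_a, gen_c} = {gen_alpha, gen_gamma} \<union> {act [Ga], act [Gc]}"
    by auto
  ultimately show "factors_through (generate Aut_tree {gen_alpha, gen_gamma}) (dihedral_words [Ga] [Gc] 2) \<Gamma>B"
    "factors_through (generate Aut_tree {gen_alpha, gen_gamma}) (dihedral_words [Gc] [Ga] 2) \<Gamma>B"
    using *
    by simp_all
qed

lemma factor_C:
  "factors_through (generate Aut_tree {gen_alpha, gen_beta}) (dihedral_words [Ga] [Gb] 4) \<Gamma>C"
  "factors_through (generate Aut_tree {gen_alpha, gen_beta}) (dihedral_words [Gb] [Ga] 4) \<Gamma>C"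
proof -
  note * = dihedral_factorization[of "{gen_alpha, gen_beta}" "[Ga]" "[Gb]" 4 "{gen_alpha, gen_beta, gen_a, gen_b}"]
  have "act [Ga] \<circ> x \<circ> act [Ga] \<in> generate Aut_tree {gen_alpha, gen_beta}"
    "act [Gb] \<circ> x \<circ> act [Gb] \<in> generate Aut_tree {gen_alpha, gen_beta}" if "x \<in> {gen_alpha, gen_beta}" for x
    using that by (elim insertE emptyE; simp add: conjugates generate_triple generate.incl)+
  moreover have "(act [Gb] \<circ> act [Ga]) ^^ 4 \<in> generate Aut_tree {gen_alpha, gen_beta}"
    using generate_power[OF generate_comp[of gen_beta "{gen_alpha, gen_beta}" gen_alpha], of 4]
    by (simp add: b_a_power generate.incl)
  moreover have "{gen_alpha, gen_beta, gen_a, gen_b} = {gen_alpha, gen_beta} \<union> {act [Ga], act [Gb]}"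
    by auto
  ultimately show "factors_through (generate Aut_tree {gen_alpha, gen_beta}) (dihedral_words [Ga] [Gb] 4) \<Gamma>C"
    "factors_through (generate Aut_tree {gen_alpha, gen_beta}) (dihedral_words [Gb] [Ga] 4) \<Gamma>C"
    using *
    by simp_all
qed

lemma factor_A1:
  "factors_through ({id, gen_alpha}) (dihedral_words [Gb] [Gc] 4) \<Gamma>A1"
  "factors_through ({id, gen_alpha}) (dihedral_words [Gc] [Gb] 4) \<Gamma>A1"
proof -
  note * = dihedral_factorization[of "{gen_alpha}" "[Gb]" "[Gc]" 4 "{gen_alpha, gen_b, gen_c}"]
  have "act [Gb] \<circ> x \<circ> act [Gb] \<in> generate Aut_tree {gen_alpha}"
    "act [Gc] \<circ> x \<circ> act [Gc] \<in> generate Aut_tree {gen_alpha}" if "x \<in> {gen_alpha}" for x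
    using that by (elim insertE emptyE; simp add: conjugates generate_triple generate.incl)+
  moreover have "(act [Gc] \<circ> act [Gb]) ^^ 4 \<in> generate Aut_tree {gen_alpha}"
    by (simp add: c_b_power)
  moreover have "{gen_alpha, gen_b, gen_c} = {gen_alpha} \<union> {act [Gb], act [Gc]}"
    by auto
  ultimately show "factors_through ({id, gen_alpha}) (dihedral_words [Gb] [Gc] 4) \<Gamma>A1"
    "factors_through ({id, gen_alpha}) (dihedral_words [Gc] [Gb] 4) \<Gamma>A1"
    using * by (simp_all add: generate_singleton)
qed

lemma factor_B1:
  "factors_through ({id, gen_beta}) (dihedral_words [Ga] [Gc, G\<gamma>] 2) \<Gamma>B1"
  "factors_through ({id, gen_beta}) (dihedral_words [Gc, G\<gamma>] [Ga] 2) \<Gamma>B1"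
proof -
  note * = dihedral_factorization[of "{gen_beta}" "[Ga]" "[Gc, G\<gamma>]" 2 "{gen_beta, gen_a, gen_c \<circ> gen_gamma}"]
  have "act [Ga] \<circ> x \<circ> act [Ga] \<in> generate Aut_tree {gen_beta}"
    "act [Gc, G\<gamma>] \<circ> x \<circ> act [Gc, G\<gamma>] \<in> generate Aut_tree {gen_beta}" if "x \<in> {gen_beta}" for x
    using that by (elim insertE emptyE; simp add: conjugates generate_triple generate.incl)+
  moreover have "(act [Gc, G\<gamma>] \<circ> act [Ga]) ^^ 2 \<in> generate Aut_tree {gen_beta}"
    by (simp add: c_gamma_a_power)
  moreover have "{gen_beta, gen_a, gen_c \<circ> gen_gamma} = {gen_beta} \<union> {act [Ga], act [Gc, G\<gamma>]}"
    by auto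
  ultimately show "factors_through ({id, gen_beta}) (dihedral_words [Ga] [Gc, G\<gamma>] 2) \<Gamma>B1"
    "factors_through ({id, gen_beta}) (dihedral_words [Gc, G\<gamma>] [Ga] 2) \<Gamma>B1"
    using * by (simp_all add: generate_singleton)
qed

lemma factor_C1:
  "factors_through ({id, gen_gamma}) (dihedral_words [Ga, G\<alpha>] [Gb, G\<beta>] 4) \<Gamma>C1"
  "factors_through ({id, gen_gamma}) (dihedral_words [Gb, G\<beta>] [Ga, G\<alpha>] 4) \<Gamma>C1"
proof -
  note * = dihedral_factorization[of "{gen_gamma}" "[Ga, G\<alpha>]" "[Gb, G\<beta>]" 4 "{gen_gamma, gen_a \<circ> gen_alpha, gen_b \<circ> gen_beta}"]
  have "act [Ga, G\<alpha>] \<circ> x \<circ> act [Ga, G\<alpha>] \<in> generate Aut_tree {gen_gamma}"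
    "act [Gb, G\<beta>] \<circ> x \<circ> act [Gb, G\<beta>] \<in> generate Aut_tree {gen_gamma}" if "x \<in> {gen_gamma}" for x
    using that by (elim insertE emptyE; simp add: conjugates generate_triple generate.incl)+
  moreover have "(act [Gb, G\<beta>] \<circ> act [Ga, G\<alpha>]) ^^ 4 \<in> generate Aut_tree {gen_gamma}"
    by (simp add: b_a_twisted_power)
  moreover have "{gen_gamma, gen_a \<circ> gen_alpha, gen_b \<circ> gen_beta} = {gen_gamma} \<union> {act [Ga, G\<alpha>], act [Gb, G\<beta>]}"
    by auto
  ultimately show "factors_through ({id, gen_gamma}) (dihedral_words [Ga, G\<alpha>] [Gb, G\<beta>] 4) \<Gamma>C1"
    "factors_through ({id, gen_gamma}) (dihedral_words [Gb, G\<beta>] [Ga, G\<alpha>] 4) \<Gamma>C1"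
    using * by (simp_all add: generate_singleton)
qed

section \<open>The block action and test words\<close>

fun block :: "letter \<Rightarrow> bool" where
  "block X1 = False" | "block X2 = False" | "block X3 = True" | "block X4 = True"

text \<open>The groups \<open>\<langle>\<alpha>, \<beta>, \<gamma>\<rangle>\<close> act trivially on the binary tree of words in the blocks \<open>{1, 2}\<close> and
  \<open>{3, 4}\<close>, so the action on blocks reads off the dihedral factor.\<close>

definition block_preserving :: "(word \<Rightarrow> word) set" where
  "block_preserving = {k. \<forall>v. map block (k v) = map block v}"

lemma gens_block_preserving:
  "gen_alpha \<in> block_preserving" "gen_beta \<in> block_preserving" "gen_gamma \<in> block_preserving"
proof -
  have alpha: "map block (gen_alpha v) = map block v" for v
    by (cases v; cases "hd v") auto
  have "map block (gen_beta v) = map block v \<and> map block (gen_gamma v) = map block v" for v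
  proof (induction v)
    case (Cons x v)
    then show ?case using alpha by (cases x) auto
  qed simp
  then show "gen_alpha \<in> block_preserving" "gen_beta \<in> block_preserving" "gen_gamma \<in> block_preserving"
    using alpha by (auto simp: block_preserving_def)
qed

lemma generate_block_preserving:
  assumes "S \<subseteq> {gen_alpha, gen_beta, gen_gamma}"
  shows "generate Aut_tree S \<subseteq> block_preserving"
proof
  fix h assume "h \<in> generate Aut_tree S"
  then show "h \<in> block_preserving"
  proof (rule generate_involutions_induct)
    show "S \<subseteq> involutions" using assms by auto
    show "id \<in> block_preserving" by (simp add: block_preserving_def)
    show "s \<circ> p \<in> block_preserving" if "s \<in> S" "p \<in> block_preserving" for s p
      using that assms gens_block_preserving by (auto simp: block_preserving_def)
  qed
qed

text \<open>The values of the words are arguments, so that \<^verbatim>\<open>code_simp\<close> evaluates each of them only once.\<close>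

definition values_separated :: "('a \<times> 'b) list \<Rightarrow> ('a \<times> 'b) list \<Rightarrow> ('a \<Rightarrow> 'a \<Rightarrow> bool) \<Rightarrow> bool" where
  "values_separated A B P \<longleftrightarrow> (\<forall>(x, i)\<in>set A. \<forall>(y, j)\<in>set B. i = j \<longrightarrow> P x y)"

lemma values_separatedD:
  "values_separated (map (\<lambda>x. (x, f x)) D1) (map (\<lambda>x. (x, f x)) D2) P \<Longrightarrow>
     x \<in> set D1 \<Longrightarrow> y \<in> set D2 \<Longrightarrow> f x = f y \<Longrightarrow> P x y"
  by (auto simp: values_separated_def)

text \<open>The block action is sampled at three words only. That these samples suffice is the
  content of the \<open>blocks_separated\<close> checks below.\<close>

definition block_values :: "generator list \<Rightarrow> bool list list" where
  "block_values x = map (\<lambda>v. map block (act x v)) [[X1, X1, X1], [X1, X3, X1], [X3, X1, X1]]"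

text \<open>Apart from two empty words, one coincidence is tolerated, that of \<open>e1\<close> with
  \<open>e2\<close>. These may differ as words, since b and b\<beta>, for example, act alike on
  blocks.\<close>

definition blocks_separated ::
  "generator list list \<Rightarrow> generator list list \<Rightarrow> generator list \<Rightarrow> generator list \<Rightarrow> bool" where
  "blocks_separated D1 D2 e1 e2 \<longleftrightarrow>
     values_separated (map (\<lambda>x. (x, block_values x)) D1) (map (\<lambda>x. (x, block_values x)) D2)
       (\<lambda>x y. x = [] \<and> y = [] \<or> x = e1 \<and> y = e2)"

text \<open>The factors in \<open>H1\<close> and \<open>H2\<close> are invisible on blocks, so the
  two dihedral factors of \<open>h\<close> have equal block values, and only the tolerated
  coincidences remain.\<close>

lemma common_factor:
  assumes "factors_through H1 D1 G1" "factors_through H2 D2 G2"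
    and "H1 \<subseteq> block_preserving" "H2 \<subseteq> block_preserving"
    and "blocks_separated D1 D2 e1 e2" "h \<in> G1" "h \<in> G2"
  shows "h \<in> H1 \<inter> H2 \<or> (\<exists>k1\<in>H1. \<exists>k2\<in>H2. h = k1 \<circ> act e1 \<and> h = k2 \<circ> act e2)"
proof -
  obtain k1 d1 where 1: "k1 \<in> H1" "d1 \<in> set D1" "h = k1 \<circ> act d1"
    using assms(1,6) by (auto simp: factors_through_def)
  obtain k2 d2 where 2: "k2 \<in> H2" "d2 \<in> set D2" "h = k2 \<circ> act d2"
    using assms(2,7) by (auto simp: factors_through_def)
  have "map block (act d1 v) = map block (act d2 v)" for v
  proof -
    have "k1 (act d1 v) = k2 (act d2 v)"
      using fun_cong[OF trans[OF 1(3)[symmetric] 2(3)], of v] by simp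
    moreover have "map block (k1 u) = map block u" "map block (k2 u) = map block u" for u
      using 1(1) 2(1) assms(3,4) by (auto simp: block_preserving_def)
    ultimately show ?thesis by metis
  qed
  then have "block_values d1 = block_values d2"
    unfolding block_values_def by simp
  then have "d1 = [] \<and> d2 = [] \<or> d1 = e1 \<and> d2 = e2"
    using values_separatedD[OF assms(5)[unfolded blocks_separated_def] 1(2) 2(2)] by simp
  then show ?thesis
  proof
    assume "d1 = [] \<and> d2 = []"
    then show ?thesis using 1 2 by auto
  next
    assume "d1 = e1 \<and> d2 = e2"
    then have "h = k1 \<circ> act e1" "h = k2 \<circ> act e2" using 1(3) 2(3) by blast+
    then show ?thesis using 1(1) 2(1) by blast
  qed
qed

definition words_separated ::
  "word list \<Rightarrow> generator list list \<Rightarrow> generator list list \<Rightarrow> generator list list \<Rightarrow> bool" where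
  "words_separated ws D1 D2 E \<longleftrightarrow>
     values_separated (map (\<lambda>x. (x, map (act x) ws)) D1) (map (\<lambda>x. (x, map (act x) ws)) D2)
       (\<lambda>x y. x \<in> set E)"

text \<open>With trivial left factors, a common element is the action of a listed word of either
  group, and these two words agree at all test words.\<close>

lemma intersection_by_words:
  assumes "factors_through {id} D1 G1" "factors_through {id} D2 G2"
    and "words_separated ws D1 D2 E"
  shows "G1 \<inter> G2 \<subseteq> act ` set E"
proof
  fix h assume h: "h \<in> G1 \<inter> G2"
  then obtain x where x: "x \<in> set D1" "h = act x"
    using assms(1) by (auto simp: factors_through_def)
  obtain y where y: "y \<in> set D2" "h = act y"
    using assms(2) h by (auto simp: factors_through_def)
  have "x \<in> set E"
    using values_separatedD[OF assms(3)[unfolded words_separated_def] x(1) y(1)] x(2) y(2) by simp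
  then show "h \<in> act ` set E" using x(2) by simp
qed

text \<open>A left factor with two values is moved into the list, which prepares
  \<open>\<Gamma>A1\<close>, \<open>\<Gamma>B1\<close>, \<open>\<Gamma>C1\<close> for
  \<open>intersection_by_words\<close>.\<close>

lemma factors_through_extend:
  assumes "factors_through {id, act s} D G"
  shows "factors_through {id} (D @ map (\<lambda>d. s @ d) D) G"
  unfolding factors_through_def
proof
  fix h assume "h \<in> G"
  then obtain k d where kd: "k \<in> {id, act s}" "d \<in> set D" "h = k \<circ> act d"
    using assms unfolding factors_through_def by blast
  then have "h = id \<circ> act d \<or> h = id \<circ> act (s @ d)" by (auto simp: act_append)
  then show "\<exists>k\<in>{id}. \<exists>d\<in>set (D @ map (\<lambda>d. s @ d) D). h = k \<circ> act d"
    using kd(2) by auto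
qed

text \<open>The test words in the following checks were found by a computer search.\<close>

lemma words_separated_AC:
  "words_separated [[X1, X2, X1, X1, X1], [X4, X1, X4, X2, X2]]
    (dihedral_words [G\<beta>] [G\<alpha>] 8) (dihedral_words [G\<beta>] [G\<gamma>] 8) [[], [G\<beta>]]"
  by code_simp

lemma words_separated_AB:
  "words_separated [[X1, X1, X1, X3, X1], [X3, X2, X1, X1, X3], [X4, X3, X1, X1, X4]]
    (dihedral_words [G\<gamma>] [G\<beta>] 8) (dihedral_words [G\<gamma>] [G\<alpha>] 4) [[], [G\<gamma>]]"
  by code_simp

lemma words_separated_BC:
  "words_separated [[X1, X1, X1, X1], [X2, X1, X1, X1]]
    (dihedral_words [G\<alpha>] [G\<gamma>] 4) (dihedral_words [G\<alpha>] [G\<beta>] 8) [[], [G\<alpha>]]"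
  by code_simp

lemma blocks_separated_AB:
  "blocks_separated (dihedral_words [Gc] [Gb] 4) (dihedral_words [Gc] [Ga] 2) [Gc] [Gc]"
  by code_simp

lemma blocks_separated_AC:
  "blocks_separated (dihedral_words [Gb] [Gc] 4) (dihedral_words [Gb] [Ga] 4) [Gb] [Gb]"
  by code_simp

lemma blocks_separated_BC:
  "blocks_separated (dihedral_words [Ga] [Gc] 2) (dihedral_words [Ga] [Gb] 4) [Ga] [Ga]"
  by code_simp

lemma blocks_separated_AB1:
  "blocks_separated (dihedral_words [Gc] [Gb] 4) (dihedral_words [Gc, G\<gamma>] [Ga] 2) [Gc] [Gc, G\<gamma>]"
  by code_simp

lemma blocks_separated_AC1:
  "blocks_separated (dihedral_words [Gb] [Gc] 4) (dihedral_words [Gb, G\<beta>] [Ga, G\<alpha>] 4) [Gb] [Gb, G\<beta>]"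
  by code_simp

lemma blocks_separated_BA1:
  "blocks_separated (dihedral_words [Gc] [Ga] 2) (dihedral_words [Gc] [Gb] 4) [Gc] [Gc]"
  by code_simp

lemma blocks_separated_BC1:
  "blocks_separated (dihedral_words [Ga] [Gc] 2) (dihedral_words [Ga, G\<alpha>] [Gb, G\<beta>] 4) [Ga] [Ga, G\<alpha>]"
  by code_simp

lemma blocks_separated_CA1:
  "blocks_separated (dihedral_words [Gb] [Ga] 4) (dihedral_words [Gb] [Gc] 4) [Gb] [Gb]"
  by code_simp

lemma blocks_separated_CB1:
  "blocks_separated (dihedral_words [Ga] [Gb] 4) (dihedral_words [Ga] [Gc, G\<gamma>] 2) [Ga] [Ga]"
  by code_simp

lemma words_separated_A1B1:
  "words_separated [[X1, X1, X1], [X1, X2, X1]]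
    (dihedral_words [Gb] [Gc] 4 @ map (\<lambda>d. [G\<alpha>] @ d) (dihedral_words [Gb] [Gc] 4))
    (dihedral_words [Ga] [Gc, G\<gamma>] 2 @ map (\<lambda>d. [G\<beta>] @ d) (dihedral_words [Ga] [Gc, G\<gamma>] 2)) [[]]"
  by code_simp

lemma words_separated_A1C1:
  "words_separated [[X1, X1, X1], [X2, X2, X1]]
    (dihedral_words [Gb] [Gc] 4 @ map (\<lambda>d. [G\<alpha>] @ d) (dihedral_words [Gb] [Gc] 4))
    (dihedral_words [Ga, G\<alpha>] [Gb, G\<beta>] 4 @
      map (\<lambda>d. [G\<gamma>] @ d) (dihedral_words [Ga, G\<alpha>] [Gb, G\<beta>] 4)) [[]]"
  by code_simp

lemma words_separated_B1C1:
  "words_separated [[X1, X1, X1], [X2, X1, X1]]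
    (dihedral_words [Ga] [Gc, G\<gamma>] 2 @ map (\<lambda>d. [G\<beta>] @ d) (dihedral_words [Ga] [Gc, G\<gamma>] 2))
    (dihedral_words [Ga, G\<alpha>] [Gb, G\<beta>] 4 @
      map (\<lambda>d. [G\<gamma>] @ d) (dihedral_words [Ga, G\<alpha>] [Gb, G\<beta>] 4)) [[]]"
  by code_simp

section \<open>Intersections within the two families\<close>

lemma act_cancel:
  assumes "f \<circ> act w = g \<circ> act w" shows "f = g"
proof
  fix v show "f v = g v" using fun_cong[OF assms, of "act (rev w) v"] by simp
qed

lemma intersect_AB: "generate Aut_tree {gen_beta, gen_gamma} \<inter> generate Aut_tree {gen_alpha, gen_gamma} \<subseteq> {id, gen_gamma}"
  using intersection_by_words[OF dihedral_beta_gamma(2) dihedral_alpha_gamma(2) words_separated_AB] by auto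

lemma intersect_AC: "generate Aut_tree {gen_beta, gen_gamma} \<inter> generate Aut_tree {gen_alpha, gen_beta} \<subseteq> {id, gen_beta}"
  using intersection_by_words[OF dihedral_alpha_beta(2) dihedral_beta_gamma(1) words_separated_AC] by auto

lemma intersect_BC: "generate Aut_tree {gen_alpha, gen_gamma} \<inter> generate Aut_tree {gen_alpha, gen_beta} \<subseteq> {id, gen_alpha}"
  using intersection_by_words[OF dihedral_alpha_gamma(1) dihedral_alpha_beta(1) words_separated_BC] by auto

text \<open>If the dihedral factor is \<open>e\<close> on both sides, it cancels: the left factors
  agree and lie in \<open>H1 \<inter> H2\<close>.\<close>

lemma common_factor_same:
  assumes "factors_through H1 D1 G1" "factors_through H2 D2 G2"
    and "H1 \<subseteq> block_preserving" "H2 \<subseteq> block_preserving"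
    and "blocks_separated D1 D2 [e] [e]" "H1 \<inter> H2 \<subseteq> {id, x}"
  shows "G1 \<inter> G2 \<subseteq> {id, x, gen_act e, x \<circ> gen_act e}"
proof
  fix h assume h: "h \<in> G1 \<inter> G2"
  then consider "h \<in> H1 \<inter> H2"
    | k1 k2 where "k1 \<in> H1" "k2 \<in> H2" "h = k1 \<circ> act [e]" "h = k2 \<circ> act [e]"
    using common_factor[OF assms(1-5)] by blast
  then show "h \<in> {id, x, gen_act e, x \<circ> gen_act e}"
  proof cases
    case 1
    then show ?thesis using assms(6) by auto
  next
    case (2 k1 k2)
    then have "k1 = k2" using act_cancel[of k1 "[e]" k2] by simp
    then have "k1 \<in> {id, x}" using 2 assms(6) by auto
    then show ?thesis using 2 by auto
  qed
qed

lemma \<Gamma>A_Int_\<Gamma>B: "\<Gamma>A \<inter> \<Gamma>B \<subseteq> {id, gen_gamma, gen_c, gen_gamma \<circ> gen_c}"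
  using common_factor_same[OF factor_A(2) factor_B(2) _ _ blocks_separated_AB intersect_AB]
  by (simp add: generate_block_preserving)

lemma \<Gamma>A_Int_\<Gamma>C: "\<Gamma>A \<inter> \<Gamma>C \<subseteq> {id, gen_beta, gen_b, gen_beta \<circ> gen_b}"
  using common_factor_same[OF factor_A(1) factor_C(2) _ _ blocks_separated_AC intersect_AC]
  by (simp add: generate_block_preserving)

lemma \<Gamma>B_Int_\<Gamma>C: "\<Gamma>B \<inter> \<Gamma>C \<subseteq> {id, gen_alpha, gen_a, gen_alpha \<circ> gen_a}"
  using common_factor_same[OF factor_B(1) factor_C(1) _ _ blocks_separated_BC intersect_BC]
  by (simp add: generate_block_preserving)

lemma \<Gamma>A1_Int_\<Gamma>B1: "\<Gamma>A1 \<inter> \<Gamma>B1 \<subseteq> {id}"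
  using intersection_by_words[OF factors_through_extend[of "[G\<alpha>]"] factors_through_extend[of "[G\<beta>]"] words_separated_A1B1]
    factor_A1 factor_B1 by simp

lemma \<Gamma>A1_Int_\<Gamma>C1: "\<Gamma>A1 \<inter> \<Gamma>C1 \<subseteq> {id}"
  using intersection_by_words[OF factors_through_extend[of "[G\<alpha>]"] factors_through_extend[of "[G\<gamma>]"] words_separated_A1C1]
    factor_A1 factor_C1 by simp

lemma \<Gamma>B1_Int_\<Gamma>C1: "\<Gamma>B1 \<inter> \<Gamma>C1 \<subseteq> {id}"
  using intersection_by_words[OF factors_through_extend[of "[G\<beta>]"] factors_through_extend[of "[G\<gamma>]"] words_separated_B1C1]
    factor_B1 factor_C1 by simp

text \<open>As \<alpha> lies in \<open>\<Gamma>B\<close>, membership would put it into the list of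
  \<open>\<Gamma>A_Int_\<Gamma>B\<close>, whose elements all fix the letter 1. The next two lemmas
  use words of length two and three, the first levels on which \<beta> and \<gamma> act
  nontrivially.\<close>

lemma alpha_notin_\<Gamma>A: "gen_alpha \<notin> \<Gamma>A"
proof
  assume "gen_alpha \<in> \<Gamma>A"
  then have "gen_alpha \<in> \<Gamma>A \<inter> \<Gamma>B" by (simp add: generate.incl)
  then have "gen_alpha [X1] \<in> (\<lambda>g. g [X1]) ` {id, gen_gamma, gen_c, gen_gamma \<circ> gen_c}"
    using \<Gamma>A_Int_\<Gamma>B by blast
  then show False by simp
qed

lemma beta_notin_\<Gamma>B: "gen_beta \<notin> \<Gamma>B"
proof
  assume "gen_beta \<in> \<Gamma>B"
  then have "gen_beta \<in> \<Gamma>A \<inter> \<Gamma>B" by (simp add: generate.incl)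
  then have "gen_beta [X1, X1] \<in> (\<lambda>g. g [X1, X1]) ` {id, gen_gamma, gen_c, gen_gamma \<circ> gen_c}"
    using \<Gamma>A_Int_\<Gamma>B by blast
  then show False by simp
qed

lemma gamma_notin_\<Gamma>C: "gen_gamma \<notin> \<Gamma>C"
proof
  assume "gen_gamma \<in> \<Gamma>C"
  then have "gen_gamma \<in> \<Gamma>A \<inter> \<Gamma>C" by (simp add: generate.incl)
  then have "gen_gamma [X1, X1, X1] \<in> (\<lambda>g. g [X1, X1, X1]) ` {id, gen_beta, gen_b, gen_beta \<circ> gen_b}"
    using \<Gamma>A_Int_\<Gamma>C by blast
  then show False by simp
qed

section \<open>Generation of the intersections by members of \<open>nucleus\<close>\<close>

lemma act_dihedral_in_generate:
  assumes "d \<in> set (dihedral_words s t m)"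
  shows "act d \<in> generate Aut_tree {act s, act t}"
proof -
  have s: "act s \<in> generate Aut_tree {act s, act t}" and t: "act t \<in> generate Aut_tree {act s, act t}"
    by (auto intro: generate.incl)
  have "act (rotation_word s t i) \<in> generate Aut_tree {act s, act t}" for i
    unfolding act_rotation_word by (rule generate_power[OF generate_comp[OF t s]])
  moreover from this have "act (s @ rotation_word s t i) \<in> generate Aut_tree {act s, act t}" for i
    unfolding act_append by (rule generate_comp[OF s])
  ultimately show ?thesis
    using assms by (auto simp: set_dihedral_words)
qed

lemma generate_comp_cancel:
  assumes "S \<subseteq> involutions" "k \<circ> g \<in> generate Aut_tree S" "g \<in> generate Aut_tree S"
    "k \<in> tree_automorphisms"
  shows "k \<in> generate Aut_tree S"
proof -
  note sub = subgroup_generate[OF assms(1)]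
  have g: "g \<in> tree_automorphisms" using subgroup.subset[OF sub] assms(3) by auto
  have "(k \<circ> g) \<circ> inv\<^bsub>Aut_tree\<^esub> g \<in> generate Aut_tree S"
    by (intro generate_comp assms(2) subgroup.m_inv_closed[OF sub] assms(3))
  moreover have "g \<circ> inv\<^bsub>Aut_tree\<^esub> g = id"
    using group.r_inv[OF group_Aut_tree, of g] g by simp
  ultimately show ?thesis by (simp add: comp_assoc)
qed

lemma generate_mono: "S \<subseteq> T \<Longrightarrow> generate Aut_tree S \<subseteq> generate Aut_tree T"
  by (rule group.mono_generate[OF group_Aut_tree])

text \<open>The dihedral factor of \<open>h\<close> lies in both groups. Dividing by it leaves
  \<open>id\<close> or \<open>x\<close>, and \<open>x\<close> is excluded. This covers the pairs of
  \<open>\<Gamma>A\<close> with \<open>\<Gamma>A1\<close>, \<open>\<Gamma>B\<close> with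
  \<open>\<Gamma>B1\<close> and \<open>\<Gamma>C\<close> with \<open>\<Gamma>C1\<close>, which share
  both involutions of the dihedral factor.\<close>

lemma generated_by_dihedral:
  assumes "factors_through {id, x} (dihedral_words s t m) G1"
    and "x \<notin> generate Aut_tree S" "S \<subseteq> involutions" "x \<in> tree_automorphisms"
    and "{act s, act t} \<subseteq> G1 \<inter> generate Aut_tree S \<inter> nucleus"
    and "h \<in> generate Aut_tree S" "h \<in> G1"
  shows "h \<in> generate Aut_tree (generate Aut_tree S \<inter> G1 \<inter> nucleus)"
proof -
  obtain k d where kd: "k \<in> {id, x}" "d \<in> set (dihedral_words s t m)" "h = k \<circ> act d"
    using assms(1,7) unfolding factors_through_def by blast
  have d: "act d \<in> generate Aut_tree {act s, act t}"
    by (rule act_dihedral_in_generate[OF kd(2)])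
  also have "\<dots> \<subseteq> generate Aut_tree S"
    using assms(3,5) by (intro group.generate_subgroup_incl[OF group_Aut_tree] subgroup_generate) auto
  finally have "act d \<in> generate Aut_tree S" .
  moreover have "k \<in> tree_automorphisms" using kd(1) assms(4) by auto
  ultimately have "k \<in> generate Aut_tree S"
    using generate_comp_cancel[OF assms(3), of k "act d"] kd(3) assms(6) by simp
  then have "k = id" using kd(1) assms(2) by auto
  moreover have "{act s, act t} \<subseteq> generate Aut_tree S \<inter> G1 \<inter> nucleus"
    using assms(5) by blast
  ultimately show ?thesis
    using kd(3) d generate_mono[of "{act s, act t}" "generate Aut_tree S \<inter> G1 \<inter> nucleus"] by auto
qed

text \<open>For the other six mixed pairs, the shared dihedral part is a single involution: a common
  element is a product of \<open>id\<close> or \<open>x\<close> with \<open>id\<close> or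
  \<open>act e2\<close>.\<close>

lemma generated_by_common_factor:
  assumes "factors_through H1 D1 G1" "factors_through {id, x} D2 G2"
    and "H1 \<subseteq> block_preserving" "x \<in> block_preserving"
    and "blocks_separated D1 D2 e1 e2" "h \<in> G1" "h \<in> G2"
    and "{x, act e2} \<subseteq> G1 \<inter> G2 \<inter> nucleus"
  shows "h \<in> generate Aut_tree (G1 \<inter> G2 \<inter> nucleus)"
proof -
  have "{id, x} \<subseteq> block_preserving" using assms(4) by (auto simp: block_preserving_def)
  from common_factor[OF assms(1,2,3) this assms(5-7)]
  consider "h \<in> {id, x}" | k where "k \<in> {id, x}" "h = k \<circ> act e2" by blast
  then have "h \<in> {id, x, act e2, x \<circ> act e2}" by cases auto
  moreover have "x \<in> generate Aut_tree (G1 \<inter> G2 \<inter> nucleus)" "act e2 \<in> generate Aut_tree (G1 \<inter> G2 \<inter> nucleus)"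
    using assms(8) by (auto intro: generate.incl)
  ultimately show ?thesis using generate_comp[of x _ "act e2"] by auto
qed

lemma nucleus_involutions: "nucleus \<subseteq> involutions"
  by (auto simp: nucleus_def involutions_def alpha_a_commute beta_b_commute gamma_c_commute
      gamma_a_alpha_commute alpha_c_commute)

lemma nucleus_mem [simp]:
  "id \<in> nucleus" "gen_alpha \<in> nucleus" "gen_beta \<in> nucleus" "gen_gamma \<in> nucleus"
  "gen_a \<in> nucleus" "gen_b \<in> nucleus" "gen_c \<in> nucleus"
  "gen_a \<circ> gen_alpha \<in> nucleus" "gen_b \<circ> gen_beta \<in> nucleus" "gen_c \<circ> gen_gamma \<in> nucleus"
  by (simp_all add: nucleus_def)

lemma commuted_mem_nucleus:
  "gen_gamma \<circ> gen_c \<in> nucleus" "gen_beta \<circ> gen_b \<in> nucleus" "gen_alpha \<circ> gen_a \<in> nucleus"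
proof -
  have "gen_gamma \<circ> gen_c = gen_c \<circ> gen_gamma" "gen_beta \<circ> gen_b = gen_b \<circ> gen_beta"
    "gen_alpha \<circ> gen_a = gen_a \<circ> gen_alpha"
    by (auto simp: beta_b_commute gamma_c_commute alpha_a_commute)
  then show "gen_gamma \<circ> gen_c \<in> nucleus" "gen_beta \<circ> gen_b \<in> nucleus" "gen_alpha \<circ> gen_a \<in> nucleus"
    by simp_all
qed

lemma generate_pair: "s \<in> S \<Longrightarrow> t \<in> S \<Longrightarrow> s \<circ> t \<in> generate Aut_tree S"
  by (intro generate_comp generate.incl)

lemma mixed_AA1: "h \<in> \<Gamma>A \<Longrightarrow> h \<in> \<Gamma>A1 \<Longrightarrow> h \<in> generate Aut_tree (\<Gamma>A \<inter> \<Gamma>A1 \<inter> nucleus)"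
  by (rule generated_by_dihedral[OF factor_A1(1) alpha_notin_\<Gamma>A]) (auto intro: generate.incl)

lemma mixed_BB1: "h \<in> \<Gamma>B \<Longrightarrow> h \<in> \<Gamma>B1 \<Longrightarrow> h \<in> generate Aut_tree (\<Gamma>B \<inter> \<Gamma>B1 \<inter> nucleus)"
  by (rule generated_by_dihedral[OF factor_B1(1) beta_notin_\<Gamma>B]) (auto intro: generate.incl generate_pair)

lemma mixed_CC1: "h \<in> \<Gamma>C \<Longrightarrow> h \<in> \<Gamma>C1 \<Longrightarrow> h \<in> generate Aut_tree (\<Gamma>C \<inter> \<Gamma>C1 \<inter> nucleus)"
  by (rule generated_by_dihedral[OF factor_C1(1) gamma_notin_\<Gamma>C]) (auto intro: generate.incl generate_pair)

lemma mixed_AB1: "h \<in> \<Gamma>A \<Longrightarrow> h \<in> \<Gamma>B1 \<Longrightarrow> h \<in> generate Aut_tree (\<Gamma>A \<inter> \<Gamma>B1 \<inter> nucleus)"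
  by (rule generated_by_common_factor[OF factor_A(2) factor_B1(2) _ _ blocks_separated_AB1])
    (simp_all add: generate_block_preserving gens_block_preserving generate.incl generate_pair)

lemma mixed_AC1: "h \<in> \<Gamma>A \<Longrightarrow> h \<in> \<Gamma>C1 \<Longrightarrow> h \<in> generate Aut_tree (\<Gamma>A \<inter> \<Gamma>C1 \<inter> nucleus)"
  by (rule generated_by_common_factor[OF factor_A(1) factor_C1(2) _ _ blocks_separated_AC1])
    (simp_all add: generate_block_preserving gens_block_preserving generate.incl generate_pair)

lemma mixed_BA1: "h \<in> \<Gamma>B \<Longrightarrow> h \<in> \<Gamma>A1 \<Longrightarrow> h \<in> generate Aut_tree (\<Gamma>B \<inter> \<Gamma>A1 \<inter> nucleus)"
  by (rule generated_by_common_factor[OF factor_B(2) factor_A1(2) _ _ blocks_separated_BA1])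
    (simp_all add: generate_block_preserving gens_block_preserving generate.incl generate_pair)

lemma mixed_BC1: "h \<in> \<Gamma>B \<Longrightarrow> h \<in> \<Gamma>C1 \<Longrightarrow> h \<in> generate Aut_tree (\<Gamma>B \<inter> \<Gamma>C1 \<inter> nucleus)"
  by (rule generated_by_common_factor[OF factor_B(1) factor_C1(1) _ _ blocks_separated_BC1])
    (simp_all add: generate_block_preserving gens_block_preserving generate.incl generate_pair)

lemma mixed_CA1: "h \<in> \<Gamma>C \<Longrightarrow> h \<in> \<Gamma>A1 \<Longrightarrow> h \<in> generate Aut_tree (\<Gamma>C \<inter> \<Gamma>A1 \<inter> nucleus)"
  by (rule generated_by_common_factor[OF factor_C(2) factor_A1(1) _ _ blocks_separated_CA1])
    (simp_all add: generate_block_preserving gens_block_preserving generate.incl generate_pair)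

lemma mixed_CB1: "h \<in> \<Gamma>C \<Longrightarrow> h \<in> \<Gamma>B1 \<Longrightarrow> h \<in> generate Aut_tree (\<Gamma>C \<inter> \<Gamma>B1 \<inter> nucleus)"
  by (rule generated_by_common_factor[OF factor_C(1) factor_B1(1) _ _ blocks_separated_CB1])
    (simp_all add: generate_block_preserving gens_block_preserving generate.incl generate_pair)

lemma six_groups_eq: "six_groups = {\<Gamma>A, \<Gamma>B, \<Gamma>C} \<union> {\<Gamma>A1, \<Gamma>B1, \<Gamma>C1}"
  by (auto simp: six_groups_def)

lemma Int_distinct_of_three:
  assumes "X \<in> {A, B, C}" "Y \<in> {A, B, C}" "X \<noteq> Y"
    and "A \<inter> B \<subseteq> N" "A \<inter> C \<subseteq> N" "B \<inter> C \<subseteq> N"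
  shows "X \<inter> Y \<subseteq> N"
  using assms by auto

lemma Int_same_family:
  assumes "{X, Y} \<subseteq> {\<Gamma>A, \<Gamma>B, \<Gamma>C} \<or> {X, Y} \<subseteq> {\<Gamma>A1, \<Gamma>B1, \<Gamma>C1}" "X \<noteq> Y"
  shows "X \<inter> Y \<subseteq> nucleus"
  using assms(1)
proof
  assume "{X, Y} \<subseteq> {\<Gamma>A, \<Gamma>B, \<Gamma>C}"
  then have "X \<in> {\<Gamma>A, \<Gamma>B, \<Gamma>C}" "Y \<in> {\<Gamma>A, \<Gamma>B, \<Gamma>C}" by blast+
  then show ?thesis
    by (rule Int_distinct_of_three[OF _ _ assms(2) order_trans[OF \<Gamma>A_Int_\<Gamma>B]
          order_trans[OF \<Gamma>A_Int_\<Gamma>C] order_trans[OF \<Gamma>B_Int_\<Gamma>C]]) (simp_all add: commuted_mem_nucleus)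
next
  assume "{X, Y} \<subseteq> {\<Gamma>A1, \<Gamma>B1, \<Gamma>C1}"
  then have "X \<in> {\<Gamma>A1, \<Gamma>B1, \<Gamma>C1}" "Y \<in> {\<Gamma>A1, \<Gamma>B1, \<Gamma>C1}" by blast+
  then show ?thesis
    by (rule Int_distinct_of_three[OF _ _ assms(2) order_trans[OF \<Gamma>A1_Int_\<Gamma>B1]
          order_trans[OF \<Gamma>A1_Int_\<Gamma>C1] order_trans[OF \<Gamma>B1_Int_\<Gamma>C1]]) simp_all
qed

lemma Int_mixed_of_three:
  assumes "X \<in> {A, B, C}" "Y \<in> {D, E, F}"
    and "P A D" "P A E" "P A F" "P B D" "P B E" "P B F" "P C D" "P C E" "P C F"
  shows "P X Y"
  using assms by auto

lemma Int_mixed_family: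
  assumes "X \<in> {\<Gamma>A, \<Gamma>B, \<Gamma>C}" "Y \<in> {\<Gamma>A1, \<Gamma>B1, \<Gamma>C1}"
  shows "X \<inter> Y \<subseteq> generate Aut_tree (X \<inter> Y \<inter> nucleus)"
  using assms by (rule Int_mixed_of_three[of _ _ _ _ _ _ _ _ "\<lambda>X Y. X \<inter> Y \<subseteq> generate Aut_tree (X \<inter> Y \<inter> nucleus)"])
    (rule subsetI, elim IntE, rule mixed_AA1 mixed_AB1 mixed_AC1 mixed_BA1 mixed_BB1 mixed_BC1
      mixed_CA1 mixed_CB1 mixed_CC1, assumption, assumption)+

text \<open>The explicit groups are hidden behind two families, so that the rest is a pigeonhole
  argument about sets.\<close>

lemma six_groups_families:
  "\<exists>F1 F2. six_groups = F1 \<union> F2 \<and>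
     (\<forall>X Y. ({X, Y} \<subseteq> F1 \<or> {X, Y} \<subseteq> F2) \<longrightarrow> X \<noteq> Y \<longrightarrow> X \<inter> Y \<subseteq> nucleus) \<and>
     (\<forall>X\<in>F1. \<forall>Y\<in>F2. X \<inter> Y \<subseteq> generate Aut_tree (X \<inter> Y \<inter> nucleus))"
  by (intro exI conjI allI impI ballI, rule six_groups_eq, rule Int_same_family, assumption+,
      rule Int_mixed_family, assumption+)

lemma generated_trivially: "G \<subseteq> N \<Longrightarrow> G \<subseteq> generate Aut_tree (G \<inter> N)"
  by (auto intro: generate.incl)

lemma six_groups_generated:
  assumes "X \<in> six_groups" shows "X \<subseteq> generate Aut_tree (X \<inter> nucleus)"
proof -
  have *: "generate Aut_tree S \<subseteq> generate Aut_tree (generate Aut_tree S \<inter> nucleus)" if "S \<subseteq> nucleus" for S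
    by (rule generate_mono) (use that in \<open>auto intro: generate.incl\<close>)
  have "\<exists>S. X = generate Aut_tree S \<and> S \<subseteq> nucleus"
    using assms unfolding six_groups_def
    by (elim insertE emptyE) (intro exI conjI, assumption, simp)+
  then show ?thesis using * by auto
qed

lemma pair_generated:
  assumes "X \<in> six_groups" "Y \<in> six_groups"
  shows "X \<inter> Y \<subseteq> generate Aut_tree (X \<inter> Y \<inter> nucleus)"
proof (cases "X = Y")
  case True
  then show ?thesis using six_groups_generated[OF assms(1)] by simp
next
  case False
  obtain F1 F2 where F: "six_groups = F1 \<union> F2"
    and same: "\<forall>X Y. ({X, Y} \<subseteq> F1 \<or> {X, Y} \<subseteq> F2) \<longrightarrow> X \<noteq> Y \<longrightarrow> X \<inter> Y \<subseteq> nucleus"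
    and mixed: "\<forall>X\<in>F1. \<forall>Y\<in>F2. X \<inter> Y \<subseteq> generate Aut_tree (X \<inter> Y \<inter> nucleus)"
    using six_groups_families by (elim exE conjE) (rule that)
  consider "{X, Y} \<subseteq> F1 \<or> {X, Y} \<subseteq> F2" | "X \<in> F1" "Y \<in> F2" | "Y \<in> F1" "X \<in> F2"
    using assms F by blast
  then show ?thesis
  proof cases
    case 1
    then have "X \<inter> Y \<subseteq> nucleus" using same[rule_format, of X Y] False by simp
    then show ?thesis by (rule generated_trivially)
  next
    case 2
    then show ?thesis using mixed by simp
  next
    case 3
    then have "Y \<inter> X \<subseteq> generate Aut_tree (Y \<inter> X \<inter> nucleus)" using mixed by simp
    then show ?thesis by (simp only: Int_commute)
  qed
qed

text \<open>If two of the three groups coincide, only a pair is left. Of three distinct groups, two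
  belong to the same family, so that their intersection already lies in
  \<open>nucleus\<close>.\<close>

lemma vertex_group_generated:
  assumes "G \<in> vertex_groups"
  shows "G \<subseteq> generate Aut_tree (G \<inter> nucleus)"
proof -
  obtain X Y Z where G: "G = X \<inter> Y \<inter> Z" and XYZ: "X \<in> six_groups" "Y \<in> six_groups" "Z \<in> six_groups"
    using assms unfolding vertex_groups_def by blast
  show ?thesis
  proof (cases "X \<noteq> Y \<and> X \<noteq> Z \<and> Y \<noteq> Z")
    case False
    then obtain P Q where "P \<in> six_groups" "Q \<in> six_groups" "G = P \<inter> Q"
      using G XYZ by (metis Int_absorb Int_commute Int_left_absorb)
    then show ?thesis using pair_generated by blast
  next
    case True
    obtain F1 F2 where F: "six_groups = F1 \<union> F2"
      and same: "\<forall>X Y. ({X, Y} \<subseteq> F1 \<or> {X, Y} \<subseteq> F2) \<longrightarrow> X \<noteq> Y \<longrightarrow> X \<inter> Y \<subseteq> nucleus"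
      using six_groups_families by (elim exE conjE) (rule that)
    consider "{X, Y} \<subseteq> F1 \<or> {X, Y} \<subseteq> F2" | "{X, Z} \<subseteq> F1 \<or> {X, Z} \<subseteq> F2"
      | "{Y, Z} \<subseteq> F1 \<or> {Y, Z} \<subseteq> F2"
      using XYZ unfolding F by blast
    then have "G \<subseteq> nucleus"
      using True G by cases (use same in blast)+
    then show ?thesis by (rule generated_trivially)
  qed
qed

section \<open>Sections and the parity of a group element\<close>

lemma generate_subset_range_act:
  assumes "S = act ` set W" "\<forall>w\<in>set W. act w \<in> involutions"
  shows "h \<in> generate Aut_tree S \<Longrightarrow> h \<in> range act"
proof (rule generate_involutions_induct)
  show "S \<subseteq> involutions" using assms by auto
  show "id \<in> range act" by (rule image_eqI[of _ _ "[]"]) simp_all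
  show "s \<circ> p \<in> range act" if "s \<in> S" "p \<in> range act" for s p
    using that assms(1) by (auto simp flip: act_append)
qed

lemma Gamma_group_eq: "Gamma_group = range act"
proof
  show "Gamma_group \<subseteq> range act"
    unfolding Gamma_group_def
    using generate_subset_range_act[of _ "[[G\<alpha>], [G\<beta>], [G\<gamma>], [Ga], [Gb], [Gc]]"] by auto
  have "act w \<in> Gamma_group" for w
  proof (induction w)
    case Nil
    show ?case unfolding act_empty Gamma_group_def by (rule id_in_generate)
  next
    case (Cons s w)
    have "gen_act s \<in> Gamma_group"
      unfolding Gamma_group_def by (cases s) (auto intro: generate.incl)
    then have "gen_act s \<circ> act w \<in> Gamma_group"
      using Cons unfolding Gamma_group_def by (rule generate_comp)
    moreover have "gen_act s \<circ> act w = act (s # w)" by (rule ext) simp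
    ultimately show ?case by (simp only:)
  qed
  then show "range act \<subseteq> Gamma_group" by auto
qed

lemma Gamma_group_in_tree_automorphisms: "g \<in> Gamma_group \<Longrightarrow> g \<in> tree_automorphisms"
  by (auto simp: Gamma_group_eq)

lemma id_in_Gamma_group [simp]: "id \<in> Gamma_group"
  by (simp add: Gamma_group_def)

lemma Gamma_group_comp: "f \<in> Gamma_group \<Longrightarrow> g \<in> Gamma_group \<Longrightarrow> f \<circ> g \<in> Gamma_group"
  unfolding Gamma_group_def by (rule generate_comp)

lemma Gamma_group_inv: "g \<in> Gamma_group \<Longrightarrow> inv\<^bsub>Aut_tree\<^esub> g \<in> Gamma_group"
  by (auto simp: Gamma_group_eq inv_act)

lemma inv_comp:
  assumes "g \<in> Gamma_group"
  shows "inv\<^bsub>Aut_tree\<^esub> g \<circ> g = id" "g \<circ> inv\<^bsub>Aut_tree\<^esub> g = id"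
  using assms by (auto simp: Gamma_group_eq inv_act act_rev_comp)

lemma inv_inv: "g \<in> Gamma_group \<Longrightarrow> inv\<^bsub>Aut_tree\<^esub> (inv\<^bsub>Aut_tree\<^esub> g) = g"
  by (auto simp: Gamma_group_eq inv_act)

primrec word_section :: "generator list \<Rightarrow> word \<Rightarrow> generator list" where
  "word_section w [] = w"
| "word_section w (x # u) = word_section (act_section w x) u"

lemma section_at_act: "section_at (act w) u = act (word_section w u)"
proof (induction u arbitrary: w)
  case (Cons x u)
  have "(\<lambda>v. tl (act w (x # v))) = act (act_section w x)" by (simp add: act_Cons)
  then show ?case using Cons by simp
qed simp

lemma section_in_Gamma_group: "g \<in> Gamma_group \<Longrightarrow> section_at g u \<in> Gamma_group"
  by (auto simp: Gamma_group_eq section_at_act)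

lemma Gamma_group_length [simp]: "g \<in> Gamma_group \<Longrightarrow> length (g v) = length v"
  using Gamma_group_in_tree_automorphisms length_tree_automorphism by blast

lemma act_append_word: "act w (u @ v) = act w u @ act (word_section w u) v"
  by (induction u arbitrary: w) (simp_all add: act_Cons)

lemma Gamma_group_append: "g \<in> Gamma_group \<Longrightarrow> g (u @ v) = g u @ section_at g u v"
  by (auto simp: Gamma_group_eq section_at_act act_append_word)

lemma section_at_comp:
  assumes "f \<in> Gamma_group" "g \<in> Gamma_group"
  shows "section_at (f \<circ> g) u = section_at f (g u) \<circ> section_at g u"
proof
  fix v
  have "(f \<circ> g) (u @ v) = (f \<circ> g) u @ section_at (f \<circ> g) u v"
    by (rule Gamma_group_append) (rule Gamma_group_comp[OF assms])
  moreover have "(f \<circ> g) (u @ v) = f (g u) @ section_at f (g u) (section_at g u v)"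
    using assms by (simp add: Gamma_group_append)
  ultimately show "section_at (f \<circ> g) u v = (section_at f (g u) \<circ> section_at g u) v" by simp
qed

lemma section_at_id [simp]: "section_at id u = id"
proof
  show "section_at id u v = id v" for v using Gamma_group_append[of id u v] by simp
qed

section \<open>Counting the letters a, b, c\<close>

definition crossings :: "generator list \<Rightarrow> nat" where
  "crossings w = length (filter (\<lambda>s. s \<in> {Ga, Gb, Gc}) w)"

definition swaps :: "generator list \<Rightarrow> nat" where
  "swaps w = length (filter (\<lambda>s. s = Ga) w)"

text \<open>The weights 0, 1, 2 of a, b, c count how many sections at 1 it takes to turn the letter
  into an a.\<close>

definition depth :: "generator list \<Rightarrow> nat" where
  "depth w = length (filter (\<lambda>s. s = Gb) w) + 2 * length (filter (\<lambda>s. s = Gc) w)"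

lemma crossings_append [simp]: "crossings (u @ w) = crossings u + crossings w"
  by (simp add: crossings_def)

lemma depth_append [simp]: "depth (u @ w) = depth u + depth w"
  by (simp add: depth_def)

text \<open>The section of b or c at any letter contains exactly one of a, b, c, whereas the section
  of a is empty: precisely the letters a are lost.\<close>

lemma crossings_section: "crossings (act_section w x) + swaps w = crossings w"
proof (induction w)
  case (Cons s w)
  then show ?case by (cases s) (auto simp: crossings_def swaps_def)
qed (simp add: crossings_def swaps_def)

text \<open>Only a exchanges the blocks {1, 2} and {3, 4}. Hence a word that fixes a letter contains
  an even number of letters a.\<close>

lemma block_act_top: "block (act_top w x) = (block x \<noteq> odd (swaps w))"
proof (induction w)
  case (Cons s w)
  then show ?case by (cases s; cases "act_top w x") (auto simp: swaps_def)
qed (simp add: swaps_def)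

lemma depth_section:
  assumes "swaps w = 0"
  shows "depth (act_section w X1) + crossings w = depth w"
  using assms
proof (induction w)
  case (Cons s w)
  then have "swaps w = 0" by (simp add: swaps_def split: if_splits)
  \<comment> \<open>Without a, the image of 1 stays in the block {1, 2}, where the sections of b and
    c are a\<alpha> and b\<beta>. So each crossing loses one unit of depth.\<close>
  then have "act_top w X1 \<in> {X1, X2}"
    using block_act_top[of w X1] by (cases "act_top w X1") auto
  then show ?case
    using Cons \<open>swaps w = 0\<close> by (cases s) (auto simp: depth_def crossings_def swaps_def)
qed (simp add: depth_def crossings_def)

text \<open>A word that contains an \<open>a\<close> has a section with fewer crossings. Otherwise the section at \<open>1\<close>
  turns \<open>b\<close> into \<open>a\<close> and \<open>c\<close> into \<open>b\<close>. So a shortest trivial word with an odd number of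
  crossings cannot exist.\<close>

lemma even_crossings:
  assumes "act w = id" shows "even (crossings w)"
  using assms
proof (induction w rule: wf_induct[OF wf_measures[of "[crossings, depth]"]])
  case (1 w)
  have "act w (X1 # v) = X1 # v" for v using 1(2) by simp
  then have top: "act_top w X1 = X1" and sec: "act (act_section w X1) = id"
    by (auto simp: act_Cons)
  have "even (swaps w)" using block_act_top[of w X1] top by simp
  moreover have "even (crossings (act_section w X1))" if "crossings w > 0"
  proof -
    have "(act_section w X1, w) \<in> measures [crossings, depth]"
      using crossings_section[of w X1] depth_section[of w] that by (cases "swaps w = 0") auto
    then show ?thesis using 1(1) sec by blast
  qed
  ultimately show ?case using crossings_section[of w X1]
    by (metis bot_nat_0.not_eq_extremum even_add even_zero)
qed

section \<open>The even subgroup and the parity\<close>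

lemma IMG_group_gens:
  "gen_alpha \<in> IMG_group" "gen_beta \<in> IMG_group" "gen_gamma \<in> IMG_group"
  "gen_a \<circ> gen_b \<in> IMG_group" "gen_b \<circ> gen_c \<in> IMG_group"
  unfolding IMG_group_def by (auto intro: generate.incl)

lemma IMG_group_comp: "f \<in> IMG_group \<Longrightarrow> g \<in> IMG_group \<Longrightarrow> f \<circ> g \<in> IMG_group"
  unfolding IMG_group_def by (rule generate_comp)

lemma subgroup_IMG_group: "subgroup IMG_group Aut_tree"
  unfolding IMG_group_def
  by (rule group.generate_is_subgroup[OF group_Aut_tree]) auto

lemma IMG_gens_words:
  assumes "h \<in> {gen_alpha, gen_beta, gen_gamma, gen_a \<circ> gen_b, gen_b \<circ> gen_c}"
  shows "\<exists>w. h = act w \<and> even (crossings w)"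
proof -
  have "h \<in> act ` {[G\<alpha>], [G\<beta>], [G\<gamma>], [Ga, Gb], [Gb, Gc]}"
    using assms unfolding image_insert act_singleton act_pair by simp
  then obtain w where "w \<in> {[G\<alpha>], [G\<beta>], [G\<gamma>], [Ga, Gb], [Gb, Gc]}" "h = act w" by blast
  moreover from this(1) have "even (crossings w)" by (auto simp: crossings_def)
  ultimately show ?thesis by blast
qed

lemma crossings_rev [simp]: "crossings (rev w) = crossings w"
  by (simp add: crossings_def flip: rev_filter)

lemma IMG_group_words: "g \<in> IMG_group \<Longrightarrow> \<exists>w. g = act w \<and> even (crossings w)"
  unfolding IMG_group_def
proof (induction rule: generate.induct)
  case one
  then show ?case by (intro exI[of _ "[]"]) (simp add: crossings_def)
next
  case (incl h)
  then show ?case by (rule IMG_gens_words)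
next
  case (inv h)
  then obtain w where "h = act w" "even (crossings w)" using IMG_gens_words by blast
  then show ?case by (intro exI[of _ "rev w"]) (simp add: inv_act)
next
  case (eng h1 h2)
  then obtain w1 w2 where "h1 = act w1" "even (crossings w1)" "h2 = act w2" "even (crossings w2)"
    by blast
  then show ?case by (intro exI[of _ "w1 @ w2"]) (simp add: act_append)
qed

lemma IMG_group_subset: "g \<in> IMG_group \<Longrightarrow> g \<in> Gamma_group"
  using IMG_group_words Gamma_group_eq by blast

lemma IMG_group_inv: "g \<in> IMG_group \<Longrightarrow> inv\<^bsub>Aut_tree\<^esub> g \<in> IMG_group"
  by (rule subgroup.m_inv_closed[OF subgroup_IMG_group])

lemma a_conjugates_in_IMG:
  "gen_a \<circ> gen_alpha \<circ> gen_a \<in> IMG_group" "gen_a \<circ> gen_beta \<circ> gen_a \<in> IMG_group"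
  "gen_a \<circ> gen_gamma \<circ> gen_a \<in> IMG_group"
  by (simp_all add: conjugates IMG_group_gens IMG_group_comp)

lemma b_a_in_IMG: "gen_b \<circ> gen_a \<in> IMG_group"
proof -
  have "inv\<^bsub>Aut_tree\<^esub> (act [Ga, Gb]) \<in> IMG_group"
    using IMG_group_inv IMG_group_gens(4) by simp
  then show ?thesis by (simp only: inv_act) simp
qed

lemma a_c_in_IMG: "gen_a \<circ> gen_c \<in> IMG_group"
proof -
  have "gen_a \<circ> gen_c = (gen_a \<circ> gen_b) \<circ> (gen_b \<circ> gen_c)" by auto
  then show ?thesis using IMG_group_comp[OF IMG_group_gens(4,5)] by simp
qed

lemma c_a_in_IMG: "gen_c \<circ> gen_a \<in> IMG_group"
proof -
  have "inv\<^bsub>Aut_tree\<^esub> (act [Ga, Gc]) \<in> IMG_group"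
    using IMG_group_inv a_c_in_IMG by simp
  then show ?thesis by (simp only: inv_act) simp
qed

text \<open>Even and odd words are treated together, because every new letter a, b or c changes the
  parity; an odd word is corrected by an a in front.\<close>

lemma words_in_IMG:
  "(even (crossings w) \<longrightarrow> act w \<in> IMG_group) \<and>
   (odd (crossings w) \<longrightarrow> gen_a \<circ> act w \<in> IMG_group)"
proof (induction w)
  case Nil
  have "act [] \<in> IMG_group" unfolding act_empty IMG_group_def by (rule id_in_generate)
  moreover have "even (crossings [])" by (simp add: crossings_def)
  ultimately show ?case by blast
next
  case (Cons s w)
  have crossings: "even (crossings (s # w)) \<longleftrightarrow> (even (crossings w) \<noteq> (s \<in> {Ga, Gb, Gc}))"
    by (auto simp: crossings_def)
  have s_w: "act (s # w) = gen_act s \<circ> act w" by (rule ext) simp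
  show ?case
  proof (cases "even (crossings w)")
    case True
    then have w: "act w \<in> IMG_group" using Cons.IH by blast
    have "gen_act s \<in> IMG_group" if "s \<notin> {Ga, Gb, Gc}"
      using that IMG_group_gens by (cases s) auto
    moreover have "gen_a \<circ> gen_act s \<in> IMG_group" if "s \<in> {Ga, Gb, Gc}"
    proof -
      have "gen_a \<circ> gen_a \<in> IMG_group" by (simp add: comp_def flip: id_def) (simp add: IMG_group_def)
      then show ?thesis using that IMG_group_gens a_c_in_IMG by auto
    qed
    ultimately have "s \<notin> {Ga, Gb, Gc} \<Longrightarrow> act (s # w) \<in> IMG_group"
      "s \<in> {Ga, Gb, Gc} \<Longrightarrow> gen_a \<circ> act (s # w) \<in> IMG_group"
      unfolding s_w comp_assoc[symmetric] by (blast intro: IMG_group_comp[OF _ w])+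
    then show ?thesis using True crossings by blast
  next
    case False
    then have w: "gen_a \<circ> act w \<in> IMG_group" using Cons.IH by blast
    \<comment> \<open>A cancelling pair of letters a is inserted, so that the first factor becomes
      one of the products and conjugates already known to lie in \<open>IMG_group\<close>.\<close>
    have eqs: "act (s # w) = (gen_act s \<circ> gen_a) \<circ> (gen_a \<circ> act w)"
      "gen_a \<circ> act (s # w) = (gen_a \<circ> gen_act s \<circ> gen_a) \<circ> (gen_a \<circ> act w)"
      by (auto simp: s_w)
    have "gen_a \<circ> gen_act s \<circ> gen_a \<in> IMG_group" if "s \<notin> {Ga, Gb, Gc}"
      using that a_conjugates_in_IMG by (cases s) auto
    moreover have "gen_act s \<circ> gen_a \<in> IMG_group" if "s \<in> {Ga, Gb, Gc}"
    proof -
      have "gen_a \<circ> gen_a \<in> IMG_group" by (simp add: comp_def flip: id_def) (simp add: IMG_group_def)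
      then show ?thesis using that b_a_in_IMG c_a_in_IMG by auto
    qed
    ultimately have "s \<notin> {Ga, Gb, Gc} \<longrightarrow>
        (gen_a \<circ> gen_act s \<circ> gen_a) \<circ> (gen_a \<circ> act w) \<in> IMG_group"
      "s \<in> {Ga, Gb, Gc} \<longrightarrow> (gen_act s \<circ> gen_a) \<circ> (gen_a \<circ> act w) \<in> IMG_group"
      by (blast intro: IMG_group_comp[OF _ w])+
    then have "s \<notin> {Ga, Gb, Gc} \<longrightarrow> gen_a \<circ> act (s # w) \<in> IMG_group"
      "s \<in> {Ga, Gb, Gc} \<longrightarrow> act (s # w) \<in> IMG_group"
      unfolding eqs(2)[symmetric] eqs(1)[symmetric] by blast+
    then show ?thesis using False crossings by blast
  qed
qed

definition parity :: "(word \<Rightarrow> word) \<Rightarrow> bool" where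
  "parity g \<longleftrightarrow> (\<exists>w. g = act w \<and> odd (crossings w))"

text \<open>Two words \<open>w\<close>, \<open>u\<close> for one element give the trivial word
  \<open>rev w @ u\<close>, to which \<open>even_crossings\<close> applies. Hence the parity does
  not depend on the word.\<close>

lemma parity_act: "parity (act w) \<longleftrightarrow> odd (crossings w)"
proof
  assume "parity (act w)"
  then obtain u where u: "act w = act u" "odd (crossings u)" by (auto simp: parity_def)
  have "act (rev w @ u) = id"
    using u(1) by (simp add: act_append act_rev_comp flip: u(1))
  then have "even (crossings (rev w @ u))" by (rule even_crossings)
  then show "odd (crossings w)" using u(2) by simp
qed (auto simp: parity_def)

lemma parity_comp:
  assumes "f \<in> Gamma_group" "g \<in> Gamma_group"
  shows "parity (f \<circ> g) \<longleftrightarrow> parity f \<noteq> parity g"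
proof -
  obtain u w where "f = act u" "g = act w" using assms by (auto simp: Gamma_group_eq)
  then show ?thesis using parity_act[of "u @ w"] by (simp add: parity_act act_append)
qed

lemma parity_id [simp]: "\<not> parity id"
  using even_crossings by (auto simp: parity_def)

lemma parity_inv:
  assumes "g \<in> Gamma_group" shows "parity (inv\<^bsub>Aut_tree\<^esub> g) \<longleftrightarrow> parity g"
  using assms by (auto simp: Gamma_group_eq inv_act parity_act)

lemma IMG_group_iff: "g \<in> IMG_group \<longleftrightarrow> g \<in> Gamma_group \<and> \<not> parity g"
proof
  assume "g \<in> IMG_group"
  then show "g \<in> Gamma_group \<and> \<not> parity g"
    using IMG_group_words[of g] parity_act by (auto simp: Gamma_group_eq)
next
  assume "g \<in> Gamma_group \<and> \<not> parity g"
  then show "g \<in> IMG_group" using words_in_IMG by (auto simp: Gamma_group_eq parity_act)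
qed

lemma parity_gens [simp]:
  "\<not> parity gen_alpha" "\<not> parity gen_beta" "\<not> parity gen_gamma"
  "parity gen_a" "parity gen_b" "parity gen_c"
  using parity_act[of "[G\<alpha>]"] parity_act[of "[G\<beta>]"] parity_act[of "[G\<gamma>]"]
    parity_act[of "[Ga]"] parity_act[of "[Gb]"] parity_act[of "[Gc]"]
  by (simp_all add: crossings_def)

lemma gens_in_Gamma_group [simp]:
  "gen_alpha \<in> Gamma_group" "gen_beta \<in> Gamma_group" "gen_gamma \<in> Gamma_group"
  "gen_a \<in> Gamma_group" "gen_b \<in> Gamma_group" "gen_c \<in> Gamma_group"
  by (auto simp: Gamma_group_def intro: generate.incl)

section \<open>Parities and sections of the elements of \<open>nucleus\<close>\<close>

lemma nucleus_in_Gamma_group: "s \<in> nucleus \<Longrightarrow> s \<in> Gamma_group"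
  by (auto simp: nucleus_def intro!: Gamma_group_comp)

text \<open>The parity sorts the listed elements by the kind of pasting they perform: the odd ones
  connect the two copies, while \<alpha>, \<beta>, \<gamma> act inside each copy.\<close>

lemma parity_nucleus:
  assumes "s \<in> nucleus"
  shows "if parity s then s \<in> crossing_elements else s \<in> {id, gen_alpha, gen_beta, gen_gamma}"
  using assms by (auto simp: nucleus_def crossing_elements_def parity_comp Gamma_group_comp)

lemma parity_crossing_elements:
  assumes "s \<in> crossing_elements" shows "parity s" "s \<in> nucleus"
  using assms by (auto simp: crossing_elements_def nucleus_def parity_comp Gamma_group_comp)

text \<open>A finite check. The elements a\<alpha>\<gamma> and \<alpha>c enter as sections of
  b\<beta> = (a, a\<alpha>\<gamma>, \<alpha>c, c\<gamma>).\<close>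

lemma nucleus_section_letter:
  assumes "s \<in> nucleus" shows "(\<lambda>v. tl (s (x # v))) \<in> nucleus"
proof -
  have nucleus_eq: "nucleus = {\<lambda>v. v, gen_alpha, gen_beta, gen_gamma, gen_a, gen_b, gen_c,
    \<lambda>v. gen_a (gen_alpha v), \<lambda>v. gen_b (gen_beta v), \<lambda>v. gen_c (gen_gamma v),
    \<lambda>v. gen_a (gen_alpha (gen_gamma v)), \<lambda>v. gen_alpha (gen_c v)}"
    by (simp add: nucleus_def comp_def id_def)
  show ?thesis
    using assms unfolding nucleus_eq
    by (elim insertE emptyE; cases x)
      (simp_all add: alpha_c_commute alpha_a_commute)
qed

lemma nucleus_section: "s \<in> nucleus \<Longrightarrow> section_at s u \<in> nucleus"
  by (induction u arbitrary: s) (simp_all add: nucleus_section_letter)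

section \<open>The action on \<open>\<Xi>\<close>\<close>

lemma r_coset_Aut_tree: "C #>\<^bsub>Aut_tree\<^esub> g = (\<lambda>h. h \<circ> g) ` C"
  by (auto simp: r_coset_def)

lemma r_coset_comp: "C #>\<^bsub>Aut_tree\<^esub> f #>\<^bsub>Aut_tree\<^esub> g = C #>\<^bsub>Aut_tree\<^esub> (f \<circ> g)"
  by (auto simp: r_coset_Aut_tree image_image comp_assoc)

lemma r_coset_id [simp]: "C #>\<^bsub>Aut_tree\<^esub> id = C"
  by (simp add: r_coset_Aut_tree)

lemma r_coset_inv [simp]:
  assumes "g \<in> Gamma_group"
  shows "C #>\<^bsub>Aut_tree\<^esub> g #>\<^bsub>Aut_tree\<^esub> inv\<^bsub>Aut_tree\<^esub> g = C"
    "C #>\<^bsub>Aut_tree\<^esub> inv\<^bsub>Aut_tree\<^esub> g #>\<^bsub>Aut_tree\<^esub> g = C"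
  by (simp_all only: r_coset_comp inv_comp[OF assms] r_coset_id)

lemma inv_mult:
  assumes "f \<in> Gamma_group" "g \<in> Gamma_group"
  shows "inv\<^bsub>Aut_tree\<^esub> (f \<circ> g) = inv\<^bsub>Aut_tree\<^esub> g \<circ> inv\<^bsub>Aut_tree\<^esub> f"
  using group.inv_mult_group[OF group_Aut_tree, of f g] assms Gamma_group_in_tree_automorphisms by simp

lemma inv_id [simp]: "inv\<^bsub>Aut_tree\<^esub> id = id"
  by (rule inv_Aut_tree) auto

lemma Xi_act_comp:
  assumes "f \<in> Gamma_group" "g \<in> Gamma_group"
  shows "Xi_act (Xi_act \<xi> f) g = Xi_act \<xi> (f \<circ> g)"
  by (rule ext) (simp only: Xi_act_def r_coset_comp inv_mult[OF assms])

lemma Xi_act_id [simp]: "Xi_act \<xi> id = \<xi>"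
  by (simp add: Xi_act_def)

lemma Xi_act_inv [simp]:
  assumes "g \<in> Gamma_group"
  shows "Xi_act (Xi_act \<xi> g) (inv\<^bsub>Aut_tree\<^esub> g) = \<xi>" "Xi_act (Xi_act \<xi> (inv\<^bsub>Aut_tree\<^esub> g)) g = \<xi>"
  by (simp_all only: Xi_act_comp Gamma_group_inv assms inv_comp Xi_act_id)

definition translate :: "(word \<Rightarrow> word) set set \<Rightarrow> (word \<Rightarrow> word) \<Rightarrow> (word \<Rightarrow> word) set set" where
  "translate s g = (\<lambda>C. C #>\<^bsub>Aut_tree\<^esub> g) ` s"

lemma Xi_act_closed_simplex:
  assumes "g \<in> Gamma_group" "\<xi> \<in> closed_simplex s"
  shows "Xi_act \<xi> g \<in> closed_simplex (translate s g)"
proof -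
  have "Xi_act \<xi> g C = 0" if "C \<notin> translate s g" for C
  proof -
    have "C #>\<^bsub>Aut_tree\<^esub> inv\<^bsub>Aut_tree\<^esub> g \<notin> s"
    proof
      assume "C #>\<^bsub>Aut_tree\<^esub> inv\<^bsub>Aut_tree\<^esub> g \<in> s"
      then have "C #>\<^bsub>Aut_tree\<^esub> inv\<^bsub>Aut_tree\<^esub> g #>\<^bsub>Aut_tree\<^esub> g \<in> translate s g"
        unfolding translate_def by (rule imageI)
      then show False using that assms(1) by simp
    qed
    then show ?thesis using assms(2) by (simp add: Xi_act_def closed_simplex_def)
  qed
  moreover have "(\<Sum>C\<in>translate s g. Xi_act \<xi> g C) = 1"
  proof -
    have "inj_on (\<lambda>C. C #>\<^bsub>Aut_tree\<^esub> g) s"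
      by (rule inj_on_inverseI[of _ "\<lambda>C. C #>\<^bsub>Aut_tree\<^esub> inv\<^bsub>Aut_tree\<^esub> g"]) (simp add: assms(1))
    then show ?thesis
      using assms by (simp add: translate_def sum.reindex Xi_act_def closed_simplex_def)
  qed
  ultimately show ?thesis using assms(2) by (simp add: closed_simplex_def Xi_act_def)
qed

lemma finite_chains_translate:
  assumes "s \<in> finite_chains P" "\<And>C. C \<in> s \<Longrightarrow> C #>\<^bsub>Aut_tree\<^esub> g \<in> Q"
  shows "translate s g \<in> finite_chains Q"
proof -
  have "chain\<^sub>\<subseteq> s" using assms(1) by (simp add: finite_chains_def)
  then have "chain\<^sub>\<subseteq> (translate s g)"
    unfolding chain_subset_def translate_def ball_simps r_coset_Aut_tree by (meson image_mono)
  moreover have "translate s g \<subseteq> Q" using assms(2) unfolding translate_def by blast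
  moreover have "finite (translate s g)" "translate s g \<noteq> {}"
    using assms(1) by (simp_all add: finite_chains_def translate_def)
  ultimately show ?thesis by (simp add: finite_chains_def)
qed

lemma Xi_vertices_translate:
  assumes "C \<in> Xi_vertices" "g \<in> Gamma_group"
  shows "C #>\<^bsub>Aut_tree\<^esub> g \<in> Xi_vertices"
proof -
  obtain G h where G: "C = G #>\<^bsub>Aut_tree\<^esub> h" "G \<in> vertex_groups" "h \<in> Gamma_group"
    using assms(1) unfolding Xi_vertices_def by blast
  then have "C #>\<^bsub>Aut_tree\<^esub> g = G #>\<^bsub>Aut_tree\<^esub> (h \<circ> g)" by (simp only: r_coset_comp)
  then show ?thesis
    using G(2) Gamma_group_comp[OF G(3) assms(2)] unfolding Xi_vertices_def by blast
qed

lemma finite_chains_Xi_translate: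
  "s \<in> finite_chains Xi_vertices \<Longrightarrow> g \<in> Gamma_group \<Longrightarrow> translate s g \<in> finite_chains Xi_vertices"
  using finite_chains_translate[of s Xi_vertices g Xi_vertices] Xi_vertices_translate
  by (auto simp: finite_chains_def)

lemma topspace_Xi: "topspace Xi = realization (finite_chains Xi_vertices)"
  by (simp add: Xi_def topspace_realization_topology)

lemma Xi_act_in_Xi: "\<xi> \<in> topspace Xi \<Longrightarrow> g \<in> Gamma_group \<Longrightarrow> Xi_act \<xi> g \<in> topspace Xi"
  unfolding topspace_Xi realization_def UN_iff
  using Xi_act_closed_simplex finite_chains_Xi_translate by (elim bexE) (rule bexI)

section \<open>Vertex groups and the fundamental domain \<open>T0\<close>\<close>

lemma six_groups_subgroup:
  assumes "G \<in> six_groups" shows "subgroup G Aut_tree"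
  using assms unfolding six_groups_def
  by (elim insertE emptyE) (simp_all add: subgroup_generate)

lemma vertex_groups_subgroup:
  assumes "G \<in> vertex_groups" shows "subgroup G Aut_tree"
proof -
  obtain X Y Z where "G = X \<inter> Y \<inter> Z" "X \<in> six_groups" "Y \<in> six_groups" "Z \<in> six_groups"
    using assms unfolding vertex_groups_def by blast
  then show ?thesis
    by (simp add: group.subgroups_Inter_pair[OF group_Aut_tree] six_groups_subgroup)
qed

lemma vertex_groupD:
  assumes "G \<in> vertex_groups"
  shows "id \<in> G" "f \<in> G \<Longrightarrow> g \<in> G \<Longrightarrow> f \<circ> g \<in> G" "f \<in> G \<Longrightarrow> inv\<^bsub>Aut_tree\<^esub> f \<in> G"
  using subgroup.one_closed[OF vertex_groups_subgroup[OF assms]]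
    subgroup.m_closed[OF vertex_groups_subgroup[OF assms]]
    subgroup.m_inv_closed[OF vertex_groups_subgroup[OF assms]] by auto

lemma vertex_groups_subset_Gamma: "G \<in> vertex_groups \<Longrightarrow> G \<subseteq> Gamma_group"
proof -
  have *: "generate Aut_tree S \<subseteq> Gamma_group" if "S \<subseteq> Gamma_group" for S
    unfolding Gamma_group_def
    by (rule group.generate_subgroup_incl[OF group_Aut_tree])
      (use that in \<open>auto simp: Gamma_group_def intro!: subgroup_generate\<close>)
  have "X \<subseteq> Gamma_group" if "X \<in> six_groups" for X
    using that unfolding six_groups_def
    by (elim insertE emptyE) (simp_all add: * Gamma_group_comp)
  moreover assume "G \<in> vertex_groups"
  ultimately show "G \<subseteq> Gamma_group" unfolding vertex_groups_def by blast
qed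

lemma vertex_group_coset:
  assumes "G \<in> vertex_groups" "g \<in> G" shows "G #>\<^bsub>Aut_tree\<^esub> g = G"
  by (rule subgroup.rcos_const[OF vertex_groups_subgroup[OF assms(1)] group_Aut_tree assms(2)])

lemma vertex_groups_subset_Xi_vertices: "vertex_groups \<subseteq> Xi_vertices"
proof
  fix G assume "G \<in> vertex_groups"
  then have "G #>\<^bsub>Aut_tree\<^esub> id \<in> Xi_vertices"
    unfolding Xi_vertices_def using id_in_Gamma_group by blast
  then show "G \<in> Xi_vertices" by simp
qed

lemma finite_chains_mono: "P \<subseteq> Q \<Longrightarrow> finite_chains P \<subseteq> finite_chains Q"
  by (auto simp: finite_chains_def)

lemma T0_subset_Xi: "T0 \<subseteq> topspace Xi"
  unfolding T0_def topspace_Xi realization_def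
  using finite_chains_mono[OF vertex_groups_subset_Xi_vertices] by blast

lemma finite_chains_least:
  assumes "s \<in> finite_chains P" obtains C where "C \<in> s" "\<And>D. D \<in> s \<Longrightarrow> C \<subseteq> D"
proof -
  have "finite s" "s \<noteq> {}" "chain\<^sub>\<subseteq> s" using assms by (auto simp: finite_chains_def)
  moreover obtain C where "C \<in> s" "\<And>D. D \<in> s \<Longrightarrow> D \<subseteq> C \<Longrightarrow> C = D"
    using finite_has_minimal[of s] calculation(1,2) by metis
  ultimately show thesis using that[of C] unfolding chain_subset_def by blast
qed

text \<open>Let Gg be the least coset of the chain. It contains g, hence so does every other coset
  of the chain, which can therefore be written as Hg with the same g. So every simplex of \<Xi> is a
  translate of a simplex of \<open>T0\<close>.\<close>

lemma chain_translate_of_groups: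
  assumes "s \<in> finite_chains Xi_vertices"
  obtains t g where "t \<in> finite_chains vertex_groups" "g \<in> Gamma_group" "s = translate t g"
proof -
  obtain C where C: "C \<in> s" "\<And>D. D \<in> s \<Longrightarrow> C \<subseteq> D" using finite_chains_least[OF assms] by blast
  have s: "s \<subseteq> Xi_vertices" using assms by (auto simp: finite_chains_def)
  then obtain G g where G: "C = G #>\<^bsub>Aut_tree\<^esub> g" "G \<in> vertex_groups" "g \<in> Gamma_group"
    using C(1) unfolding Xi_vertices_def by blast
  have g: "g \<in> D" if "D \<in> s" for D
  proof -
    have "id \<circ> g \<in> C" unfolding G(1) r_coset_Aut_tree using vertex_groupD(1)[OF G(2)] by (rule imageI)
    then show ?thesis using C(2)[OF that] by auto
  qed
  have "D #>\<^bsub>Aut_tree\<^esub> inv\<^bsub>Aut_tree\<^esub> g \<in> vertex_groups" if "D \<in> s" for D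
  proof -
    obtain H h where H: "D = H #>\<^bsub>Aut_tree\<^esub> h" "H \<in> vertex_groups" "h \<in> Gamma_group"
      using subsetD[OF s \<open>D \<in> s\<close>] unfolding Xi_vertices_def by blast
    obtain k where k: "k \<in> H" "g = k \<circ> h"
      using g[OF \<open>D \<in> s\<close>] unfolding H(1) r_coset_Aut_tree by blast
    have "D = H #>\<^bsub>Aut_tree\<^esub> k #>\<^bsub>Aut_tree\<^esub> h" using H(1) vertex_group_coset[OF H(2) k(1)] by simp
    also have "\<dots> = H #>\<^bsub>Aut_tree\<^esub> g" by (simp only: r_coset_comp k(2))
    finally show ?thesis using H(2) G(3) by simp
  qed
  then have "translate s (inv\<^bsub>Aut_tree\<^esub> g) \<in> finite_chains vertex_groups"
    by (rule finite_chains_translate[OF assms])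
  moreover have "s = translate (translate s (inv\<^bsub>Aut_tree\<^esub> g)) g"
    using G(3) by (simp add: translate_def image_image)
  ultimately show thesis using that G(3) by blast
qed

text \<open>A vertex group that k or its inverse carries to a vertex group contains k, because a
  coset that is a group contains the identity. So k fixes every vertex in the supports of both
  points, and it lies in the least group of the support of \<xi>.\<close>

lemma T0_rigid:
  assumes "\<xi> \<in> T0" "\<xi>' \<in> T0" "k \<in> Gamma_group" "\<xi> = Xi_act \<xi>' k"
  shows "\<xi> = \<xi>'" "\<exists>G\<in>vertex_groups. k \<in> G \<and> (\<forall>g\<in>G. Xi_act \<xi> g = \<xi>)"
proof -
  \<comment> \<open>The support of \<xi> spans the smallest simplex containing \<xi>; its least
    group will be the witness of the second claim.\<close>
  define S where "S = {C. \<xi> C \<noteq> 0}"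
  have vanish: "C \<in> vertex_groups" if "\<eta> \<in> T0" "\<eta> C \<noteq> 0" for \<eta> C
    using that unfolding T0_def realization_def finite_chains_def closed_simplex_def by blast
  have S: "S \<in> finite_chains vertex_groups"
  proof -
    obtain s where s: "s \<in> finite_chains vertex_groups" "\<xi> \<in> closed_simplex s"
      using assms(1) unfolding T0_def realization_def by blast
    then have "S \<subseteq> s" unfolding S_def closed_simplex_def by blast
    moreover have "S \<noteq> {}"
    proof
      assume "S = {}"
      then have "(\<Sum>C\<in>s. \<xi> C) = 0" by (simp add: S_def)
      then show False using s(2) by (simp add: closed_simplex_def)
    qed
    moreover have "finite s" "s \<subseteq> vertex_groups" "chain\<^sub>\<subseteq> s"
      using s(1) by (auto simp: finite_chains_def)
    moreover from this(3) \<open>S \<subseteq> s\<close> have "chain\<^sub>\<subseteq> S"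
      unfolding chain_subset_def by blast
    ultimately show ?thesis
      using finite_subset[of S s] by (simp add: finite_chains_def)
  qed
  have \<xi>: "\<xi> (C #>\<^bsub>Aut_tree\<^esub> k) = \<xi>' C" for C using assms(3,4) by (simp add: Xi_act_def)
  have coset: "k \<in> C" if "C \<in> vertex_groups" "C #>\<^bsub>Aut_tree\<^esub> inv\<^bsub>Aut_tree\<^esub> k \<in> vertex_groups \<or>
      C #>\<^bsub>Aut_tree\<^esub> k \<in> vertex_groups" for C
    using that(2)
  proof
    assume "C #>\<^bsub>Aut_tree\<^esub> inv\<^bsub>Aut_tree\<^esub> k \<in> vertex_groups"
    then obtain h where h: "h \<in> C" "id = h \<circ> inv\<^bsub>Aut_tree\<^esub> k"
      using vertex_groupD(1) unfolding r_coset_Aut_tree by blast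
    have "k = (h \<circ> inv\<^bsub>Aut_tree\<^esub> k) \<circ> k" by (simp only: h(2)[symmetric] id_comp)
    then have "k = h \<circ> (inv\<^bsub>Aut_tree\<^esub> k \<circ> k)" by (simp only: comp_assoc)
    then show "k \<in> C" using h(1) inv_comp[OF assms(3)] by simp
  next
    assume "C #>\<^bsub>Aut_tree\<^esub> k \<in> vertex_groups"
    then obtain h where h: "h \<in> C" "id = h \<circ> k"
      using vertex_groupD(1) unfolding r_coset_Aut_tree by blast
    have "(h \<circ> k) \<circ> inv\<^bsub>Aut_tree\<^esub> k = inv\<^bsub>Aut_tree\<^esub> k" by (simp only: h(2)[symmetric] id_comp)
    then have "h \<circ> (k \<circ> inv\<^bsub>Aut_tree\<^esub> k) = inv\<^bsub>Aut_tree\<^esub> k" by (simp only: comp_assoc)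
    then have "inv\<^bsub>Aut_tree\<^esub> k \<in> C" using h(1) inv_comp[OF assms(3)] by simp
    then have "inv\<^bsub>Aut_tree\<^esub> (inv\<^bsub>Aut_tree\<^esub> k) \<in> C" by (rule vertex_groupD(3)[OF that(1)])
    then show "k \<in> C" using inv_inv[OF assms(3)] by simp
  qed
  have k: "k \<in> C" if "C \<in> S" for C
  proof -
    have "\<xi> C \<noteq> 0" using that by (simp add: S_def)
    moreover from this have "\<xi>' (C #>\<^bsub>Aut_tree\<^esub> inv\<^bsub>Aut_tree\<^esub> k) \<noteq> 0"
      using assms(4) by (simp add: Xi_act_def)
    ultimately show ?thesis using coset[of C] vanish[OF assms(1)] vanish[OF assms(2)] by simp
  qed
  have k': "k \<in> C" if "\<xi>' C \<noteq> 0" for C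
  proof -
    have "\<xi> (C #>\<^bsub>Aut_tree\<^esub> k) \<noteq> 0" using that \<xi> by simp
    then show ?thesis using coset[of C] vanish[OF assms(1)] vanish[OF assms(2) that] by simp
  qed
  show "\<xi> = \<xi>'"
  proof
    fix C show "\<xi> C = \<xi>' C"
    \<comment> \<open>A vertex group containing k is fixed by k, so the coordinates agree there.
      Everywhere else both coordinates vanish.\<close>
    proof (cases "k \<in> C \<and> C \<in> vertex_groups")
      case True
      then show ?thesis using \<xi>[of C] vertex_group_coset[of C k] by simp
    next
      case False
      then have "\<xi> C = 0" using k[of C] vanish[OF assms(1), of C] by (auto simp: S_def)
      moreover have "\<xi>' C = 0" using False k'[of C] vanish[OF assms(2), of C] by auto
      ultimately show ?thesis by simp
    qed
  qed
  obtain G where G: "G \<in> S" "\<And>D. D \<in> S \<Longrightarrow> G \<subseteq> D" using finite_chains_least[OF S] by blast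
  have S_groups: "S \<subseteq> vertex_groups" using S by (simp add: finite_chains_def)
  \<comment> \<open>An element of the least group lies in every group of the support and hence fixes
    all these vertices.\<close>
  have "Xi_act \<xi> g = \<xi>" if g: "g \<in> G" for g
  proof
    have g_Gamma: "g \<in> Gamma_group"
      using g G(1) S_groups vertex_groups_subset_Gamma by blast
    fix C show "Xi_act \<xi> g C = \<xi> C"
    proof (cases "C \<in> S \<or> C #>\<^bsub>Aut_tree\<^esub> inv\<^bsub>Aut_tree\<^esub> g \<in> S")
      case True
      then obtain D where D: "D \<in> S" "C = D \<or> C = D #>\<^bsub>Aut_tree\<^esub> g"
        using r_coset_inv(2)[OF g_Gamma, of C, symmetric] by blast
      have "g \<in> D" "D \<in> vertex_groups" using D(1) G(2) g S_groups by auto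
      then have "D #>\<^bsub>Aut_tree\<^esub> g = D" "D #>\<^bsub>Aut_tree\<^esub> inv\<^bsub>Aut_tree\<^esub> g = D"
        using vertex_group_coset vertex_groupD(3) by simp_all
      then show ?thesis using D(2) by (auto simp: Xi_act_def)
    next
      case False
      then show ?thesis by (simp add: Xi_act_def S_def)
    qed
  qed
  then show "\<exists>G\<in>vertex_groups. k \<in> G \<and> (\<forall>g\<in>G. Xi_act \<xi> g = \<xi>)"
    using G(1) S_groups k[OF G(1)] by (intro bexI[of _ G]) auto
qed

section \<open>The quotients \<open>\<Xi>\<^sub>n\<close> and \<open>\<M>\<^sub>n\<close>\<close>

lemma generated_equiv_eq:
  assumes "equiv A R" shows "generated_equiv A R = R"
  using generated_equiv_least[OF equiv_type[OF assms] assms] by blast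

lemma topspace_quotient_space: "topspace (quotient_space X R) = quotient_class X R ` topspace X"
proof
  show "topspace (quotient_space X R) \<subseteq> quotient_class X R ` topspace X"
    using openin_topspace[of "quotient_space X R"] unfolding openin_quotient_space by blast
  have "{x \<in> topspace X. quotient_class X R x \<in> quotient_class X R ` topspace X} = topspace X"
    by blast
  then have "openin (quotient_space X R) (quotient_class X R ` topspace X)"
    unfolding openin_quotient_space by simp
  then show "quotient_class X R ` topspace X \<subseteq> topspace (quotient_space X R)"
    by (rule openin_subset)
qed

lemma quotient_map_quotient_space: "quotient_map X (quotient_space X R) (quotient_class X R)"
  by (auto simp: quotient_map_def topspace_quotient_space openin_quotient_space)

lemma quotient_class_eq_iff:
  assumes "x \<in> topspace X" "y \<in> topspace X"
  shows "quotient_class X R x = quotient_class X R y \<longleftrightarrow> (x, y) \<in> generated_equiv (topspace X) R"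
  unfolding quotient_class_def by (rule eq_equiv_class_iff[OF equiv_generated_equiv assms])

lemma bimodule_left_in_bimodule:
  "g \<in> Gamma_group \<Longrightarrow> m \<in> bimodule n \<Longrightarrow> bimodule_left g m \<in> bimodule n"
  by (auto simp: bimodule_def bimodule_left_def intro: Gamma_group_comp section_in_Gamma_group)

lemma bimodule_right_in_bimodule:
  "g \<in> Gamma_group \<Longrightarrow> m \<in> bimodule n \<Longrightarrow> bimodule_right m g \<in> bimodule n"
  by (auto simp: bimodule_def bimodule_right_def intro: Gamma_group_comp)

lemma bimodule_left_comp:
  assumes "f \<in> Gamma_group" "g \<in> Gamma_group"
  shows "bimodule_left f (bimodule_left g m) = bimodule_left (f \<circ> g) m"
  by (simp add: bimodule_left_def section_at_comp[OF assms] comp_assoc)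

lemma bimodule_left_id [simp]: "bimodule_left id m = m"
  by (simp add: bimodule_left_def)

lemma bimodule_left_right:
  "bimodule_right (bimodule_left g m) h = bimodule_left g (bimodule_right m h)"
  by (simp add: bimodule_left_def bimodule_right_def comp_assoc)

lemma tensor_rel_iff:
  "((\<xi>, m), (\<eta>, k)) \<in> tensor_rel n \<longleftrightarrow>
     \<eta> \<in> topspace Xi \<and> m \<in> bimodule n \<and> (\<exists>g\<in>Gamma_group. \<xi> = Xi_act \<eta> g \<and> k = bimodule_left g m)"
  unfolding tensor_rel_def by blast

lemma equiv_tensor_rel: "equiv (topspace Xi \<times> bimodule n) (tensor_rel n)"
proof (rule equivI)
  show "tensor_rel n \<subseteq> (topspace Xi \<times> bimodule n) \<times> (topspace Xi \<times> bimodule n)"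
    by (auto simp: tensor_rel_def Xi_act_in_Xi bimodule_left_in_bimodule)
  show "refl_on (topspace Xi \<times> bimodule n) (tensor_rel n)"
  proof (rule refl_onI)
    fix x assume "x \<in> topspace Xi \<times> bimodule n"
    then obtain \<xi> m where "x = (\<xi>, m)" "\<xi> \<in> topspace Xi" "m \<in> bimodule n" by auto
    then show "(x, x) \<in> tensor_rel n"
      unfolding \<open>x = (\<xi>, m)\<close> tensor_rel_iff by (intro conjI bexI[of _ id]) simp_all
  qed
  show "sym (tensor_rel n)"
  proof (rule symI)
    fix x y assume "(x, y) \<in> tensor_rel n"
    then obtain \<xi> g m where *: "x = (Xi_act \<xi> g, m)" "y = (\<xi>, bimodule_left g m)"
      "\<xi> \<in> topspace Xi" "g \<in> Gamma_group" "m \<in> bimodule n"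
      by (auto simp: tensor_rel_def)
    then have "y = (Xi_act (Xi_act \<xi> g) (inv\<^bsub>Aut_tree\<^esub> g), bimodule_left g m)"
      "x = (Xi_act \<xi> g, bimodule_left (inv\<^bsub>Aut_tree\<^esub> g) (bimodule_left g m))"
      by (simp_all add: bimodule_left_comp Gamma_group_inv inv_comp)
    then show "(y, x) \<in> tensor_rel n"
      using *(3-5) Xi_act_in_Xi Gamma_group_inv bimodule_left_in_bimodule
      unfolding tensor_rel_def by blast
  qed
  show "trans (tensor_rel n)"
  proof (rule transI)
    fix x y z assume "(x, y) \<in> tensor_rel n" "(y, z) \<in> tensor_rel n"
    then obtain \<xi> g m \<eta> h where *: "x = (Xi_act \<xi> g, m)" "\<xi> = Xi_act \<eta> h"
      "z = (\<eta>, bimodule_left h (bimodule_left g m))"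
      "\<eta> \<in> topspace Xi" "g \<in> Gamma_group" "m \<in> bimodule n" "h \<in> Gamma_group"
      by (auto simp: tensor_rel_def)
    then have "x = (Xi_act \<eta> (h \<circ> g), m)" "z = (\<eta>, bimodule_left (h \<circ> g) m)"
      by (simp_all add: bimodule_left_comp Xi_act_comp)
    then show "(x, z) \<in> tensor_rel n"
      using *(4-7) Gamma_group_comp unfolding tensor_rel_def by blast
  qed
qed

lemma topspace_Xi_times_bimodule: "topspace (Xi_times_bimodule n) = topspace Xi \<times> bimodule n"
  by (simp add: Xi_times_bimodule_def)

text \<open>\<open>Xi_n_act\<close> is applied to a class as a set of representatives, so the class
  is needed explicitly, as an orbit.\<close>

lemma tensor_eq:
  assumes "\<xi> \<in> topspace Xi" "m \<in> bimodule n"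
  shows "tensor n \<xi> m =
    {(Xi_act \<xi> (inv\<^bsub>Aut_tree\<^esub> g), bimodule_left g m) | g. g \<in> Gamma_group}"
proof -
  have "tensor n \<xi> m = tensor_rel n `` {(\<xi>, m)}"
    by (simp add: tensor_def quotient_class_def topspace_Xi_times_bimodule
        generated_equiv_eq[OF equiv_tensor_rel])
  also have "\<dots> = {(Xi_act \<xi> (inv\<^bsub>Aut_tree\<^esub> g), bimodule_left g m) | g. g \<in> Gamma_group}"
  proof (rule Set.set_eqI, rule iffI)
    fix y assume "y \<in> tensor_rel n `` {(\<xi>, m)}"
    then obtain \<eta> g where *: "\<xi> = Xi_act \<eta> g" "y = (\<eta>, bimodule_left g m)" "g \<in> Gamma_group"
      by (auto simp: tensor_rel_def)
    then have "\<eta> = Xi_act \<xi> (inv\<^bsub>Aut_tree\<^esub> g)" by simp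
    then show "y \<in> {(Xi_act \<xi> (inv\<^bsub>Aut_tree\<^esub> g), bimodule_left g m) | g. g \<in> Gamma_group}"
      using * by blast
  next
    fix y assume "y \<in> {(Xi_act \<xi> (inv\<^bsub>Aut_tree\<^esub> g), bimodule_left g m) | g. g \<in> Gamma_group}"
    then obtain g where *: "y = (Xi_act \<xi> (inv\<^bsub>Aut_tree\<^esub> g), bimodule_left g m)" "g \<in> Gamma_group"
      by blast
    then have "((Xi_act (Xi_act \<xi> (inv\<^bsub>Aut_tree\<^esub> g)) g, m), y) \<in> tensor_rel n"
      using assms Xi_act_in_Xi Gamma_group_inv unfolding tensor_rel_def by blast
    then show "y \<in> tensor_rel n `` {(\<xi>, m)}" using *(2) by simp
  qed
  finally show ?thesis .
qed

lemma tensor_eq_iff: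
  assumes "\<xi> \<in> topspace Xi" "m \<in> bimodule n" "\<eta> \<in> topspace Xi" "k \<in> bimodule n"
  shows "tensor n \<xi> m = tensor n \<eta> k \<longleftrightarrow>
    (\<exists>g\<in>Gamma_group. \<xi> = Xi_act \<eta> g \<and> k = bimodule_left g m)"
proof -
  have "tensor n \<xi> m = tensor n \<eta> k \<longleftrightarrow> ((\<xi>, m), (\<eta>, k)) \<in> tensor_rel n"
    unfolding tensor_def using assms
    by (subst quotient_class_eq_iff)
      (simp_all add: topspace_Xi_times_bimodule generated_equiv_eq[OF equiv_tensor_rel])
  also have "\<dots> \<longleftrightarrow> (\<exists>g\<in>Gamma_group. \<xi> = Xi_act \<eta> g \<and> k = bimodule_left g m)"
    using assms by (simp add: tensor_rel_iff)
  finally show ?thesis .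
qed

lemma tensor_move:
  assumes "\<xi> \<in> topspace Xi" "g \<in> Gamma_group" "m \<in> bimodule n"
  shows "tensor n (Xi_act \<xi> g) m = tensor n \<xi> (bimodule_left g m)"
  using assms tensor_eq_iff[OF Xi_act_in_Xi[OF assms(1,2)] assms(3) assms(1)
      bimodule_left_in_bimodule[OF assms(2,3)]] by blast

lemma topspace_Xi_n: "topspace (Xi_n n) = {tensor n \<xi> m | \<xi> m. \<xi> \<in> topspace Xi \<and> m \<in> bimodule n}"
  unfolding Xi_n_def topspace_quotient_space topspace_Xi_times_bimodule tensor_def by auto

lemma Xi_n_act_tensor:
  assumes "\<xi> \<in> topspace Xi" "m \<in> bimodule n" "g \<in> Gamma_group"
  shows "Xi_n_act (tensor n \<xi> m) g = tensor n \<xi> (bimodule_right m g)"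
  unfolding tensor_eq[OF assms(1,2)] tensor_eq[OF assms(1) bimodule_right_in_bimodule[OF assms(3,2)]]
  by (simp only: Xi_n_act_def setcompr_eq_image image_image case_prod_conv bimodule_left_right)

lemma Xi_n_act_comp: "Xi_n_act (Xi_n_act p f) g = Xi_n_act p (f \<circ> g)"
  by (auto simp: Xi_n_act_def bimodule_right_def image_image comp_assoc case_prod_unfold)

lemma Xi_n_act_id [simp]: "Xi_n_act p id = p"
  by (simp add: Xi_n_act_def bimodule_right_def case_prod_unfold)

lemma Xi_n_act_in_Xi_n:
  assumes "p \<in> topspace (Xi_n n)" "g \<in> Gamma_group" shows "Xi_n_act p g \<in> topspace (Xi_n n)"
  using assms unfolding topspace_Xi_n
  using Xi_n_act_tensor bimodule_right_in_bimodule by blast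

lemma Xi_n_act_inv [simp]:
  assumes "g \<in> Gamma_group"
  shows "Xi_n_act (Xi_n_act p g) (inv\<^bsub>Aut_tree\<^esub> g) = p" "Xi_n_act (Xi_n_act p (inv\<^bsub>Aut_tree\<^esub> g)) g = p"
  by (simp_all only: Xi_n_act_comp inv_comp[OF assms] Xi_n_act_id)

lemma equiv_IMG_orbit_rel: "equiv (topspace (Xi_n n)) (IMG_orbit_rel n)"
proof (rule equivI)
  show "IMG_orbit_rel n \<subseteq> topspace (Xi_n n) \<times> topspace (Xi_n n)"
    by (auto simp: IMG_orbit_rel_def Xi_n_act_in_Xi_n IMG_group_subset)
  have id: "id \<in> IMG_group" by (simp add: IMG_group_iff)
  show "refl_on (topspace (Xi_n n)) (IMG_orbit_rel n)"
  proof (rule refl_onI)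
    fix p assume "p \<in> topspace (Xi_n n)"
    then have "(p, Xi_n_act p id) \<in> IMG_orbit_rel n" using id unfolding IMG_orbit_rel_def by blast
    then show "(p, p) \<in> IMG_orbit_rel n" by simp
  qed
  show "sym (IMG_orbit_rel n)"
  proof (rule symI)
    fix p q assume "(p, q) \<in> IMG_orbit_rel n"
    then obtain g where *: "p \<in> topspace (Xi_n n)" "g \<in> IMG_group" "q = Xi_n_act p g"
      by (auto simp: IMG_orbit_rel_def)
    then have "p = Xi_n_act q (inv\<^bsub>Aut_tree\<^esub> g)" "q \<in> topspace (Xi_n n)"
      by (simp_all add: IMG_group_subset Xi_n_act_in_Xi_n)
    then show "(q, p) \<in> IMG_orbit_rel n"
      using *(2) IMG_group_inv unfolding IMG_orbit_rel_def by blast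
  qed
  show "trans (IMG_orbit_rel n)"
  proof (rule transI)
    fix p q r assume "(p, q) \<in> IMG_orbit_rel n" "(q, r) \<in> IMG_orbit_rel n"
    then obtain f g where *: "p \<in> topspace (Xi_n n)" "f \<in> IMG_group" "g \<in> IMG_group"
      "r = Xi_n_act (Xi_n_act p f) g"
      by (auto simp: IMG_orbit_rel_def)
    then show "(p, r) \<in> IMG_orbit_rel n"
      using IMG_group_comp unfolding IMG_orbit_rel_def Xi_n_act_comp by blast
  qed
qed

lemma M_n_proj_eq_iff:
  assumes "p \<in> topspace (Xi_n n)" "q \<in> topspace (Xi_n n)"
  shows "M_n_proj n p = M_n_proj n q \<longleftrightarrow> (\<exists>g\<in>IMG_group. q = Xi_n_act p g)"
  unfolding M_n_proj_def quotient_class_eq_iff[OF assms] generated_equiv_eq[OF equiv_IMG_orbit_rel]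
  using assms(1) by (auto simp: IMG_orbit_rel_def)

lemma M_n_proj_act:
  assumes "p \<in> topspace (Xi_n n)" "g \<in> IMG_group"
  shows "M_n_proj n (Xi_n_act p g) = M_n_proj n p"
  using M_n_proj_eq_iff[OF assms(1) Xi_n_act_in_Xi_n[OF assms(1) IMG_group_subset[OF assms(2)]]] assms(2)
  by blast

lemma topspace_M_n: "topspace (M_n n) = M_n_proj n ` topspace (Xi_n n)"
  by (simp add: M_n_def M_n_proj_def topspace_quotient_space)

section \<open>Open sets of \<open>\<Xi>\<^sub>n\<close>\<close>

lemma openin_Xi_n_simplex:
  assumes "openin (Xi_n n) W" "s \<in> finite_chains Xi_vertices" "m \<in> bimodule n"
  shows "openin (top_of_set (closed_simplex s)) {\<xi> \<in> closed_simplex s. tensor n \<xi> m \<in> W}"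
proof -
  have "continuous_map (Xi_times_bimodule n) (Xi_n n)
      (quotient_class (Xi_times_bimodule n) (tensor_rel n))"
    unfolding Xi_n_def by (rule quotient_imp_continuous_map[OF quotient_map_quotient_space])
  moreover have "continuous_map Xi (Xi_times_bimodule n) (\<lambda>\<xi>. (\<xi>, m))"
    unfolding Xi_times_bimodule_def using assms(3) by (intro continuous_map_pairedI) simp_all
  ultimately have "continuous_map Xi (Xi_n n)
      (quotient_class (Xi_times_bimodule n) (tensor_rel n) \<circ> (\<lambda>\<xi>. (\<xi>, m)))"
    by (rule continuous_map_compose[rotated])
  then have "continuous_map Xi (Xi_n n) (\<lambda>\<xi>. tensor n \<xi> m)"
    by (simp add: comp_def tensor_def)
  from openin_continuous_map_preimage[OF this assms(1)]
  have "openin (top_of_set (closed_simplex s))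
      ({\<xi> \<in> topspace Xi. tensor n \<xi> m \<in> W} \<inter> closed_simplex s)"
    using assms(2) unfolding Xi_def openin_realization_topology by blast
  moreover have "closed_simplex s \<subseteq> topspace Xi"
    using assms(2) unfolding topspace_Xi realization_def by blast
  then have "{\<xi> \<in> topspace Xi. tensor n \<xi> m \<in> W} \<inter> closed_simplex s =
      {\<xi> \<in> closed_simplex s. tensor n \<xi> m \<in> W}" by blast
  ultimately show ?thesis by (simp only:)
qed

text \<open>\<Xi> carries the weak topology and the bimodule is discrete, so openness in the
  quotient can be tested on one simplex and one bimodule element at a time.\<close>

lemma openin_Xi_nI:
  assumes "W \<subseteq> topspace (Xi_n n)"
    and "\<And>s m. s \<in> finite_chains Xi_vertices \<Longrightarrow> m \<in> bimodule n \<Longrightarrow>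
      openin (top_of_set (closed_simplex s)) {\<xi> \<in> closed_simplex s. tensor n \<xi> m \<in> W}"
  shows "openin (Xi_n n) W"
proof -
  have slice: "openin Xi {\<xi> \<in> topspace Xi. tensor n \<xi> m \<in> W}" if m: "m \<in> bimodule n" for m
    unfolding Xi_def openin_realization_topology topspace_realization_topology
  proof (intro conjI ballI)
    fix s assume s: "s \<in> finite_chains Xi_vertices"
    then have "closed_simplex s \<subseteq> realization (finite_chains Xi_vertices)"
      unfolding realization_def by blast
    then have "{\<xi> \<in> realization (finite_chains Xi_vertices). tensor n \<xi> m \<in> W} \<inter> closed_simplex s =
        {\<xi> \<in> closed_simplex s. tensor n \<xi> m \<in> W}" by blast
    then show "openin (top_of_set (closed_simplex s))
        ({\<xi> \<in> realization (finite_chains Xi_vertices). tensor n \<xi> m \<in> W} \<inter> closed_simplex s)"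
      using assms(2)[OF s m] by (simp only:)
  qed blast
  have "openin (Xi_times_bimodule n) ({\<xi> \<in> topspace Xi. tensor n \<xi> m \<in> W} \<times> {m})"
    if "m \<in> bimodule n" for m
    unfolding Xi_times_bimodule_def openin_prod_Times_iff using slice[OF that] that by simp
  then have "openin (Xi_times_bimodule n)
      (\<Union>m\<in>bimodule n. {\<xi> \<in> topspace Xi. tensor n \<xi> m \<in> W} \<times> {m})"
    by (intro openin_Union) blast
  also have "(\<Union>m\<in>bimodule n. {\<xi> \<in> topspace Xi. tensor n \<xi> m \<in> W} \<times> {m}) =
      {x \<in> topspace (Xi_times_bimodule n). quotient_class (Xi_times_bimodule n) (tensor_rel n) x \<in> W}"
    by (auto simp: topspace_Xi_times_bimodule tensor_def)
  finally show ?thesis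
    using assms(1) unfolding Xi_n_def openin_quotient_space topspace_quotient_space by blast
qed

section \<open>The two copies of \<open>\<T>\<^sub>n\<close>\<close>

text \<open>The elements id and a represent the two cosets of the even subgroup and index the two
  copies.\<close>

definition twist :: "bool \<Rightarrow> word \<Rightarrow> word" where
  "twist i = (if i then gen_a else id)"

lemma twist_in_Gamma_group [simp]: "twist i \<in> Gamma_group"
  by (simp add: twist_def)

lemma parity_twist [simp]: "parity (twist i) = i"
  by (simp add: twist_def)

lemma twist_involution [simp]: "twist i \<circ> twist i = id"
  by (auto simp: twist_def)

lemma id_bimodule: "length v = n \<Longrightarrow> (v, id) \<in> bimodule n"
  by (simp add: bimodule_def)

lemma twist_bimodule: "length v = n \<Longrightarrow> (v, twist i) \<in> bimodule n"
  by (simp add: bimodule_def)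

lemma T0_in_Xi [simp]: "\<xi> \<in> T0 \<Longrightarrow> \<xi> \<in> topspace Xi"
  using T0_subset_Xi by blast

lemma Xi_n_act_tensor_word:
  assumes "\<xi> \<in> topspace Xi" "length v = n" "f \<in> Gamma_group" "g \<in> Gamma_group"
  shows "Xi_n_act (tensor n \<xi> (v, f)) g = tensor n \<xi> (v, f \<circ> g)"
  using Xi_n_act_tensor[OF assms(1) _ assms(4), of "(v, f)"] assms(2,3)
  by (simp add: bimodule_def bimodule_right_def)

definition copy :: "nat \<Rightarrow> bool \<Rightarrow> xin_point set" where
  "copy n i = {tensor n \<xi> (v, twist i) | \<xi> v. \<xi> \<in> T0 \<and> length v = n}"

lemma Xi_n_act_twist:
  "\<xi> \<in> T0 \<Longrightarrow> length v = n \<Longrightarrow> Xi_n_act (tensor n \<xi> (v, id)) (twist i) = tensor n \<xi> (v, twist i)"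
  by (simp add: Xi_n_act_tensor_word)

lemma copy_eq: "copy n i = (\<lambda>p. Xi_n_act p (twist i)) ` T_n n"
proof
  show "copy n i \<subseteq> (\<lambda>p. Xi_n_act p (twist i)) ` T_n n"
  proof
    fix p assume "p \<in> copy n i"
    then obtain \<xi> v where "p = tensor n \<xi> (v, twist i)" "\<xi> \<in> T0" "length v = n"
      unfolding copy_def by blast
    then have "p = Xi_n_act (tensor n \<xi> (v, id)) (twist i)" "tensor n \<xi> (v, id) \<in> T_n n"
      using Xi_n_act_twist unfolding T_n_def by auto
    then show "p \<in> (\<lambda>p. Xi_n_act p (twist i)) ` T_n n" by (rule image_eqI)
  qed
  show "(\<lambda>p. Xi_n_act p (twist i)) ` T_n n \<subseteq> copy n i"
    using Xi_n_act_twist unfolding T_n_def copy_def by fast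
qed

lemma copy_False: "copy n False = T_n n"
  by (simp add: copy_eq twist_def)

lemma copy_subset: "copy n i \<subseteq> topspace (Xi_n n)"
  unfolding copy_def topspace_Xi_n using twist_bimodule T0_in_Xi by blast

lemma two_copies_eq: "two_copies n = sum_topology (\<lambda>i. subtopology (Xi_n n) (copy n i)) UNIV"
proof -
  have "(if i then (\<lambda>p. Xi_n_act p gen_a) ` T_n n else T_n n) = copy n i" for i
    by (simp add: copy_eq twist_def)
  then show ?thesis unfolding two_copies_def by (simp only:)
qed

lemma topspace_two_copies: "topspace (two_copies n) = Sigma UNIV (copy n)"
proof -
  have "topspace (Xi_n n) \<inter> copy n i = copy n i" for i using copy_subset[of n i] by blast
  then show ?thesis by (simp add: two_copies_eq comp_def)
qed

section \<open>The map from the two copies onto \<open>M_n n\<close>\<close>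

definition copies_proj :: "nat \<Rightarrow> bool \<times> xin_point \<Rightarrow> xin_point set" where
  "copies_proj n x = M_n_proj n (snd x)"

text \<open>For m = (u, h), the section of g at u times h is the product of id or a with an even
  element, which the quotient absorbs. It matters that \<open>v\<close> and \<open>i\<close> do not
  depend on \<xi>: a whole simplex is moved at once.\<close>

lemma move_into_copy:
  assumes "g \<in> Gamma_group" "m \<in> bimodule n"
  shows "\<exists>v i. length v = n \<and> (\<forall>\<xi>\<in>topspace Xi.
      M_n_proj n (tensor n (Xi_act \<xi> g) m) = M_n_proj n (tensor n \<xi> (v, twist i)))"
proof -
  obtain u h where m: "m = (u, h)" "length u = n" "h \<in> Gamma_group"
    using assms(2) by (auto simp: bimodule_def)
  define f where "f = section_at g u \<circ> h"
  have f: "f \<in> Gamma_group"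
    unfolding f_def by (intro Gamma_group_comp section_in_Gamma_group assms(1) m(3))
  define k where "k = twist (parity f) \<circ> f"
  have k: "k \<in> IMG_group"
    by (simp add: k_def IMG_group_iff Gamma_group_comp f parity_comp)
  have f_eq: "f = twist (parity f) \<circ> k"
    unfolding k_def comp_assoc[symmetric] by simp
  have "M_n_proj n (tensor n (Xi_act \<xi> g) m) = M_n_proj n (tensor n \<xi> (g u, twist (parity f)))"
    if \<xi>: "\<xi> \<in> topspace Xi" for \<xi>
  proof -
    have "tensor n (Xi_act \<xi> g) m = tensor n \<xi> (g u, twist (parity f) \<circ> k)"
      unfolding tensor_move[OF \<xi> assms] f_eq[symmetric] by (simp add: bimodule_left_def m(1) f_def)
    also have "\<dots> = Xi_n_act (tensor n \<xi> (g u, twist (parity f))) k"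
      by (simp add: Xi_n_act_tensor_word \<xi> m(2) assms(1) IMG_group_subset[OF k])
    finally have "tensor n (Xi_act \<xi> g) m = Xi_n_act (tensor n \<xi> (g u, twist (parity f))) k" .
    moreover have "tensor n \<xi> (g u, twist (parity f)) \<in> topspace (Xi_n n)"
      unfolding topspace_Xi_n using \<xi> twist_bimodule[of "g u" n] m(2) assms(1) by auto
    ultimately show ?thesis using M_n_proj_act k by simp
  qed
  then show ?thesis using m(2) assms(1) by (intro exI[of _ "g u"] exI[of _ "parity f"]) simp
qed

lemma closed_simplex_translate:
  assumes "g \<in> Gamma_group"
  shows "closed_simplex (translate s g) = (\<lambda>\<xi>. Xi_act \<xi> g) ` closed_simplex s"
proof
  show "(\<lambda>\<xi>. Xi_act \<xi> g) ` closed_simplex s \<subseteq> closed_simplex (translate s g)"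
    using Xi_act_closed_simplex[OF assms] by blast
  show "closed_simplex (translate s g) \<subseteq> (\<lambda>\<xi>. Xi_act \<xi> g) ` closed_simplex s"
  proof
    fix \<xi> assume "\<xi> \<in> closed_simplex (translate s g)"
    then have "Xi_act \<xi> (inv\<^bsub>Aut_tree\<^esub> g) \<in> closed_simplex (translate (translate s g) (inv\<^bsub>Aut_tree\<^esub> g))"
      by (rule Xi_act_closed_simplex[OF Gamma_group_inv[OF assms]])
    then have "Xi_act \<xi> (inv\<^bsub>Aut_tree\<^esub> g) \<in> closed_simplex s"
      using assms by (simp add: translate_def image_image)
    then show "\<xi> \<in> (\<lambda>\<xi>. Xi_act \<xi> g) ` closed_simplex s"
      by (rule image_eqI[rotated]) (simp add: assms)
  qed
qed

lemma closed_simplex_T0: "s \<in> finite_chains vertex_groups \<Longrightarrow> closed_simplex s \<subseteq> T0"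
  unfolding T0_def realization_def by blast

lemma finite_chains_vertex_groups_Xi:
  "s \<in> finite_chains vertex_groups \<Longrightarrow> s \<in> finite_chains Xi_vertices"
  using finite_chains_mono[OF vertex_groups_subset_Xi_vertices] by blast

lemma continuous_Xi_act: "continuous_on S (\<lambda>\<xi>. Xi_act \<xi> g)"
  unfolding Xi_act_def
  by (intro continuous_on_coordinatewise_then_product
      continuous_on_subset[OF continuous_on_product_coordinates]) simp

lemma continuous_copies_proj: "continuous_map (two_copies n) (M_n n) (copies_proj n)"
  unfolding continuous_map_def
proof (intro conjI allI impI)
  show "copies_proj n \<in> topspace (two_copies n) \<rightarrow> topspace (M_n n)"
  proof
    fix x assume "x \<in> topspace (two_copies n)"
    then have "snd x \<in> topspace (Xi_n n)"
      unfolding topspace_two_copies using copy_subset by (cases x) auto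
    then show "copies_proj n x \<in> topspace (M_n n)"
      unfolding topspace_M_n copies_proj_def by (rule imageI)
  qed
next
  fix U assume U: "openin (M_n n) U"
  have "openin (Xi_n n) {p \<in> topspace (Xi_n n). M_n_proj n p \<in> U}"
    using U unfolding M_n_def M_n_proj_def openin_quotient_space by blast
  then have "openin (subtopology (Xi_n n) (copy n i))
      ({p \<in> topspace (Xi_n n). M_n_proj n p \<in> U} \<inter> copy n i)" for i
    by (rule openin_subtopology_Int)
  moreover have "{p \<in> topspace (Xi_n n). M_n_proj n p \<in> U} \<inter> copy n i =
      {p. (i, p) \<in> {x \<in> topspace (two_copies n). copies_proj n x \<in> U}}" for i
    using copy_subset[of n i] by (auto simp: topspace_two_copies copies_proj_def)
  ultimately have "openin (subtopology (Xi_n n) (copy n i))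
      {p. (i, p) \<in> {x \<in> topspace (two_copies n). copies_proj n x \<in> U}}" for i
    by (simp only:)
  moreover have "{x \<in> topspace (two_copies n). copies_proj n x \<in> U} \<subseteq>
      Sigma UNIV (topspace \<circ> (\<lambda>i. subtopology (Xi_n n) (copy n i)))"
    by (auto simp: two_copies_eq)
  ultimately show "openin (two_copies n) {x \<in> topspace (two_copies n). copies_proj n x \<in> U}"
    unfolding two_copies_eq openin_sum_topology by blast
qed

lemma surj_copies_proj: "copies_proj n ` topspace (two_copies n) = topspace (M_n n)"
proof
  show "copies_proj n ` topspace (two_copies n) \<subseteq> topspace (M_n n)"
    using continuous_copies_proj continuous_map_image_subset_topspace by blast
  show "topspace (M_n n) \<subseteq> copies_proj n ` topspace (two_copies n)"
  proof
    fix y assume "y \<in> topspace (M_n n)"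
    then obtain \<xi> m where y: "y = M_n_proj n (tensor n \<xi> m)" "\<xi> \<in> topspace Xi" "m \<in> bimodule n"
      unfolding topspace_M_n topspace_Xi_n by blast
    then obtain s where s: "s \<in> finite_chains Xi_vertices" "\<xi> \<in> closed_simplex s"
      unfolding topspace_Xi realization_def by blast
    obtain t g where t: "t \<in> finite_chains vertex_groups" "g \<in> Gamma_group" "s = translate t g"
      using chain_translate_of_groups[OF s(1)] .
    then obtain \<eta> where \<eta>: "\<eta> \<in> closed_simplex t" "\<xi> = Xi_act \<eta> g"
      using s(2) closed_simplex_translate by blast
    obtain v i where v: "length v = n" "\<forall>\<xi>\<in>topspace Xi.
        M_n_proj n (tensor n (Xi_act \<xi> g) m) = M_n_proj n (tensor n \<xi> (v, twist i))"
      using move_into_copy[OF t(2) y(3)] by blast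
    have "\<eta> \<in> T0" using \<eta>(1) closed_simplex_T0[OF t(1)] by blast
    then have "y = copies_proj n (i, tensor n \<eta> (v, twist i))"
      using v(2) y(1) \<eta>(2) by (simp add: copies_proj_def)
    moreover have "(i, tensor n \<eta> (v, twist i)) \<in> topspace (two_copies n)"
      using \<open>\<eta> \<in> T0\<close> v(1) unfolding topspace_two_copies copy_def by blast
    ultimately show "y \<in> copies_proj n ` topspace (two_copies n)" by blast
  qed
qed

text \<open>The substantial direction is that a set with open preimage in the copies is open. Each
  simplex of \<Xi>, with a bimodule element, is carried by the continuous map \<open>\<phi>\<close>
  to a simplex of one copy without changing the images in \<open>M_n n\<close>, and openness is
  pulled back along \<open>\<phi>\<close>.\<close>

lemma quotient_map_copies_proj: "quotient_map (two_copies n) (M_n n) (copies_proj n)"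
  unfolding quotient_map_def
proof (intro conjI allI impI)
  fix U assume U: "U \<subseteq> topspace (M_n n)"
  show "openin (two_copies n) {x \<in> topspace (two_copies n). copies_proj n x \<in> U} = openin (M_n n) U"
  proof
    assume open_U: "openin (two_copies n) {x \<in> topspace (two_copies n). copies_proj n x \<in> U}"
    \<comment> \<open>A copy has the subspace topology, so the open set \<open>V\<close> need agree
      with the preimage of \<open>U\<close> only on that copy. It is therefore used below only at
      points of the copy.\<close>
    have copy_open: "\<exists>V. openin (Xi_n n) V \<and> (\<forall>p\<in>copy n i. p \<in> V \<longleftrightarrow> M_n_proj n p \<in> U)" for i
    proof -
      have "openin (subtopology (Xi_n n) (copy n i))
          {p. (i, p) \<in> {x \<in> topspace (two_copies n). copies_proj n x \<in> U}}"
        using open_U unfolding two_copies_eq openin_sum_topology by blast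
      then obtain V where V: "openin (Xi_n n) V"
        "{p. (i, p) \<in> {x \<in> topspace (two_copies n). copies_proj n x \<in> U}} = V \<inter> copy n i"
        unfolding openin_subtopology by blast
      have "p \<in> V \<longleftrightarrow> M_n_proj n p \<in> U" if "p \<in> copy n i" for p
        using that V(2) by (auto simp: topspace_two_copies copies_proj_def)
      then show ?thesis using V(1) by blast
    qed
    have "openin (Xi_n n) {p \<in> topspace (Xi_n n). M_n_proj n p \<in> U}"
    proof (rule openin_Xi_nI)
      fix s m assume s: "s \<in> finite_chains Xi_vertices" and m: "m \<in> bimodule n"
      obtain t g where t: "t \<in> finite_chains vertex_groups" "g \<in> Gamma_group" "s = translate t g"
        using chain_translate_of_groups[OF s] .
      obtain v i where v: "length v = n" "\<forall>\<xi>\<in>topspace Xi.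
          M_n_proj n (tensor n (Xi_act \<xi> g) m) = M_n_proj n (tensor n \<xi> (v, twist i))"
        using move_into_copy[OF t(2) m] by blast
      obtain V where V: "openin (Xi_n n) V" "\<And>p. p \<in> copy n i \<Longrightarrow> p \<in> V \<longleftrightarrow> M_n_proj n p \<in> U"
        using copy_open[of i] by blast
      define \<phi> where "\<phi> = (\<lambda>\<xi>. Xi_act \<xi> (inv\<^bsub>Aut_tree\<^esub> g))"
      define O' where "O' = {\<eta> \<in> closed_simplex t. tensor n \<eta> (v, twist i) \<in> V}"
      have open_O': "openin (top_of_set (closed_simplex t)) O'"
        unfolding O'_def
        by (rule openin_Xi_n_simplex[OF V(1) finite_chains_vertex_groups_Xi[OF t(1)] twist_bimodule[OF v(1)]])
      have \<phi>: "\<phi> \<xi> \<in> closed_simplex t" "Xi_act (\<phi> \<xi>) g = \<xi>" if "\<xi> \<in> closed_simplex s" for \<xi>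
        using that t(2) unfolding t(3) closed_simplex_translate[OF t(2)] \<phi>_def by auto
      have "openin (top_of_set (closed_simplex s)) (closed_simplex s \<inter> \<phi> -` O')"
        by (rule continuous_openin_preimage[OF _ _ open_O'])
          (use \<phi>(1) in \<open>auto simp: \<phi>_def continuous_Xi_act\<close>)
      moreover have "closed_simplex s \<inter> \<phi> -` O' =
          {\<xi> \<in> closed_simplex s. tensor n \<xi> m \<in> {p \<in> topspace (Xi_n n). M_n_proj n p \<in> U}}"
      proof -
        have "\<phi> \<xi> \<in> O' \<longleftrightarrow> tensor n \<xi> m \<in> {p \<in> topspace (Xi_n n). M_n_proj n p \<in> U}"
          if \<xi>: "\<xi> \<in> closed_simplex s" for \<xi>
        proof -
          have T0: "\<phi> \<xi> \<in> T0" using \<phi>(1)[OF \<xi>] closed_simplex_T0[OF t(1)] by blast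
          then have "tensor n (\<phi> \<xi>) (v, twist i) \<in> copy n i" using v(1) unfolding copy_def by blast
          then have "\<phi> \<xi> \<in> O' \<longleftrightarrow> M_n_proj n (tensor n (\<phi> \<xi>) (v, twist i)) \<in> U"
            using V(2) \<phi>(1)[OF \<xi>] by (simp add: O'_def)
          also have "\<dots> \<longleftrightarrow> M_n_proj n (tensor n \<xi> m) \<in> U"
            using bspec[OF v(2), of "\<phi> \<xi>"] T0 \<phi>(2)[OF \<xi>] by simp
          finally have "\<phi> \<xi> \<in> O' \<longleftrightarrow> M_n_proj n (tensor n \<xi> m) \<in> U" .
          moreover have "\<xi> \<in> topspace Xi"
            using Xi_act_in_Xi[of "\<phi> \<xi>" g] T0 t(2) \<phi>(2)[OF \<xi>] by simp
          then have "tensor n \<xi> m \<in> topspace (Xi_n n)"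
            using m unfolding topspace_Xi_n by blast
          ultimately show ?thesis by blast
        qed
        then show ?thesis by blast
      qed
      ultimately show "openin (top_of_set (closed_simplex s))
          {\<xi> \<in> closed_simplex s. tensor n \<xi> m \<in> {p \<in> topspace (Xi_n n). M_n_proj n p \<in> U}}"
        by (simp only:)
    qed blast
    then show "openin (M_n n) U"
      using U unfolding M_n_def M_n_proj_def openin_quotient_space topspace_quotient_space by blast
  next
    assume "openin (M_n n) U"
    then show "openin (two_copies n) {x \<in> topspace (two_copies n). copies_proj n x \<in> U}"
      by (rule openin_continuous_map_preimage[OF continuous_copies_proj])
  qed
qed (rule surj_copies_proj)

section \<open>The pasting relation\<close>

definition glued :: "nat \<Rightarrow> ((bool \<times> xin_point) \<times> (bool \<times> xin_point)) set" where
  "glued n = generated_equiv (topspace (two_copies n)) (pasting_rel n)"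

lemma T_n_subset: "T_n n \<subseteq> topspace (Xi_n n)"
  using copy_subset[of n False] by (simp add: copy_False)

lemma kappa_act: "g \<in> Gamma_group \<Longrightarrow> kappa g (Xi_n_act r g) = r"
  by (simp add: kappa_def)

lemma K_setE:
  assumes "p \<in> K_set g n" "g \<in> Gamma_group"
  obtains r where "p \<in> T_n n" "r \<in> T_n n" "p = Xi_n_act r g" "kappa g p = r"
proof -
  obtain r where r: "r \<in> T_n n" "p = Xi_n_act r g" "p \<in> T_n n"
    using assms(1) unfolding K_set_def by blast
  have "kappa g p = r" unfolding r(2) by (rule kappa_act[OF assms(2)])
  then show thesis by (rule that[OF r(3,1,2)])
qed

lemma crossing_in_Gamma_group: "g \<in> crossing_elements \<Longrightarrow> g \<in> Gamma_group"
  by (rule nucleus_in_Gamma_group[OF parity_crossing_elements(2)])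

lemma snd_in_Xi_n: "x \<in> topspace (two_copies n) \<Longrightarrow> snd x \<in> topspace (Xi_n n)"
  using copy_subset[of n "fst x"] unfolding topspace_two_copies mem_Times_iff by (cases x) (simp add: subset_iff)

lemma mem_topspace_two_copies:
  "p \<in> T_n n \<Longrightarrow> (False, p) \<in> topspace (two_copies n)"
  "p \<in> T_n n \<Longrightarrow> (True, Xi_n_act p gen_a) \<in> topspace (two_copies n)"
  by (simp_all add: topspace_two_copies copy_eq twist_def)

text \<open>The second point arises from the first by the action of g^-1 h, which is even.\<close>

lemma M_n_proj_same_parity:
  assumes "r \<in> topspace (Xi_n n)" "g \<in> Gamma_group" "h \<in> Gamma_group" "parity g = parity h"
  shows "M_n_proj n (Xi_n_act r g) = M_n_proj n (Xi_n_act r h)"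
proof -
  let ?k = "inv\<^bsub>Aut_tree\<^esub> g \<circ> h"
  have "?k \<in> IMG_group"
    using assms by (simp add: IMG_group_iff Gamma_group_comp Gamma_group_inv parity_comp parity_inv)
  then have "M_n_proj n (Xi_n_act (Xi_n_act r g) ?k) = M_n_proj n (Xi_n_act r g)"
    by (rule M_n_proj_act[OF Xi_n_act_in_Xi_n[OF assms(1,2)]])
  moreover have "Xi_n_act (Xi_n_act r g) ?k = Xi_n_act r h"
    unfolding Xi_n_act_comp comp_assoc[symmetric] inv_comp(2)[OF assms(2)] by simp
  ultimately show ?thesis by simp
qed

lemma pasting_relI:
  "g \<in> crossing_elements \<Longrightarrow> p \<in> K_set g n \<Longrightarrow>
     ((False, p), (True, Xi_n_act (kappa g p) gen_a)) \<in> pasting_rel n"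
  "g \<in> {gen_alpha, gen_beta, gen_gamma} \<Longrightarrow> p \<in> K_set g n \<Longrightarrow>
     ((False, p), (False, kappa g p)) \<in> pasting_rel n"
  "g \<in> {gen_alpha, gen_beta, gen_gamma} \<Longrightarrow> p \<in> K_set g n \<Longrightarrow>
     ((True, Xi_n_act p gen_a), (True, Xi_n_act (kappa g p) gen_a)) \<in> pasting_rel n"
  unfolding pasting_rel_def by blast+

text \<open>Write p = rg, so that \<kappa> maps p to r. For odd g, the points rg and ra have the
  same image; for even g, so do rg and r, and also rga and ra. These are the three kinds of pasted
  pairs.\<close>

lemma pasting_rel_sound:
  "pasting_rel n \<subseteq> {(x, y). x \<in> topspace (two_copies n) \<and> y \<in> topspace (two_copies n) \<and>
     copies_proj n x = copies_proj n y}" (is "_ \<subseteq> ?E")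
proof -
  have crossing: "((False, p), (True, Xi_n_act (kappa g p) gen_a)) \<in> ?E"
    if g: "g \<in> crossing_elements" and p: "p \<in> K_set g n" for g p
  proof -
    note g_Gamma = crossing_in_Gamma_group[OF g]
    obtain r where r: "p \<in> T_n n" "r \<in> T_n n" "p = Xi_n_act r g" "kappa g p = r"
      using K_setE[OF p g_Gamma] .
    have "M_n_proj n (Xi_n_act r g) = M_n_proj n (Xi_n_act r gen_a)"
      by (rule M_n_proj_same_parity[OF subsetD[OF T_n_subset r(2)]])
        (simp_all add: g_Gamma parity_crossing_elements(1)[OF g])
    then show ?thesis
      using r mem_topspace_two_copies(1)[OF r(1)] mem_topspace_two_copies(2)[OF r(2)]
      by (simp add: copies_proj_def)
  qed
  have inner: "((False, p), (False, kappa g p)) \<in> ?E \<and>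
      ((True, Xi_n_act p gen_a), (True, Xi_n_act (kappa g p) gen_a)) \<in> ?E"
    if g: "g \<in> {gen_alpha, gen_beta, gen_gamma}" and p: "p \<in> K_set g n" for g p
  proof -
    have g_Gamma: "g \<in> Gamma_group" "\<not> parity g" using g by auto
    obtain r where r: "p \<in> T_n n" "r \<in> T_n n" "p = Xi_n_act r g" "kappa g p = r"
      using K_setE[OF p g_Gamma(1)] .
    have r': "r \<in> topspace (Xi_n n)" using r(2) T_n_subset by blast
    have "M_n_proj n (Xi_n_act r g) = M_n_proj n (Xi_n_act r id)"
      by (rule M_n_proj_same_parity[OF r']) (simp_all add: g_Gamma)
    moreover have "M_n_proj n (Xi_n_act r (g \<circ> gen_a)) = M_n_proj n (Xi_n_act r gen_a)"
      by (rule M_n_proj_same_parity[OF r']) (simp_all add: g_Gamma Gamma_group_comp parity_comp)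
    ultimately show ?thesis
      using r mem_topspace_two_copies[OF r(1)] mem_topspace_two_copies[OF r(2)]
      by (simp add: copies_proj_def Xi_n_act_comp)
  qed
  show ?thesis
    unfolding pasting_rel_def
  proof (intro Un_least subsetI)
    fix x assume "x \<in> {((False, p), (True, Xi_n_act (kappa g p) gen_a)) | g p.
      g \<in> crossing_elements \<and> p \<in> K_set g n}"
    then show "x \<in> ?E" by (elim CollectE exE conjE) (simp only: crossing)
  next
    fix x assume "x \<in> {((False, p), (False, kappa g p)) | g p.
      g \<in> {gen_alpha, gen_beta, gen_gamma} \<and> p \<in> K_set g n}"
    then show "x \<in> ?E" by (elim CollectE exE conjE) (simp only: inner)
  next
    fix x assume "x \<in> {((True, Xi_n_act p gen_a), (True, Xi_n_act (kappa g p) gen_a)) | g p.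
      g \<in> {gen_alpha, gen_beta, gen_gamma} \<and> p \<in> K_set g n}"
    then show "x \<in> ?E" by (elim CollectE exE conjE) (simp only: inner)
  qed
qed

lemma pasting_rel_glued: "pasting_rel n \<subseteq> glued n"
proof -
  have "pasting_rel n \<subseteq> topspace (two_copies n) \<times> topspace (two_copies n)"
    by (rule order_trans[OF pasting_rel_sound]) auto
  then show ?thesis
    unfolding glued_def generated_equiv_def
  proof (rule Int_greatest[rotated])
    show "pasting_rel n \<subseteq> (pasting_rel n \<union> (pasting_rel n)\<inverse>)\<^sup>*"
      by (rule subsetI) (rule r_into_rtrancl, rule UnI1)
  qed
qed

lemma equiv_glued: "equiv (topspace (two_copies n)) (glued n)"
  unfolding glued_def by (rule equiv_generated_equiv)

lemma glued_sound:
  assumes "(x, y) \<in> glued n" shows "copies_proj n x = copies_proj n y"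
proof -
  let ?A = "topspace (two_copies n)"
  let ?E = "{(x, y). x \<in> ?A \<and> y \<in> ?A \<and> copies_proj n x = copies_proj n y}"
  have "equiv ?A ?E" by (rule equivI) (auto simp: refl_on_def sym_def trans_def)
  moreover have "pasting_rel n \<subseteq> ?A \<times> ?A"
    by (rule order_trans[OF pasting_rel_sound]) auto
  ultimately have "glued n \<subseteq> ?E"
    unfolding glued_def using pasting_rel_sound by (intro generated_equiv_least(2))
  from subsetD[OF this assms] show ?thesis by simp
qed

definition copy_point :: "nat \<Rightarrow> xi_point \<Rightarrow> bool \<Rightarrow> word \<Rightarrow> bool \<times> xin_point" where
  "copy_point n \<xi> i v = (i, tensor n \<xi> (v, twist i))"

lemma copy_point_in_two_copies:
  "\<xi> \<in> T0 \<Longrightarrow> length v = n \<Longrightarrow> copy_point n \<xi> i v \<in> topspace (two_copies n)"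
  unfolding topspace_two_copies copy_def copy_point_def by blast

text \<open>An element \<open>s\<close> that fixes \<open>\<xi>\<close> turns \<open>\<xi> \<otimes> v\<close> into \<open>(\<xi> \<otimes> s(v)) \<cdot> s|\<^sub>v\<close>. If \<open>s\<close> is in the nucleus,
  then so is \<open>s|\<^sub>v\<close>, and this is one of the listed pastings.\<close>

lemma glued_nucleus_step:
  assumes "\<xi> \<in> T0" "s \<in> nucleus" "Xi_act \<xi> s = \<xi>" "length v = n"
  shows "(copy_point n \<xi> i v, copy_point n \<xi> (i \<noteq> parity (section_at s v)) (s v)) \<in> glued n"
proof -
  define g where "g = section_at s v"
  have g: "g \<in> nucleus" unfolding g_def by (rule nucleus_section[OF assms(2)])
  have g_Gamma: "g \<in> Gamma_group" by (rule nucleus_in_Gamma_group[OF g])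
  have sv: "length (s v) = n" using nucleus_in_Gamma_group[OF assms(2)] assms(4) by simp
  define p where "p = tensor n \<xi> (v, id)"
  define r where "r = tensor n \<xi> (s v, id)"
  have pr: "p \<in> T_n n" "r \<in> T_n n"
    unfolding p_def r_def T_n_def using assms(1,4) sv by blast+
  have "p = tensor n (Xi_act \<xi> s) (v, id)" by (simp add: p_def assms(3))
  also have "\<dots> = tensor n \<xi> (bimodule_left s (v, id))"
    by (rule tensor_move[OF T0_in_Xi[OF assms(1)] nucleus_in_Gamma_group[OF assms(2)] id_bimodule[OF assms(4)]])
  also have "\<dots> = Xi_n_act r g"
    using assms(1) sv g_Gamma by (simp add: r_def Xi_n_act_tensor_word bimodule_left_def g_def)
  finally have p_eq: "p = Xi_n_act r g" .
  \<comment> \<open>As g is an involution, r lies in \<open>K_set g n\<close> as well, and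
    \<open>kappa g\<close> exchanges p and r.\<close>
  then have r_eq: "r = Xi_n_act p g"
    using nucleus_involutions g by (auto simp: Xi_n_act_comp involutions_def)
  have K: "p \<in> K_set g n" "r \<in> K_set g n"
    unfolding K_set_def using pr p_eq r_eq by blast+
  have kappa_p: "kappa g p = r"
    unfolding p_eq by (rule kappa_act[OF g_Gamma])
  have kappa_r: "kappa g r = p"
    by (subst r_eq) (rule kappa_act[OF g_Gamma])
  have points: "copy_point n \<xi> False v = (False, p)" "copy_point n \<xi> True v = (True, Xi_n_act p gen_a)"
    "copy_point n \<xi> False (s v) = (False, r)" "copy_point n \<xi> True (s v) = (True, Xi_n_act r gen_a)"
    unfolding copy_point_def p_def r_def
    using Xi_n_act_twist[OF assms(1,4), of True] Xi_n_act_twist[OF assms(1) sv, of True]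
    by (simp_all add: twist_def)
  have sym: "sym (glued n)" by (rule equivE[OF equiv_glued])
  show ?thesis
  proof (cases "parity g")
    case True
    then have "g \<in> crossing_elements" using parity_nucleus[OF g] by simp
    \<comment> \<open>The crossing pastings are listed only from the first copy to the second. The
      pair that starts in the second copy comes from the pasting at r, read backwards.\<close>
    then have "((False, p), (True, Xi_n_act r gen_a)) \<in> pasting_rel n"
      "((False, r), (True, Xi_n_act p gen_a)) \<in> pasting_rel n"
      using pasting_relI(1)[of g p n] pasting_relI(1)[of g r n] K by (simp_all add: kappa_p kappa_r)
    then have "((False, p), (True, Xi_n_act r gen_a)) \<in> glued n"
      "((True, Xi_n_act p gen_a), (False, r)) \<in> glued n"
      using subsetD[OF pasting_rel_glued] symD[OF sym] by simp_all
    then show ?thesis using True points by (cases i) (simp_all add: g_def)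
  next
    case False
    have "(copy_point n \<xi> i v, copy_point n \<xi> i (s v)) \<in> glued n"
    proof (cases "g = id")
      \<comment> \<open>A trivial section gives p = r, so the two points coincide and reflexivity
        suffices.\<close>
      case True
      then have "copy_point n \<xi> i v = copy_point n \<xi> i (s v)"
        using points p_eq by (cases i) simp_all
      moreover have "refl_on (topspace (two_copies n)) (glued n)"
        by (rule equivE[OF equiv_glued])
      ultimately show ?thesis
        using copy_point_in_two_copies[OF assms(1) sv] by (simp add: refl_onD)
    next
      case False
      then have "g \<in> {gen_alpha, gen_beta, gen_gamma}"
        using parity_nucleus[OF g] \<open>\<not> parity g\<close> by simp
      then have "((False, p), (False, r)) \<in> pasting_rel n"
        "((True, Xi_n_act p gen_a), (True, Xi_n_act r gen_a)) \<in> pasting_rel n"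
        using pasting_relI(2,3)[of g p n] K by (simp_all only: kappa_p)
      then show ?thesis using subsetD[OF pasting_rel_glued] points by (cases i) simp_all
    qed
    then show ?thesis using False by (simp add: g_def)
  qed
qed

text \<open>An element of G is a product of elements of \<open>G \<inter> nucleus\<close>, all of
  which fix \<xi>, so the identification is a chain of elementary steps over the same \<xi>. By the
  chain rule for sections, the changes of copy add up to the parity of the section of the
  product.\<close>

lemma glued_generated:
  assumes "\<xi> \<in> T0" "G \<in> vertex_groups" "\<And>g. g \<in> G \<Longrightarrow> Xi_act \<xi> g = \<xi>" "h \<in> G" "length v = n"
  shows "(copy_point n \<xi> i v, copy_point n \<xi> (i \<noteq> parity (section_at h v)) (h v)) \<in> glued n"
proof -
  let ?P = "{h \<in> Gamma_group. \<forall>v i. length v = n \<longrightarrow>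
      (copy_point n \<xi> i v, copy_point n \<xi> (i \<noteq> parity (section_at h v)) (h v)) \<in> glued n}"
  have "h \<in> generate Aut_tree (G \<inter> nucleus)"
    using vertex_group_generated[OF assms(2)] assms(4) by blast
  then have "h \<in> ?P"
  proof (rule generate_involutions_induct)
    show "G \<inter> nucleus \<subseteq> involutions" using nucleus_involutions by blast
    have "refl_on (topspace (two_copies n)) (glued n)" by (rule equivE[OF equiv_glued])
    then show "id \<in> ?P" using copy_point_in_two_copies[OF assms(1)] by (simp add: refl_onD)
    fix s p assume s: "s \<in> G \<inter> nucleus" and p: "p \<in> ?P"
    have s_Gamma: "s \<in> Gamma_group" using s nucleus_in_Gamma_group by blast
    have p_Gamma: "p \<in> Gamma_group" using p by blast
    have "(copy_point n \<xi> i u, copy_point n \<xi> (i \<noteq> parity (section_at (s \<circ> p) u)) ((s \<circ> p) u)) \<in> glued n"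
      if u: "length u = n" for u i
    proof -
      let ?j = "i \<noteq> parity (section_at p u)"
      have 1: "(copy_point n \<xi> i u, copy_point n \<xi> ?j (p u)) \<in> glued n" using p u by blast
      have 2: "(copy_point n \<xi> ?j (p u),
          copy_point n \<xi> (?j \<noteq> parity (section_at s (p u))) (s (p u))) \<in> glued n"
        by (rule glued_nucleus_step) (use assms(1,3) s u p_Gamma in auto)
      have "trans (glued n)" by (rule equivE[OF equiv_glued])
      then have "(copy_point n \<xi> i u,
          copy_point n \<xi> (?j \<noteq> parity (section_at s (p u))) (s (p u))) \<in> glued n"
        using 1 2 by (rule transD)
      moreover have "parity (section_at (s \<circ> p) u) \<longleftrightarrow>
          parity (section_at s (p u)) \<noteq> parity (section_at p u)"
        unfolding section_at_comp[OF s_Gamma p_Gamma]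
        by (rule parity_comp) (simp_all add: section_in_Gamma_group s_Gamma p_Gamma)
      then have "(i \<noteq> parity (section_at (s \<circ> p) u)) = (?j \<noteq> parity (section_at s (p u)))"
        by blast
      ultimately show ?thesis by simp
    qed
    then show "s \<circ> p \<in> ?P" using Gamma_group_comp[OF s_Gamma p_Gamma] by blast
  qed
  then show ?thesis using assms(5) by blast
qed

text \<open>Points with equal images differ by an even g, so the tensors of \<xi> and \<eta> are
  related by some k. By \<open>T0_rigid\<close>, \<xi> = \<eta> and k lies in a vertex group that
  fixes \<xi>, to which \<open>glued_generated\<close> applies.\<close>

lemma glued_complete:
  assumes "x \<in> topspace (two_copies n)" "y \<in> topspace (two_copies n)"
    and "copies_proj n x = copies_proj n y"
  shows "(x, y) \<in> glued n"
proof -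
  obtain i \<xi> v where x: "x = copy_point n \<xi> i v" "\<xi> \<in> T0" "length v = n"
    using assms(1) unfolding topspace_two_copies copy_def copy_point_def by blast
  obtain j \<eta> u where y: "y = copy_point n \<eta> j u" "\<eta> \<in> T0" "length u = n"
    using assms(2) unfolding topspace_two_copies copy_def copy_point_def by blast
  have "snd x \<in> topspace (Xi_n n)" "snd y \<in> topspace (Xi_n n)"
    using assms(1,2) by (simp_all add: snd_in_Xi_n)
  then obtain g where g: "g \<in> IMG_group" "snd y = Xi_n_act (snd x) g"
    using assms(3) M_n_proj_eq_iff unfolding copies_proj_def by blast
  note g_Gamma = IMG_group_subset[OF g(1)]
  have "tensor n \<xi> (v, twist i \<circ> g) = tensor n \<eta> (u, twist j)"
    using g(2) x y by (simp add: copy_point_def Xi_n_act_tensor_word g_Gamma)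
  moreover have "(v, twist i \<circ> g) \<in> bimodule n"
    using x(3) g_Gamma by (simp add: bimodule_def Gamma_group_comp)
  ultimately obtain k where k: "k \<in> Gamma_group" "\<xi> = Xi_act \<eta> k"
    "(u, twist j) = bimodule_left k (v, twist i \<circ> g)"
    using tensor_eq_iff[OF T0_in_Xi[OF x(2)] _ T0_in_Xi[OF y(2)] twist_bimodule[OF y(3)]] by blast
  have "\<xi> = \<eta>" by (rule T0_rigid(1)[OF x(2) y(2) k(1,2)])
  obtain G where G: "G \<in> vertex_groups" "k \<in> G" "\<And>g. g \<in> G \<Longrightarrow> Xi_act \<xi> g = \<xi>"
    using T0_rigid(2)[OF x(2) y(2) k(1,2)] by blast
  have u: "u = k v" and twist_j: "twist j = section_at k v \<circ> (twist i \<circ> g)"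
    using k(3) by (simp_all add: bimodule_left_def)
  \<comment> \<open>As g is even, comparing parities shows that k leads exactly to the copy of the
    second point.\<close>
  have "parity (twist j) \<longleftrightarrow> parity (section_at k v) \<noteq> (parity (twist i) \<noteq> parity g)"
    unfolding twist_j
    by (simp add: parity_comp Gamma_group_comp section_in_Gamma_group k(1) g_Gamma)
  then have "j = (i \<noteq> parity (section_at k v))"
    using g(1) by (auto simp: IMG_group_iff)
  then show ?thesis
    using glued_generated[OF x(2) G(1) G(3) G(2) x(3), of i] x(1) y(1) u \<open>\<xi> = \<eta>\<close> by simp
qed

section \<open>Comparison of classes and cells\<close>

lemma pasted_proj_eq_iff:
  assumes "x \<in> topspace (two_copies n)" "y \<in> topspace (two_copies n)"
  shows "pasted_proj n x = pasted_proj n y \<longleftrightarrow> copies_proj n x = copies_proj n y"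
  using glued_sound glued_complete[OF assms]
  unfolding pasted_proj_def quotient_class_eq_iff[OF assms] glued_def by blast

text \<open>By \<open>move_into_copy\<close>, every cell of \<open>Xi_n n\<close> has the same image
  as a cell of one of the copies. So the cells of both complexes are indexed alike: by a chain of
  vertex groups, a word and a copy.\<close>

lemma M_n_cells_eq: "M_n_cells n =
    {(\<lambda>\<xi>. M_n_proj n (tensor n \<xi> (v, twist i))) ` closed_simplex s | s v i.
      s \<in> finite_chains vertex_groups \<and> length v = n}"
proof
  show "M_n_cells n \<subseteq> {(\<lambda>\<xi>. M_n_proj n (tensor n \<xi> (v, twist i))) ` closed_simplex s | s v i.
      s \<in> finite_chains vertex_groups \<and> length v = n}"
  proof
    fix C assume "C \<in> M_n_cells n"
    then obtain s m where s: "s \<in> finite_chains Xi_vertices" "m \<in> bimodule n"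
      "C = M_n_proj n ` (\<lambda>\<xi>. tensor n \<xi> m) ` closed_simplex s"
      unfolding M_n_cells_def Xi_n_cells_def by blast
    obtain t g where t: "t \<in> finite_chains vertex_groups" "g \<in> Gamma_group" "s = translate t g"
      using chain_translate_of_groups[OF s(1)] .
    obtain v i where v: "length v = n" "\<forall>\<xi>\<in>topspace Xi.
        M_n_proj n (tensor n (Xi_act \<xi> g) m) = M_n_proj n (tensor n \<xi> (v, twist i))"
      using move_into_copy[OF t(2) s(2)] by blast
    have "C = (\<lambda>\<xi>. M_n_proj n (tensor n (Xi_act \<xi> g) m)) ` closed_simplex t"
      unfolding s(3) t(3) closed_simplex_translate[OF t(2)] image_image by simp
    also have "\<dots> = (\<lambda>\<xi>. M_n_proj n (tensor n \<xi> (v, twist i))) ` closed_simplex t"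
      using v(2) closed_simplex_T0[OF t(1)] T0_subset_Xi by (intro image_cong) auto
    finally show "C \<in> {(\<lambda>\<xi>. M_n_proj n (tensor n \<xi> (v, twist i))) ` closed_simplex s | s v i.
      s \<in> finite_chains vertex_groups \<and> length v = n}"
      using t(1) v(1) by blast
  qed
  show "{(\<lambda>\<xi>. M_n_proj n (tensor n \<xi> (v, twist i))) ` closed_simplex s | s v i.
      s \<in> finite_chains vertex_groups \<and> length v = n} \<subseteq> M_n_cells n"
  proof
    fix C assume "C \<in> {(\<lambda>\<xi>. M_n_proj n (tensor n \<xi> (v, twist i))) ` closed_simplex s | s v i.
      s \<in> finite_chains vertex_groups \<and> length v = n}"
    then obtain s v i where s: "s \<in> finite_chains vertex_groups" "length v = n"
      "C = (\<lambda>\<xi>. M_n_proj n (tensor n \<xi> (v, twist i))) ` closed_simplex s" by blast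
    have "(\<lambda>\<xi>. tensor n \<xi> (v, twist i)) ` closed_simplex s \<in> Xi_n_cells n"
      unfolding Xi_n_cells_def
      using finite_chains_vertex_groups_Xi[OF s(1)] twist_bimodule[OF s(2)] by blast
    then have "M_n_proj n ` (\<lambda>\<xi>. tensor n \<xi> (v, twist i)) ` closed_simplex s \<in> M_n_cells n"
      unfolding M_n_cells_def by (rule imageI)
    then show "C \<in> M_n_cells n" unfolding s(3) image_image .
  qed
qed

lemma pasted_cells_eq: "pasted_cells n =
    {(\<lambda>\<xi>. pasted_proj n (copy_point n \<xi> i v)) ` closed_simplex s | s v i.
      s \<in> finite_chains vertex_groups \<and> length v = n}"
proof -
  have twisted: "Xi_n_act (tensor n \<xi> (v, id)) gen_a = tensor n \<xi> (v, twist True)"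
    if "s \<in> finite_chains vertex_groups" "\<xi> \<in> closed_simplex s" "length v = n" for s \<xi> v
    using Xi_n_act_twist[of \<xi> v n True] closed_simplex_T0[OF that(1)] that(2,3)
    by (auto simp: twist_def)
  have False_cell: "(\<lambda>p. pasted_proj n (False, p)) ` (\<lambda>\<xi>. tensor n \<xi> (v, id)) ` closed_simplex s =
      (\<lambda>\<xi>. pasted_proj n (copy_point n \<xi> False v)) ` closed_simplex s" for s v
    by (simp add: image_image copy_point_def twist_def)
  have True_cell: "(\<lambda>p. pasted_proj n (True, Xi_n_act p gen_a)) `
      (\<lambda>\<xi>. tensor n \<xi> (v, id)) ` closed_simplex s =
      (\<lambda>\<xi>. pasted_proj n (copy_point n \<xi> True v)) ` closed_simplex s"
    if "s \<in> finite_chains vertex_groups" "length v = n" for s v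
    unfolding image_image copy_point_def using twisted[OF that(1) _ that(2)]
    by (intro image_cong) simp_all
  show ?thesis (is "_ = ?R")
  proof
    show "pasted_cells n \<subseteq> ?R"
    proof
      fix C assume "C \<in> pasted_cells n"
      then obtain s v where s: "s \<in> finite_chains vertex_groups" "length v = n"
        "C = (\<lambda>p. pasted_proj n (False, p)) ` (\<lambda>\<xi>. tensor n \<xi> (v, id)) ` closed_simplex s \<or>
         C = (\<lambda>p. pasted_proj n (True, Xi_n_act p gen_a)) ` (\<lambda>\<xi>. tensor n \<xi> (v, id)) ` closed_simplex s"
        unfolding pasted_cells_def T_n_cells_def by blast
      then have "C = (\<lambda>\<xi>. pasted_proj n (copy_point n \<xi> False v)) ` closed_simplex s \<or>
          C = (\<lambda>\<xi>. pasted_proj n (copy_point n \<xi> True v)) ` closed_simplex s"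
        unfolding False_cell True_cell[OF s(1,2)] by blast
      then show "C \<in> ?R" using s(1,2) by blast
    qed
    show "?R \<subseteq> pasted_cells n"
    proof
      fix C assume "C \<in> ?R"
      then obtain s v i where s: "s \<in> finite_chains vertex_groups" "length v = n"
        "C = (\<lambda>\<xi>. pasted_proj n (copy_point n \<xi> i v)) ` closed_simplex s" by blast
      have cell: "(\<lambda>\<xi>. tensor n \<xi> (v, id)) ` closed_simplex s \<in> T_n_cells n"
        unfolding T_n_cells_def using s(1,2) by blast
      show "C \<in> pasted_cells n"
      proof (cases i)
        case True
        then have "C = (\<lambda>p. pasted_proj n (True, Xi_n_act p gen_a)) ` (\<lambda>\<xi>. tensor n \<xi> (v, id)) ` closed_simplex s"
          using s(3) True_cell[OF s(1,2)] by simp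
        then show ?thesis using cell unfolding pasted_cells_def by blast
      next
        case False
        then have "C = (\<lambda>p. pasted_proj n (False, p)) ` (\<lambda>\<xi>. tensor n \<xi> (v, id)) ` closed_simplex s"
          using s(3) False_cell by simp
        then show ?thesis using cell unfolding pasted_cells_def by blast
      qed
    qed
  qed
qed

theorem proposition5p8:
  fixes n :: nat
  shows "\<exists>h. homeomorphic_map (pasted n) (M_n n) h
    \<and> (\<forall>p \<in> T_n n. h (pasted_proj n (False, p)) = M_n_proj n p
        \<and> h (pasted_proj n (True, Xi_n_act p gen_a)) = M_n_proj n (Xi_n_act p gen_a))
    \<and> (\<lambda>c. h ` c) ` pasted_cells n = M_n_cells n"
proof -
  let ?X = "two_copies n"
  have quot: "quotient_map ?X (pasted n) (pasted_proj n)"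
    unfolding pasted_def pasted_proj_def by (rule quotient_map_quotient_space)
  have compatible: "copies_proj n x = copies_proj n y"
    if "x \<in> topspace ?X" "y \<in> topspace ?X" "pasted_proj n x = pasted_proj n y" for x y
    using that by (simp add: pasted_proj_eq_iff)
  \<comment> \<open>Points with the same class have the same image, so \<open>copies_proj n\<close>
    descends to the pasted space.\<close>
  have "\<exists>h. \<forall>x\<in>topspace ?X. h (pasted_proj n x) = copies_proj n x"
    by (rule quotient_map_lift_exists[OF quot quotient_imp_continuous_map[OF quotient_map_copies_proj]
          compatible]) blast+
  then obtain h where h: "\<And>x. x \<in> topspace ?X \<Longrightarrow> h (pasted_proj n x) = copies_proj n x"
    by blast
  have "quotient_map ?X (M_n n) (h \<circ> pasted_proj n)"
    by (rule quotient_map_eq[OF quotient_map_copies_proj]) (simp add: h)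
  \<comment> \<open>The composition and its first factor are quotient maps, hence so is
    \<open>h\<close>. Together with injectivity, which is the completeness of the pasting, this
    makes \<open>h\<close> a homeomorphism.\<close>
  then have "quotient_map (pasted n) (M_n n) h"
    using quotient_map_compose_eq[OF quot] by blast
  moreover have "inj_on h (topspace (pasted n))"
    unfolding quotient_imp_surjective_map[OF quot, symmetric]
    by (auto simp: inj_on_def h pasted_proj_eq_iff)
  ultimately have "homeomorphic_map (pasted n) (M_n n) h"
    by (simp add: homeomorphic_map_def)
  moreover have "\<forall>p \<in> T_n n. h (pasted_proj n (False, p)) = M_n_proj n p
        \<and> h (pasted_proj n (True, Xi_n_act p gen_a)) = M_n_proj n (Xi_n_act p gen_a)"
    using h mem_topspace_two_copies by (simp add: copies_proj_def)
  moreover have "(\<lambda>c. h ` c) ` pasted_cells n = M_n_cells n"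
  proof -
    have h_cell: "h ` (\<lambda>\<xi>. pasted_proj n (copy_point n \<xi> i v)) ` closed_simplex s =
        (\<lambda>\<xi>. M_n_proj n (tensor n \<xi> (v, twist i))) ` closed_simplex s"
      if "s \<in> finite_chains vertex_groups" "length v = n" for s v i
      unfolding image_image
    proof (rule image_cong)
      fix \<xi> assume "\<xi> \<in> closed_simplex s"
      then have "\<xi> \<in> T0" using closed_simplex_T0[OF that(1)] by blast
      then show "h (pasted_proj n (copy_point n \<xi> i v)) = M_n_proj n (tensor n \<xi> (v, twist i))"
        using h[OF copy_point_in_two_copies[OF _ that(2)]] by (simp add: copies_proj_def copy_point_def)
    qed simp
    show ?thesis unfolding pasted_cells_eq M_n_cells_eq
    proof (intro equalityI subsetI)
      fix C assume "C \<in> (\<lambda>c. h ` c) ` {(\<lambda>\<xi>. pasted_proj n (copy_point n \<xi> i v)) ` closed_simplex s | s v i.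
        s \<in> finite_chains vertex_groups \<and> length v = n}"
      then show "C \<in> {(\<lambda>\<xi>. M_n_proj n (tensor n \<xi> (v, twist i))) ` closed_simplex s | s v i.
        s \<in> finite_chains vertex_groups \<and> length v = n}"
        using h_cell by blast
    next
      fix C assume "C \<in> {(\<lambda>\<xi>. M_n_proj n (tensor n \<xi> (v, twist i))) ` closed_simplex s | s v i.
        s \<in> finite_chains vertex_groups \<and> length v = n}"
      then obtain s v i where s: "s \<in> finite_chains vertex_groups" "length v = n"
        "C = (\<lambda>\<xi>. M_n_proj n (tensor n \<xi> (v, twist i))) ` closed_simplex s" by blast
      then have "C = h ` (\<lambda>\<xi>. pasted_proj n (copy_point n \<xi> i v)) ` closed_simplex s"
        using h_cell by simp
      then show "C \<in> (\<lambda>c. h ` c) ` {(\<lambda>\<xi>. pasted_proj n (copy_point n \<xi> i v)) ` closed_simplex s | s v i.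
        s \<in> finite_chains vertex_groups \<and> length v = n}"
        using s(1,2) by blast
    qed
  qed
  ultimately show ?thesis by blast
qed

end
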